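(* Let $N,k\ge1$, let $\bar\rho=(\bar\rho_1,\dots,\bar\rho_k)\in\mathcal{M}^+(\mathbb{R}^N)^k$, let $V=(V_1,\dots,V_k)\in(L^\infty\cap\mathrm{Lip})(\mathbb{R}^N\times\mathbb{R}^k,\mathbb{R}^{N\times k})$ with $V_i:\mathbb{R}^N\times\mathbb{R}^k\to\mathbb{R}^N$, and let $\eta=(\eta_{i,j})\in(L^\infty\cap\mathrm{Lip})(\mathbb{R}^N,\mathbb{R}^{k\times k})$. Then weak measure solutions of the system $$\partial_t\rho_i+\mathrm{div}\big(\rho_i\,V_i(x,\rho_1*\eta_{i,1},\dots,\rho_k*\eta_{i,k})\big)=0,\qquad \rho_i(0)=\bar\rho_i,\qquad i\in\{1,\dots,k\},$$ are unique: for every $T>0$, any two weak measure solutions $\rho,\tilde\rho\in L^\infty([0,T],\mathcal{M}^+(\mathbb{R}^N)^k)$ with the same initial condition $\bar\rho$ satisfy $\rho_t=\tilde\rho_t$ for a.e. $t\in[0,T]$.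
   Context: $\mathcal{M}^+(\mathbb{R}^N)$ is the set of positive measures on $\mathbb{R}^N$ with finite total mass. $\mathrm{Lip}$ denotes globally Lipschitz functions. $(\mu*\eta_{i,j})(x)=\int_{\mathbb{R}^N}\eta_{i,j}(x-y)\,d\mu(y)$. Weak measure solution: $\rho\in L^\infty([0,T],\mathcal{M}^+(\mathbb{R}^N)^k)$ is a weak measure solution with initial condition $\bar\rho$ if for every $i\in\{1,\dots,k\}$ and every $\phi\in C_c^\infty(]-\infty,T[\times\mathbb{R}^N,\mathbb{R})$, $$\int_0^T\int_{\mathbb{R}^N}\big[\partial_t\phi+V_i(x,\rho_{1,t}*\eta_{i,1}(x),\dots,\rho_{k,t}*\eta_{i,k}(x))\cdot\nabla\phi\big]\,d\rho_{i,t}(x)\,dt+\int_{\mathbb{R}^N}\phi(0,x)\,d\bar\rho_i(x)=0 .$$ Elements of $L^\infty([0,T],\cdot)$ are identified when equal for a.e. $t$. *)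

theory Defs
  imports "HOL-Analysis.Analysis"
begin

text \<open>Finite positive Borel measures.\<close>

definition Mplus :: "'a::topological_space measure set" where
  "Mplus = {\<mu>. sets \<mu> = sets borel \<and> finite_measure \<mu>}"

definition Linfty :: "('a::euclidean_space \<Rightarrow> 'b::euclidean_space) set" where
  "Linfty = {f. f \<in> borel_measurable lebesgue \<and> (\<exists>C. AE x in lebesgue. norm (f x) \<le> C)}"

definition Lip :: "('a::metric_space \<Rightarrow> 'b::metric_space) set" where
  "Lip = {f. \<exists>L. L-lipschitz_on UNIV f}"

text \<open>Representatives of elements of \<open>L\<^sup>\<infinity>([0,T], M\<^sup>+(R\<^sup>N)\<^sup>k)\<close>. Measurability in time is weak-star
  measurability, i.e. it is tested against the predual \<open>C\<^sub>0(R\<^sup>N)\<close> of the finite signed measures;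
  the total mass, which is the total variation norm of a positive measure, is essentially bounded.
  Values outside \<open>[0,T]\<close> are irrelevant.\<close>

definition Linfty_Mplus :: "real \<Rightarrow> (real \<Rightarrow> 'k \<Rightarrow> 'a::euclidean_space measure) set" where
  "Linfty_Mplus T = {\<rho>.
     (\<forall>t\<in>{0..T}. \<forall>i. \<rho> t i \<in> Mplus) \<and>
     (\<forall>i. \<forall>f::'a \<Rightarrow> real. continuous_on UNIV f \<longrightarrow> (f \<longlongrightarrow> 0) at_infinity \<longrightarrow>
        (\<lambda>t. \<integral>x. f x \<partial>\<rho> t i) \<in> borel_measurable (lebesgue_on {0..T})) \<and>
     (\<exists>C. AE t in lebesgue_on {0..T}. \<forall>i. measure (\<rho> t i) UNIV \<le> C)}"

definition conv :: "'a::euclidean_space measure \<Rightarrow> ('a \<Rightarrow> real) \<Rightarrow> 'a \<Rightarrow> real" where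
  "conv \<mu> \<eta> x = (\<integral>y. \<eta> (x - y) \<partial>\<mu>)"

primrec Ck :: "nat \<Rightarrow> ('a::euclidean_space \<Rightarrow> real) \<Rightarrow> bool" where
  "Ck 0 f \<longleftrightarrow> continuous_on UNIV f"
| "Ck (Suc n) f \<longleftrightarrow> (\<forall>x. f differentiable at x) \<and>
     (\<forall>b\<in>Basis. Ck n (\<lambda>x. frechet_derivative f (at x) b))"

text \<open>\<open>C\<^sub>c\<^sup>\<infinity>(U)\<close> for open \<open>U\<close>, each function being extended by zero to the whole space.\<close>

definition test_functions :: "'a::euclidean_space set \<Rightarrow> ('a \<Rightarrow> real) set" where
  "test_functions U = {\<phi>. (\<forall>n. Ck n \<phi>) \<and>
     compact (closure {p. \<phi> p \<noteq> 0}) \<and> closure {p. \<phi> p \<noteq> 0} \<subseteq> U}"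

definition dt :: "(real \<times> 'a \<Rightarrow> real) \<Rightarrow> real \<Rightarrow> 'a \<Rightarrow> real" where
  "dt \<phi> t x = deriv (\<lambda>s. \<phi> (s, x)) t"

definition grad :: "(real \<times> (real^'n) \<Rightarrow> real) \<Rightarrow> real \<Rightarrow> real^'n \<Rightarrow> real^'n" where
  "grad \<phi> t x = (\<chi> l. frechet_derivative (\<lambda>y. \<phi> (t, y)) (at x) (axis l 1))"

text \<open>\<open>velocity V \<eta> \<mu> i x\<close> is \<open>V\<^sub>i(x, \<mu>\<^sub>1 * \<eta>\<^bsub>i,1\<^esub>(x), \<dots>, \<mu>\<^sub>k * \<eta>\<^bsub>i,k\<^esub>(x))\<close>.\<close>

definition velocity :: "((real^'n) \<times> (real^'k) \<Rightarrow> (real^'n)^'k) \<Rightarrow> (real^'n \<Rightarrow> (real^'k)^'k)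
    \<Rightarrow> ('k \<Rightarrow> (real^'n) measure) \<Rightarrow> 'k \<Rightarrow> real^'n \<Rightarrow> real^'n" where
  "velocity V \<eta> \<mu> i x = V (x, \<chi> j. conv (\<mu> j) (\<lambda>z. \<eta> z $ i $ j) x) $ i"

definition weak_measure_solution ::
  "real \<Rightarrow> ((real^'n) \<times> (real^'k) \<Rightarrow> (real^'n)^'k) \<Rightarrow> (real^'n \<Rightarrow> (real^'k)^'k)
    \<Rightarrow> ('k \<Rightarrow> (real^'n) measure) \<Rightarrow> (real \<Rightarrow> 'k \<Rightarrow> (real^'n) measure) \<Rightarrow> bool" where
  "weak_measure_solution T V \<eta> \<rho>0 \<rho> \<longleftrightarrow> \<rho> \<in> Linfty_Mplus T \<and>
     (\<forall>i. \<forall>\<phi>\<in>test_functions ({..<T} \<times> UNIV).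
        (\<integral>t. (\<integral>x. dt \<phi> t x + velocity V \<eta> (\<rho> t) i x \<bullet> grad \<phi> t x \<partial>\<rho> t i) \<partial>lebesgue_on {0..T})
        + (\<integral>x. \<phi> (0, x) \<partial>\<rho>0 i) = 0)"

end

theory Submission
  imports Defs "HOL-Probability.Giry_Monad"
begin

text \<open>The proof is by duality with explicit Euler steps, so that no flow of the (merely Lipschitz)
  velocity is needed. Testing the equation with products \<open>\<theta>(t) \<psi>(x)\<close> and the lemma of du Bois-Reymond
  identify \<open>\<integral>\<psi> d\<rho>\<^sub>t\<close>, for a.e. \<open>t\<close>, with a function of \<open>t\<close> that is Lipschitz with constant
  proportional to \<open>Lip(\<psi>)\<close>. Let \<open>\<Delta>\<^sub>t(\<psi>)\<close> be the difference of these functions for two solutions.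
  Pulling \<open>\<psi>\<close> back through \<open>m\<close> steps \<open>x \<mapsto> x + h g(x)\<close>, where \<open>h = t/m\<close> and \<open>g\<close> is the velocity of the
  first solution, frozen in time and mollified at scale \<open>\<epsilon>\<close>, bounds \<open>\<Delta>\<^sub>t(\<psi>)\<close> by
  \<open>C Lip(\<psi>)\<close> times the time integral of the sup distance of the two velocities, plus errors that
  vanish as \<open>m \<rightarrow> \<infinity>\<close> and then \<open>\<epsilon> \<rightarrow> 0\<close>. That distance is itself bounded by
  \<open>C sup {\<bar>\<Delta>\<^sub>s(\<psi>)\<bar> : Lip(\<psi>) \<le> 1}\<close>, since the convolution kernels are Lipschitz, and a Gronwall
  argument in the norm weighted by \<open>exp(-\<gamma> t)\<close> gives \<open>\<Delta> = 0\<close>.\<close>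

section \<open>Smooth functions\<close>

text \<open>Two obstacles shape the estimates. Mollified kernels need not have compact support, so
  the weak equation is first extended from test functions to the class \<open>C11\<close> of bounded
  functions with bounded, Lipschitz derivative; this class is stable under pullback through a step,
  with two constants to track. Secondly, mollifying the velocity keeps its Lipschitz constant
  \<open>Lb\<close> but gives its derivative a Lipschitz constant that depends on the scale. Such
  second-order constants enter a step only with the factor h^2, so that over all steps they
  contribute O(h) at fixed scale, whereas Lip(psi) grows at most by (1 + h Lb)^m <= exp(Lb T). This
  dictates the order of the two limits. The Gronwall argument is a halving: a bound A exp(gamma t)
  Lip(psi) on the difference implies the same bound with A/2, because summing h exp(gamma s) over
  the steps gains a factor 3/gamma and gamma exceeds six times the remaining constant.\<close>

lemma Ck_SucI:
  fixes f :: "'a::euclidean_space \<Rightarrow> real"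
  assumes "\<And>x. (f has_derivative f' x) (at x)" "\<And>b. b \<in> Basis \<Longrightarrow> Ck n (\<lambda>x. f' x b)"
  shows "Ck (Suc n) f"
proof -
  have "frechet_derivative f (at x) = f' x" for x
    using frechet_derivative_at[OF assms(1)] by simp
  then show ?thesis
    using assms by (auto simp: differentiable_def)
qed

lemma Ck_Suc_has_derivative:
  "Ck (Suc n) f \<Longrightarrow> (f has_derivative frechet_derivative f (at x)) (at x)"
  by (simp add: frechet_derivative_works[symmetric])

lemma Ck_SucD: "Ck (Suc n) f \<Longrightarrow> Ck n f"
proof (induction n arbitrary: f)
  case 0
  then show ?case
    by (auto intro!: differentiable_imp_continuous_on simp: differentiable_on_def)
next
  case (Suc n)
  then show ?case by (metis Ck.simps(2))
qed

lemma Ck_imp_continuous_on: "Ck n f \<Longrightarrow> continuous_on S f"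
proof (induction n)
  case 0
  then show ?case by (auto intro: continuous_on_subset)
next
  case (Suc n)
  then show ?case using Ck_SucD by blast
qed

lemma Ck_const: "Ck n (\<lambda>x::'a::euclidean_space. c)"
proof (induction n arbitrary: c)
  case (Suc n)
  show ?case
    by (rule Ck_SucI[where f' = "\<lambda>x v. 0"]) (auto intro: Suc)
qed simp

lemma Ck_add: "Ck n f \<Longrightarrow> Ck n g \<Longrightarrow> Ck n (\<lambda>x. f x + g x)"
proof (induction n arbitrary: f g)
  case (Suc n)
  show ?case
    by (rule Ck_SucI[OF has_derivative_add[OF Ck_Suc_has_derivative[OF Suc.prems(1)]
            Ck_Suc_has_derivative[OF Suc.prems(2)]]])
      (use Suc in auto)
qed (auto intro: continuous_intros)

lemma Ck_mult: "Ck n f \<Longrightarrow> Ck n g \<Longrightarrow> Ck n (\<lambda>x. f x * g x)"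
proof (induction n arbitrary: f g)
  case (Suc n)
  show ?case
    by (rule Ck_SucI[OF has_derivative_mult[OF Ck_Suc_has_derivative[OF Suc.prems(1)]
            Ck_Suc_has_derivative[OF Suc.prems(2)]]])
      (use Suc Ck_SucD in \<open>auto intro!: Ck_add Suc.IH\<close>)
qed (auto intro: continuous_intros)

lemma Ck_exp: "Ck n f \<Longrightarrow> Ck n (\<lambda>x. exp (f x))"
proof (induction n arbitrary: f)
  case (Suc n)
  show ?case
    by (rule Ck_SucI[OF has_derivative_exp[OF Ck_Suc_has_derivative[OF Suc.prems(1)]]])
      (use Suc Ck_SucD in \<open>auto intro!: Ck_mult Suc.IH\<close>)
qed (auto intro: continuous_intros)

lemma Ck_inner: "Ck n (\<lambda>x::'a::euclidean_space. x \<bullet> b)"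
proof (induction n)
  case (Suc n)
  show ?case
    by (rule Ck_SucI[where f' = "\<lambda>x v. v \<bullet> b"])
      (auto intro!: Ck_const derivative_eq_intros)
qed (auto intro: continuous_intros)

lemma Ck_sum: "finite I \<Longrightarrow> (\<And>i. i \<in> I \<Longrightarrow> Ck n (f i)) \<Longrightarrow> Ck n (\<lambda>x. \<Sum>i\<in>I. f i x)"
  by (induction I rule: finite_induct) (auto intro: Ck_const Ck_add)

lemma linear_eq_sum_Basis:
  fixes f :: "'a::euclidean_space \<Rightarrow> real"
  assumes "linear f"
  shows "f v = (\<Sum>b\<in>Basis. (v \<bullet> b) * f b)"
proof -
  have "f v = f (\<Sum>b\<in>Basis. (v \<bullet> b) *\<^sub>R b)" by (simp add: euclidean_representation)
  then show ?thesis by (simp add: linear_sum[OF assms] linear_cmul[OF assms])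
qed

lemma Ck_compose_affine:
  fixes f :: "'b::euclidean_space \<Rightarrow> real" and h :: "'a::euclidean_space \<Rightarrow> 'b"
  assumes h: "linear h"
  shows "Ck n f \<Longrightarrow> Ck n (\<lambda>x. f (h x + a))"
proof (induction n arbitrary: f)
  case 0
  have "continuous_on UNIV h" using h by (simp add: linear_continuous_on linear_conv_bounded_linear)
  then have "continuous_on UNIV (\<lambda>x. h x + a)" by (intro continuous_intros)
  from continuous_on_compose2[OF _ this, of UNIV f] 0 show ?case by simp
next
  case (Suc n)
  have "((\<lambda>x. h x + a) has_derivative h) (at x)" for x
    using bounded_linear_imp_has_derivative[of h] h
    by (auto intro!: derivative_eq_intros simp: linear_conv_bounded_linear)
  from has_derivative_compose[OF this Ck_Suc_has_derivative[OF Suc.prems]]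
  have D: "((\<lambda>x. f (h x + a)) has_derivative (\<lambda>v. frechet_derivative f (at (h x + a)) (h v))) (at x)" for x .
  show ?case
  proof (rule Ck_SucI[OF D])
    fix b :: 'a
    \<comment> \<open>\<open>Ck\<close> speaks only of derivatives along basis vectors, while
      \<open>h b\<close> is an arbitrary vector; it is expanded in the basis.\<close>
    have "Ck n (\<lambda>x. \<Sum>c\<in>Basis. (h b \<bullet> c) * frechet_derivative f (at (h x + a)) c)"
      using Suc by (intro Ck_sum Ck_mult Ck_const finite_Basis) auto
    then show "Ck n (\<lambda>x. frechet_derivative f (at (h x + a)) (h b))"
      by (subst linear_eq_sum_Basis[OF has_derivative_linear[OF Ck_Suc_has_derivative[OF Suc.prems]]])
  qed
qed

lemmas Ck_fst = Ck_compose_affine[OF linear_fst, where a=0, simplified]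
lemmas Ck_snd = Ck_compose_affine[OF linear_snd, where a=0, simplified]
lemmas Ck_translate = Ck_compose_affine[OF linear_id, simplified]

text \<open>Derivatives of members of this family are linear combinations of members, so smoothness of
  \<open>exp(-1/x)\<close> at \<open>0\<close> becomes a single induction.\<close>

definition flat :: "nat \<Rightarrow> real \<Rightarrow> real" where
  "flat k x = (if x > 0 then (1/x)^k * exp (- (1/x)) else 0)"

lemma flat_tendsto_0: "(flat k \<longlongrightarrow> 0) (at 0)"
proof -
  have "((\<lambda>x. x ^ k / exp x) \<longlongrightarrow> 0) (at_top::real filter)"
    by (rule tendsto_power_div_exp_0)
  then have "((\<lambda>x. (inverse x) ^ k / exp (inverse x)) \<longlongrightarrow> 0) (at_right (0::real))"
    by (rule filterlim_compose) (rule filterlim_inverse_at_top_right)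
  then have "(flat k \<longlongrightarrow> 0) (at_right 0)"
    by (rule Lim_transform_eventually)
      (rule eventually_mono[OF eventually_at_right_less[of 0]],
        simp add: flat_def exp_minus divide_inverse)
  moreover have "(flat k \<longlongrightarrow> 0) (at_left 0)"
    by (rule Lim_transform_eventually[OF tendsto_const])
      (simp add: eventually_at_filter flat_def)
  ultimately show ?thesis
    by (simp add: filterlim_split_at_real)
qed

lemma flat_has_real_derivative:
  "(flat k has_real_derivative flat (Suc (Suc k)) x - real k * flat (Suc k) x) (at x)"
proof -
  consider "x > 0" | "x < 0" | "x = 0" by linarith
  then show ?thesis
  proof cases
    case 1
    have "((\<lambda>x. (1/x)^k * exp (- (1/x))) has_real_derivative
        real k * (1/x)^(k - 1) * (- (1/x\<^sup>2)) * exp (- (1/x)) + (1/x)^k * (exp (- (1/x)) * (1/x\<^sup>2))) (at x)"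
      using 1 by (auto intro!: derivative_eq_intros simp: power2_eq_square)
    also have "real k * (1/x)^(k - 1) * (- (1/x\<^sup>2)) * exp (- (1/x)) + (1/x)^k * (exp (- (1/x)) * (1/x\<^sup>2))
        = flat (Suc (Suc k)) x - real k * flat (Suc k) x"
      using 1 by (cases k) (simp_all add: flat_def power2_eq_square)
    finally have "((\<lambda>x. (1/x)^k * exp (- (1/x))) has_real_derivative
        flat (Suc (Suc k)) x - real k * flat (Suc k) x) (at x)" .
    moreover have "\<forall>\<^sub>F y in nhds x. (1/y)^k * exp (- (1/y)) = flat k y"
      using 1 by (intro eventually_mono[OF eventually_nhds_in_open[of "{0<..}" x]]) (auto simp: flat_def)
    ultimately show ?thesis
      by (rule iffD1[OF DERIV_cong_ev[OF refl _ refl], rotated])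
  next
    case 2
    have "\<forall>\<^sub>F y in nhds x. 0 = flat k y"
      using 2 by (intro eventually_mono[OF eventually_nhds_in_open[of "{..<0}" x]]) (auto simp: flat_def)
    then show ?thesis
      using DERIV_cong_ev[of x x "\<lambda>_. 0" "flat k" 0 0] 2 by (simp add: flat_def)
  next
    case 3
    \<comment> \<open>At 0 the difference quotient of \<open>flat k\<close> is
      \<open>flat (Suc k)\<close> itself.\<close>
    have "((\<lambda>h. (flat k (0 + h) - flat k 0) / h) \<longlongrightarrow> 0) (at 0)"
      by (rule Lim_transform_eventually[OF flat_tendsto_0[of "Suc k"]])
        (simp add: flat_def eventually_at_filter)
    then show ?thesis
      using 3 by (simp add: DERIV_def flat_def)
  qed
qed

text \<open>Differentiating leads to higher members of the family, so the induction leaves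
  \<open>k\<close> free. Smoothness of \<open>q\<close> of every order serves both the induction
  hypothesis and the inner derivative.\<close>

lemma Ck_flat: "(\<And>m. Ck m q) \<Longrightarrow> Ck n (\<lambda>x. flat k (q x))"
proof (induction n arbitrary: k)
  case 0
  have "continuous_on UNIV (flat k)"
    by (intro continuous_at_imp_continuous_on ballI DERIV_isCont[OF flat_has_real_derivative])
  moreover have "continuous_on UNIV q" using 0[of 0] by simp
  ultimately show ?case
    by (auto intro: continuous_on_compose2)
next
  case (Suc n)
  have D: "((\<lambda>x. flat k (q x)) has_derivative
    (\<lambda>v. (flat (Suc (Suc k)) (q x) + (- real k) * flat (Suc k) (q x)) * frechet_derivative q (at x) v)) (at x)" for x
    using has_derivative_compose[OF Ck_Suc_has_derivative[OF Suc.prems]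
        flat_has_real_derivative[of k, unfolded has_field_derivative_def], of x]
    by simp
  show ?case
  proof (rule Ck_SucI[OF D])
    fix b :: 'a assume "b \<in> Basis"
    then have "Ck n (\<lambda>x. frechet_derivative q (at x) b)"
      using Suc.prems[of "Suc n"] by simp
    then show "Ck n (\<lambda>x. (flat (Suc (Suc k)) (q x) + (- real k) * flat (Suc k) (q x)) * frechet_derivative q (at x) b)"
      by (intro Ck_mult Ck_add Suc.IH Ck_const Suc.prems)
  qed
qed

text \<open>The standard bump exp(-1/(1 - |x|^2/r^2)) on the ball of radius \<open>r\<close>. Its
  maximum is exp(-1), not 1; the cutoff in \<open>test_function_approx\<close> compensates for
  this.\<close>

definition bump :: "real \<Rightarrow> 'a::euclidean_space \<Rightarrow> real" where
  "bump r x = flat 0 (1 - (x \<bullet> x) / r\<^sup>2)"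

lemma Ck_bump: "Ck n (\<lambda>x::'a::euclidean_space. bump r (x - a))"
proof -
  have "Ck m (\<lambda>x::'a. 1 + (- (1/r\<^sup>2)) * (\<Sum>b\<in>Basis. ((x \<bullet> b) + (- (a \<bullet> b))) * ((x \<bullet> b) + (- (a \<bullet> b)))))" for m
    by (intro Ck_add Ck_mult Ck_const Ck_sum finite_Basis Ck_inner)
  also have "(\<lambda>x::'a. 1 + (- (1/r\<^sup>2)) * (\<Sum>b\<in>Basis. ((x \<bullet> b) + (- (a \<bullet> b))) * ((x \<bullet> b) + (- (a \<bullet> b)))))
     = (\<lambda>x. 1 - ((x - a) \<bullet> (x - a)) / r\<^sup>2)"
    by (rule ext) (subst euclidean_inner, simp add: inner_diff_left)
  finally show ?thesis
    unfolding bump_def by (rule Ck_flat)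
qed

lemma bump_nonneg: "bump r x \<ge> 0"
  by (simp add: bump_def flat_def)

lemma bump_le_1: "bump r x \<le> 1"
  by (simp add: bump_def flat_def)

lemma bump_pos_iff: "r > 0 \<Longrightarrow> bump r x > 0 \<longleftrightarrow> norm x < r"
  by (simp add: bump_def flat_def power2_norm_eq_inner[symmetric] abs_square_less_1 power_divide[symmetric])

lemma bump_eq_0: "r > 0 \<Longrightarrow> norm x \<ge> r \<Longrightarrow> bump r x = 0"
  using bump_pos_iff[of r x] bump_nonneg[of r x] by linarith

section \<open>Differentiation under the integral and functions with Lipschitz derivative\<close>

lemma continuous_on_of_norm_lipschitz:
  assumes "0 \<le> L" "\<And>x y. norm (f x - f y) \<le> L * norm (x - y)"
  shows "continuous_on S f"
  using assms by (intro lipschitz_on_continuous_on[of L] lipschitz_onI) (auto simp: dist_norm)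

lemma norm_integral_le_AE:
  fixes f :: "'a \<Rightarrow> 'b::{banach, second_countable_topology}"
  assumes "integrable M g" "AE x in M. norm (f x) \<le> g x"
  shows "norm (\<integral>x. f x \<partial>M) \<le> (\<integral>x. g x \<partial>M)"
proof -
  have "(\<integral>x. norm (f x) \<partial>M) \<le> (\<integral>x. g x \<partial>M)"
    using assms by (intro integral_mono_AE') (auto intro: order_trans[OF norm_ge_zero])
  then show ?thesis
    using integral_norm_bound[of M f] by linarith
qed

text \<open>An integrable quadratic remainder takes the place of a limit theorem. Restricting to
  \<open>norm v \<le> 1\<close> allows a majorant \<open>\<omega>\<close> of compact support when
  the derivative falls on a kernel.\<close>

lemma has_derivative_integral_quadratic:
  fixes G :: "'a::euclidean_space \<Rightarrow> 'y \<Rightarrow> 'b::euclidean_space" and D :: "'a \<Rightarrow> 'y \<Rightarrow> 'b"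
  assumes G: "\<And>v. norm v \<le> 1 \<Longrightarrow> integrable M (G (x + v))"
    and D: "\<And>v. integrable M (D v)"
    and lin: "\<And>y. linear (\<lambda>v. D v y)"
    and \<omega>: "integrable M \<omega>"
    and bound: "\<And>v y. norm v \<le> 1 \<Longrightarrow> norm (G (x + v) y - G x y - D v y) \<le> \<omega> y * (norm v)\<^sup>2"
  shows "((\<lambda>x. \<integral>y. G x y \<partial>M) has_derivative (\<lambda>v. \<integral>y. D v y \<partial>M)) (at x)"
proof (rule has_derivativeI_sandwich[where e=1])
  have "linear (\<lambda>v. \<integral>y. D v y \<partial>M)"
    using D by (intro linearI) (simp_all add: linear_add[OF lin] linear_cmul[OF lin])
  then show "bounded_linear (\<lambda>v. \<integral>y. D v y \<partial>M)"
    by (rule linear_conv_bounded_linear[THEN iffD1])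
  show "norm ((\<integral>y. G z y \<partial>M) - (\<integral>y. G x y \<partial>M) - (\<integral>y. D (z - x) y \<partial>M)) / norm (z - x)
      \<le> (\<integral>y. \<omega> y \<partial>M) * norm (z - x)" if "z \<noteq> x" "dist z x < 1" for z
  proof -
    define v where "v = z - x"
    have v: "norm v \<le> 1" "z = x + v" "v \<noteq> 0"
      using that by (auto simp: v_def dist_norm)
    have "norm (\<integral>y. G (x + v) y - G x y - D v y \<partial>M) \<le> (\<integral>y. \<omega> y * (norm v)\<^sup>2 \<partial>M)"
      using v \<omega> bound by (intro norm_integral_le_AE) auto
    then have "norm ((\<integral>y. G (x + v) y \<partial>M) - (\<integral>y. G x y \<partial>M) - (\<integral>y. D v y \<partial>M)) \<le> (\<integral>y. \<omega> y \<partial>M) * (norm v)\<^sup>2"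
      using G[of v] G[of 0] D[of v] v by simp
    then show ?thesis
      using v by (simp add: divide_simps power2_eq_square mult_ac)
  qed
  show "((\<lambda>z. (\<integral>y. \<omega> y \<partial>M) * norm (z - x)) \<longlongrightarrow> 0) (at x)"
    by (auto intro!: tendsto_eq_intros)
qed simp

text \<open>\<open>L\<close> and \<open>K\<close> are recorded separately because the final estimate
  may contain \<open>L\<close>, while \<open>K\<close> has to disappear with the step size.
  Boundedness is only qualitative, since the sup norm of \<open>f\<close> never enters the stability
  estimate. \<open>f'\<close> takes values in bounded linear maps so that differences of derivatives
  have an operator norm.\<close>

definition C11 :: "real \<Rightarrow> real \<Rightarrow> ('a::euclidean_space \<Rightarrow> 'b::euclidean_space) \<Rightarrow> ('a \<Rightarrow> 'a \<Rightarrow>\<^sub>L 'b) \<Rightarrow> bool" where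
  "C11 L K f f' \<longleftrightarrow> bounded (range f) \<and> (\<forall>x. (f has_derivative blinfun_apply (f' x)) (at x)) \<and>
     (\<forall>x. norm (f' x) \<le> L) \<and> (\<forall>x y. norm (f' x - f' y) \<le> K * norm (x - y))"

lemma C11_has_derivative: "C11 L K f f' \<Longrightarrow> (f has_derivative blinfun_apply (f' x)) (at x within S)"
  by (simp add: C11_def has_derivative_at_withinI)

lemma C11_norm_le: "C11 L K f f' \<Longrightarrow> norm (f' x) \<le> L"
  by (simp add: C11_def)

lemma C11_apply_le: "C11 L K f f' \<Longrightarrow> norm (blinfun_apply (f' x) v) \<le> L * norm v"
  by (meson C11_norm_le mult_right_mono norm_blinfun norm_ge_zero order_trans)

lemma C11_diff_le: "C11 L K f f' \<Longrightarrow> norm (f' x - f' y) \<le> K * norm (x - y)"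
  by (simp add: C11_def)

lemma C11_nonneg: "C11 L K f f' \<Longrightarrow> 0 \<le> L" "C11 L K (f :: 'a::euclidean_space \<Rightarrow> _) f' \<Longrightarrow> 0 \<le> K"
proof -
  show "0 \<le> L" if "C11 L K f f'" using C11_norm_le[OF that] norm_ge_zero order_trans by blast
  show "0 \<le> K" if "C11 L K (f :: 'a::euclidean_space \<Rightarrow> _) f'"
  proof -
    \<comment> \<open>The sign of \<open>K\<close> shows only on two distinct points, which exist
      because the dimension is positive.\<close>
    obtain b :: 'a where "b \<in> Basis" using nonempty_Basis by blast
    then have "norm (f' b - f' 0) \<le> K" using C11_diff_le[OF that, of b 0] by simp
    then show ?thesis using norm_ge_zero order_trans by blast
  qed
qed

lemma C11_lipschitz: "C11 L K f f' \<Longrightarrow> norm (f x - f y) \<le> L * norm (x - y)"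
  by (rule differentiable_bound[where S=UNIV and f'="\<lambda>x. blinfun_apply (f' x)"])
    (auto simp: C11_has_derivative norm_blinfun.rep_eq[symmetric] C11_norm_le)

text \<open>On the ball of radius \<open>norm v\<close> the derivative varies by at most
  \<open>K * norm v\<close>, so the mean value inequality applies to \<open>f\<close> minus its
  linearization. This gives K rather than the sharp K/2.\<close>

lemma C11_taylor:
  assumes "C11 L K f f'"
  shows "norm (f (x + v) - f x - blinfun_apply (f' x) v) \<le> K * (norm v)\<^sup>2"
proof -
  have "norm (f (x + v) - f x - blinfun_apply (f' x) (x + v - x)) \<le> norm (x + v - x) * (K * norm v)"
  proof (rule differentiable_bound_linearization[where S="cball x (norm v)"])
    show "x + t *\<^sub>R (x + v - x) \<in> cball x (norm v)" if "t \<in> {0..1}" for t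
      using that by (auto simp: dist_norm mult_left_le_one_le)
    show "onorm (blinfun_apply (f' y) - blinfun_apply (f' x)) \<le> K * norm v"
      if "y \<in> cball x (norm v)" for y
    proof -
      have "norm (f' y - f' x) \<le> K * norm (y - x)" by (rule C11_diff_le[OF assms])
      also have "\<dots> \<le> K * norm v"
        using that C11_nonneg(2)[OF assms] by (intro mult_left_mono) (auto simp: dist_norm norm_minus_commute)
      finally show ?thesis
        by (simp add: norm_blinfun.rep_eq blinfun.diff_left[abs_def] fun_diff_def)
    qed
  qed (auto simp: C11_has_derivative[OF assms])
  then show ?thesis by (simp add: power2_eq_square mult_ac)
qed

lemma C11_continuous_on: "C11 L K f f' \<Longrightarrow> continuous_on S f"
  by (rule has_derivative_continuous_on[OF C11_has_derivative])

lemma C11_bounded: "C11 L K f f' \<Longrightarrow> \<exists>B. \<forall>x. norm (f x) \<le> B"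
  by (auto simp: C11_def bounded_iff)

lemma C11_continuous_on_deriv:
  assumes "C11 L K f f'"
  shows "continuous_on S f'"
proof -
  have "K-lipschitz_on S f'"
    by (rule lipschitz_onI) (auto simp: dist_norm C11_diff_le[OF assms] C11_nonneg[OF assms])
  then show ?thesis by (rule lipschitz_on_continuous_on)
qed

text \<open>The increment along a small multiple of \<open>v\<close> differs from the derivative by
  an arbitrarily small fraction of its length. Applied to a mollification, this bounds the
  derivative by the very constant \<open>L\<close> of the function, which an estimate through the
  kernel derivative would not give.\<close>

lemma has_derivative_lipschitz_bound:
  fixes f :: "'a::real_normed_vector \<Rightarrow> 'b::real_normed_vector"
  assumes D: "(f has_derivative f') (at x)" and L: "\<And>x y. norm (f x - f y) \<le> L * norm (x - y)"
  shows "norm (f' v) \<le> L * norm v"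
proof (cases "v = 0")
  case True
  then show ?thesis using linear_0[OF bounded_linear.linear[OF has_derivative_bounded_linear[OF D]]] by simp
next
  case False
  show ?thesis
  proof (rule field_le_epsilon)
    fix e :: real assume "e > 0"
    then have "e / norm v > 0" using False by simp
    then obtain d where d: "d > 0"
      "\<And>y. norm (y - x) < d \<Longrightarrow> norm (f y - f x - f' (y - x)) \<le> e / norm v * norm (y - x)"
      using D unfolding has_derivative_at_alt by blast
    define t where "t = d / (2 * norm v)"
    have t: "t > 0" "norm (t *\<^sub>R v) < d"
      using d False by (auto simp: t_def)
    have scale: "f' (t *\<^sub>R v) = t *\<^sub>R f' v"
      using linear_scale[OF bounded_linear.linear[OF has_derivative_bounded_linear[OF D]]] .
    have "norm (f' (t *\<^sub>R v)) \<le> norm (f (x + t *\<^sub>R v) - f x) + norm (f (x + t *\<^sub>R v) - f x - f' (t *\<^sub>R v))"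
      by (metis add.commute norm_minus_commute norm_triangle_sub)
    also have "\<dots> \<le> L * norm (t *\<^sub>R v) + e / norm v * norm (t *\<^sub>R v)"
      using d(2)[of "x + t *\<^sub>R v"] t L[of "x + t *\<^sub>R v" x] by (intro add_mono) auto
    finally have "t * norm (f' v) \<le> t * (L * norm v + e)"
      using t False by (simp add: scale algebra_simps)
    then show "norm (f' v) \<le> L * norm v + e" using t by simp
  qed
qed

section \<open>Mollification\<close>

lemma bounded_of_compact_support:
  fixes f :: "'a::euclidean_space \<Rightarrow> 'b::real_normed_vector"
  assumes "continuous_on UNIV f" "\<And>x. norm x > R \<Longrightarrow> f x = 0"
  shows "\<exists>B\<ge>0. \<forall>x. norm (f x) \<le> B"
proof -
  have "bounded (f ` cball 0 R)"
    using assms by (intro compact_imp_bounded compact_continuous_image) (auto intro: continuous_on_subset)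
  then obtain B where B: "B > 0" "\<And>x. norm x \<le> R \<Longrightarrow> norm (f x) \<le> B"
    by (auto simp: bounded_pos)
  then have "norm (f x) \<le> B" for x using assms(2)[of x] by (cases "norm x \<le> R") auto
  then show ?thesis using B by (intro exI[of _ B]) auto
qed

lemma integrable_compact_support:
  fixes f :: "'a::euclidean_space \<Rightarrow> 'b::{banach, second_countable_topology}"
  assumes "continuous_on UNIV f" "\<And>x. norm (x - a) > R \<Longrightarrow> f x = 0"
  shows "integrable lborel f"
proof -
  have "integrable lborel (\<lambda>x. indicator (cball a R) x *\<^sub>R f x)"
    using assms by (intro borel_integrable_compact) (auto intro: continuous_on_subset)
  moreover have "indicator (cball a R) x *\<^sub>R f x = f x" for x
    using assms(2)[of x] by (auto simp: indicator_def dist_norm norm_minus_commute)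
  ultimately show ?thesis by simp
qed

lemma frechet_derivative_compact_support:
  fixes f :: "'a::euclidean_space \<Rightarrow> real"
  assumes "\<And>x. norm x > R \<Longrightarrow> f x = 0" "norm x > R"
  shows "frechet_derivative f (at x) = (\<lambda>v. 0)"
proof -
  have "(f has_derivative (\<lambda>v. 0)) (at x)"
  proof (rule has_derivative_transform_within_open[of "\<lambda>x. 0"])
    show "open (- cball (0::'a) R)" by auto
  qed (use assms in auto)
  then show ?thesis using frechet_derivative_at by metis
qed

lemma blinfun_apply_Blinfun_frechet:
  "Ck (Suc n) f \<Longrightarrow> blinfun_apply (Blinfun (frechet_derivative f (at x))) = frechet_derivative f (at x)"
  by (intro bounded_linear_Blinfun_apply has_derivative_bounded_linear[OF Ck_Suc_has_derivative])

lemma lipschitz_of_Ck_compact_support: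
  fixes f :: "'a::euclidean_space \<Rightarrow> real"
  assumes f: "Ck (Suc 0) f" and supp: "\<And>x. norm x > R \<Longrightarrow> f x = 0"
  shows "\<exists>L\<ge>0. (\<forall>x v. \<bar>frechet_derivative f (at x) v\<bar> \<le> L * norm v) \<and> (\<forall>x y. \<bar>f x - f y\<bar> \<le> L * norm (x - y))"
proof -
  let ?D = "\<lambda>x. Blinfun (frechet_derivative f (at x))"
  note D = blinfun_apply_Blinfun_frechet[OF f]
  have "\<exists>B\<ge>0. \<forall>x. norm (frechet_derivative f (at x) b) \<le> B" if "b \<in> Basis" for b
    using that f frechet_derivative_compact_support[of R f, OF supp]
    by (intro bounded_of_compact_support[of _ R]) auto
  then obtain B where B: "\<And>b. b \<in> Basis \<Longrightarrow> 0 \<le> B b"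
      "\<And>b x. b \<in> Basis \<Longrightarrow> norm (frechet_derivative f (at x) b) \<le> B b" by metis
  define L where "L = (\<Sum>b\<in>Basis. B b)"
  have "norm (?D x) \<le> L" for x
    using B norm_blinfun_euclidean_le[of "?D x"] unfolding D L_def
    by (meson order_trans sum_mono)
  then have "norm (?D x v) \<le> L * norm v" for x v
    by (meson mult_right_mono norm_blinfun norm_ge_zero order_trans)
  then have D_le: "norm (frechet_derivative f (at x) v) \<le> L * norm v" for x v
    by (simp add: D)
  have L: "0 \<le> L" using B by (auto simp: L_def sum_nonneg)
  have "norm (f x - f y) \<le> L * norm (x - y)" for x y
    by (rule differentiable_bound[OF convex_UNIV, where f'="\<lambda>x. frechet_derivative f (at x)"])
      (auto intro: Ck_Suc_has_derivative[OF f] onorm_bound[OF L D_le, simplified])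
  then show ?thesis using L D_le by auto
qed

lemma C11_of_Ck_compact_support:
  fixes f :: "'a::euclidean_space \<Rightarrow> real"
  assumes f: "\<And>n. Ck n f" and supp: "\<And>x. norm x > R \<Longrightarrow> f x = 0"
  shows "\<exists>L K. C11 L K f (\<lambda>x. Blinfun (frechet_derivative f (at x)))"
proof -
  let ?D = "\<lambda>x. Blinfun (frechet_derivative f (at x))"
  note D = blinfun_apply_Blinfun_frechet[OF f[of "Suc 0"]]
  obtain B where B: "\<And>x. norm (f x) \<le> B"
    using bounded_of_compact_support[of f R, OF Ck_imp_continuous_on[OF f[of 0]] supp] by metis
  obtain L where L: "0 \<le> L" "\<And>x v. norm (frechet_derivative f (at x) v) \<le> L * norm v"
    using lipschitz_of_Ck_compact_support[of f R, OF f supp] by auto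
  have "\<exists>K\<ge>0. \<forall>x y. \<bar>frechet_derivative f (at x) b - frechet_derivative f (at y) b\<bar> \<le> K * norm (x - y)"
    if "b \<in> Basis" for b
    using lipschitz_of_Ck_compact_support[of "\<lambda>x. frechet_derivative f (at x) b" R]
      that f[of "Suc (Suc 0)"] frechet_derivative_compact_support[of R f, OF supp] by auto
  then obtain K where K: "\<And>b x y. b \<in> Basis \<Longrightarrow>
      norm (frechet_derivative f (at x) b - frechet_derivative f (at y) b) \<le> K b * norm (x - y)"
    unfolding real_norm_def by metis
  have "norm (?D x - ?D y) \<le> (\<Sum>b\<in>Basis. K b) * norm (x - y)" for x y
  proof -
    have "norm (?D x - ?D y) \<le> (\<Sum>b\<in>Basis. norm ((?D x - ?D y) b))" by (rule norm_blinfun_euclidean_le)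
    also have "\<dots> \<le> (\<Sum>b\<in>Basis. K b * norm (x - y))"
      using K by (intro sum_mono) (simp add: blinfun.diff_left D)
    finally show ?thesis by (simp add: sum_distrib_right)
  qed
  moreover have "norm (?D x) \<le> L" for x
    by (rule norm_blinfun_bound) (use L D in auto)
  ultimately have "C11 L (\<Sum>b\<in>Basis. K b) f ?D"
    using B by (auto simp: C11_def bounded_iff D intro: Ck_Suc_has_derivative[OF f[of "Suc 0"]])
  then show ?thesis by blast
qed

lemma lborel_integral_reflect:
  fixes f :: "'a::euclidean_space \<Rightarrow> 'b::{banach, second_countable_topology}"
  shows "(\<integral>y. f (x - y) \<partial>lborel) = (\<integral>y. f y \<partial>lborel)"
    and "integrable lborel (\<lambda>y. f (x - y)) \<longleftrightarrow> integrable lborel f"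
proof -
  have eq: "(lborel :: 'a measure) = distr lborel borel (\<lambda>y. x - y)"
    using lborel_affine[of "-1" x] by (simp add: density_1)
  have eq2: "(\<lambda>y. f (x - (x - y))) = f" by simp
  show *: "integrable lborel (\<lambda>y. f (x - y)) \<longleftrightarrow> integrable lborel f"
  proof
    assume "integrable lborel f"
    then show "integrable lborel (\<lambda>y. f (x - y))"
      using integrable_distr[of "\<lambda>y. x - y" lborel borel f] eq by simp
  next
    assume "integrable lborel (\<lambda>y. f (x - y))"
    then have "integrable lborel (\<lambda>y. (\<lambda>y. f (x - y)) (x - y))"
      using integrable_distr[of "\<lambda>y. x - y" lborel borel "\<lambda>y. f (x - y)"] eq by simp
    then show "integrable lborel f" by simp
  qed
  show "(\<integral>y. f (x - y) \<partial>lborel) = (\<integral>y. f y \<partial>lborel)"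
  proof (cases "integrable lborel f")
    case True
    then have "f \<in> borel_measurable borel" by simp
    then have "(\<integral>y. f y \<partial>distr lborel borel (\<lambda>y. x - y)) = (\<integral>y. f (x - y) \<partial>lborel)"
      by (intro integral_distr) auto
    then show ?thesis using eq by simp
  next
    case False
    then show ?thesis using * by (simp add: not_integrable_integral_eq)
  qed
qed

definition mollify :: "('a::euclidean_space \<Rightarrow> real) \<Rightarrow> ('a \<Rightarrow> 'b::euclidean_space) \<Rightarrow> 'a \<Rightarrow> 'b" where
  "mollify k f x = (\<integral>y. k (x - y) *\<^sub>R f y \<partial>lborel)"

lemma mollify_reflect: "mollify k f x = (\<integral>y. k y *\<^sub>R f (x - y) \<partial>lborel)"
  unfolding mollify_def
  using lborel_integral_reflect(1)[of "\<lambda>y. k (x - y) *\<^sub>R f y" x] by simp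

text \<open>The derivative is placed on the kernel, so bounded continuous \<open>f\<close> are
  covered. This form yields the smoothness of mollifications and the Lipschitz constant of their
  derivative.\<close>

lemma mollify_has_derivative_kernel:
  fixes f :: "'a::euclidean_space \<Rightarrow> 'b::euclidean_space"
  assumes k: "\<And>n. Ck n k" and supp: "\<And>x. norm x > R \<Longrightarrow> k x = 0"
    and f: "continuous_on UNIV f" "\<And>x. norm (f x) \<le> B"
  shows "(mollify k f has_derivative (\<lambda>v. \<integral>y. frechet_derivative k (at (x - y)) v *\<^sub>R f y \<partial>lborel)) (at x)"
proof -
  note D = blinfun_apply_Blinfun_frechet[OF k[of "Suc 0"]]
  obtain L K where C: "C11 L K k (\<lambda>x. Blinfun (frechet_derivative k (at x)))"
    using C11_of_Ck_compact_support[of k R, OF k supp] by blast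
  have contk: "continuous_on S k" for S by (rule Ck_imp_continuous_on[OF k[of 0]])
  have contD: "continuous_on S (\<lambda>x. frechet_derivative k (at x) v)" for S v
  proof -
    have "continuous_on S (\<lambda>x. blinfun_apply (Blinfun (frechet_derivative k (at x))) v)"
      by (intro continuous_intros C11_continuous_on_deriv[OF C])
    then show ?thesis by (simp add: D)
  qed
  have B: "0 \<le> B" using f(2) norm_ge_zero order_trans by blast
  have lin: "linear (frechet_derivative k (at x))" for x
    using Ck_Suc_has_derivative[OF k[of "Suc 0"]] has_derivative_linear by blast
  have far: "norm (x + w - y) > R" if "norm (y - x) > R + 1" "norm w \<le> 1" for w y
    using that norm_triangle_ineq4[of "x + w - y" w] by (simp add: norm_minus_commute)
  show ?thesis unfolding mollify_def[abs_def]
  \<comment> \<open>The radius \<open>R + 1\<close> covers the support of the kernel for all shifts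
    \<open>v\<close> of length at most 1; outside that ball all terms of the remainder
    vanish.\<close>
  proof (rule has_derivative_integral_quadratic[where \<omega>="\<lambda>y. indicator (cball x (R + 1)) y * (K * B)"])
    fix v :: 'a assume "norm v \<le> 1"
    then show "integrable lborel (\<lambda>y. k (x + v - y) *\<^sub>R f y)"
      by (intro integrable_compact_support[where a=x and R="R+1"])
        (auto intro!: continuous_intros continuous_on_compose2[OF contk] f simp: supp far)
  next
    fix v :: 'a
    show "integrable lborel (\<lambda>y. frechet_derivative k (at (x - y)) v *\<^sub>R f y)"
      using frechet_derivative_compact_support[of R k, OF supp]
      by (intro integrable_compact_support[where a=x and R="R"])
        (auto intro!: continuous_intros continuous_on_compose2[OF contD] f simp: norm_minus_commute)
  next
    fix y show "linear (\<lambda>v. frechet_derivative k (at (x - y)) v *\<^sub>R f y)"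
      by (rule linearI) (simp_all add: linear_add[OF lin] linear_cmul[OF lin] algebra_simps)
  next
    show "integrable lborel (\<lambda>y. indicator (cball x (R + 1)) y * (K * B))"
      using borel_integrable_compact[of "cball x (R + 1)" "\<lambda>x. K * B"] by simp
  next
    fix v y :: 'a assume v: "norm v \<le> 1"
    show "norm (k (x + v - y) *\<^sub>R f y - k (x - y) *\<^sub>R f y - frechet_derivative k (at (x - y)) v *\<^sub>R f y)
        \<le> indicator (cball x (R + 1)) y * (K * B) * (norm v)\<^sup>2"
    proof (cases "y \<in> cball x (R + 1)")
      case True
      have "norm (k (x + v - y) *\<^sub>R f y - k (x - y) *\<^sub>R f y - frechet_derivative k (at (x - y)) v *\<^sub>R f y)
        = norm (k (x - y + v) - k (x - y) - frechet_derivative k (at (x - y)) v) * norm (f y)"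
        by (simp add: scaleR_diff_left[symmetric] diff_add_eq)
      also have "\<dots> \<le> (K * (norm v)\<^sup>2) * B"
        using C11_taylor[OF C, of "x - y" v] f(2)[of y] unfolding D by (intro mult_mono) auto
      finally show ?thesis using True by (simp add: mult_ac)
    next
      case False
      then have "norm (y - x) > R + 1" by (simp add: dist_norm norm_minus_commute)
      then have "norm (x + v - y) > R" "norm (x - y) > R" using far[of y v] far[of y 0] v by auto
      then show ?thesis
        using False supp frechet_derivative_compact_support[of R k, OF supp] by auto
    qed
  qed
qed

text \<open>Each partial derivative is again a mollification of \<open>f\<close>, by a partial
  derivative of the kernel; hence the induction leaves \<open>k\<close> arbitrary.\<close>

lemma Ck_mollify:
  fixes f :: "'a::euclidean_space \<Rightarrow> real"
  assumes k: "\<And>n. Ck n k" and supp: "\<And>x. norm x > R \<Longrightarrow> k x = 0"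
    and f: "continuous_on UNIV f" "\<And>x. norm (f x) \<le> B"
  shows "Ck n (mollify k f)"
  using k supp
proof (induction n arbitrary: k)
  case 0
  show ?case
    unfolding Ck.simps
    by (rule has_derivative_continuous_on[OF mollify_has_derivative_kernel[of k R, OF 0 f]])
next
  case (Suc n)
  show ?case
  proof (rule Ck_SucI[OF mollify_has_derivative_kernel[of k R, OF Suc.prems f]])
    fix b :: 'a assume "b \<in> Basis"
    then have "Ck m (\<lambda>x. frechet_derivative k (at x) b)" for m
      using Suc.prems(1)[of "Suc m"] by simp
    then show "Ck n (\<lambda>x. \<integral>y. frechet_derivative k (at (x - y)) b *\<^sub>R f y \<partial>lborel)"
      using Suc.IH[of "\<lambda>x. frechet_derivative k (at x) b"] frechet_derivative_compact_support[of R k, OF Suc.prems(2)]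
      by (simp add: mollify_def[abs_def])
  qed
qed

definition mollifier :: "real \<Rightarrow> ('a::euclidean_space \<Rightarrow> real) \<Rightarrow> bool" where
  "mollifier \<epsilon> k \<longleftrightarrow> (\<forall>n. Ck n k) \<and> (\<forall>x. 0 \<le> k x) \<and> (\<forall>x. norm x > \<epsilon> \<longrightarrow> k x = 0) \<and> (\<integral>x. k x \<partial>lborel) = 1"

lemma mollifier_exists:
  assumes "\<epsilon> > 0"
  shows "\<exists>k :: 'a::euclidean_space \<Rightarrow> real. mollifier \<epsilon> k"
proof -
  let ?b = "bump \<epsilon> :: 'a \<Rightarrow> real"
  have C: "Ck n ?b" for n using Ck_bump[of n \<epsilon> 0] by simp
  have int: "integrable lborel ?b"
    using assms by (intro integrable_compact_support[where a=0 and R=\<epsilon>] Ck_imp_continuous_on[OF C[of 0]]) (simp add: bump_eq_0)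
  have "(\<integral>x. ?b x \<partial>lborel) \<noteq> 0"
  proof
    assume "(\<integral>x. ?b x \<partial>lborel) = 0"
    then have "AE x in lborel. ?b x = 0"
      using integral_nonneg_eq_0_iff_AE[OF int] by (simp add: bump_nonneg)
    then have "AE x::'a in lborel. x \<notin> ball 0 \<epsilon>"
      by (rule eventually_mono) (use assms bump_pos_iff[of \<epsilon>] in \<open>force\<close>)
    then have "emeasure lborel (ball (0::'a) \<epsilon>) = 0"
      using AE_iff_measurable[of "ball (0::'a) \<epsilon>" lborel "\<lambda>x. x \<notin> ball 0 \<epsilon>"] by (simp add: ball_def)
    then have "negligible (ball (0::'a) \<epsilon>)"
      by (simp add: negligible_iff_null_sets null_sets_def)
    then show False using open_not_negligible[of "ball (0::'a) \<epsilon>"] assms by simp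
  qed
  moreover have "(\<integral>x. ?b x \<partial>lborel) \<ge> 0" by (simp add: bump_nonneg)
  ultimately have pos: "(\<integral>x. ?b x \<partial>lborel) > 0" by simp
  have "mollifier \<epsilon> (\<lambda>x. inverse (\<integral>x. ?b x \<partial>lborel) * ?b x)"
    unfolding mollifier_def
    using pos assms by (auto intro: Ck_mult Ck_const C simp: bump_nonneg bump_eq_0)
  then show ?thesis by blast
qed

lemma continuous_on_reflect:
  fixes f :: "'a::real_normed_vector \<Rightarrow> 'b::topological_space"
  shows "continuous_on UNIV f \<Longrightarrow> continuous_on S (\<lambda>y. f (x - y))"
  by (rule continuous_on_compose2[of UNIV f]) (auto intro!: continuous_intros)

lemma mollifier_integrable:
  assumes "mollifier \<epsilon> k" "continuous_on UNIV h"
  shows "integrable lborel (\<lambda>y. k y *\<^sub>R (h y :: 'b::euclidean_space))"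
  using assms
  by (intro integrable_compact_support[where a=0 and R=\<epsilon>])
    (auto intro!: continuous_intros Ck_imp_continuous_on[of 0] simp: mollifier_def)

text \<open>A weighted mean over the ball of radius \<open>\<epsilon>\<close> stays as close to
  \<open>c\<close> as the values do. With \<open>c = 0\<close> this gives sup bounds, with
  \<open>c = f x\<close> the approximation error.\<close>

lemma mollify_apply_le:
  fixes h :: "'a::euclidean_space \<Rightarrow> 'b::euclidean_space"
  assumes k: "mollifier \<epsilon> k" and h: "continuous_on UNIV h"
    and le: "\<And>y. norm y \<le> \<epsilon> \<Longrightarrow> norm (h y - c) \<le> B"
  shows "norm ((\<integral>y. k y *\<^sub>R h y \<partial>lborel) - c) \<le> B"
proof -
  have int: "integrable lborel k" "integrable lborel (\<lambda>y. k y *\<^sub>R h y)"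
    using mollifier_integrable[OF k, of "\<lambda>x. 1 :: real"] mollifier_integrable[OF k h] by auto
  have "(\<integral>y. k y *\<^sub>R h y \<partial>lborel) - c = (\<integral>y. k y *\<^sub>R (h y - c) \<partial>lborel)"
    using int k by (simp add: scaleR_diff_right mollifier_def)
  also have "norm \<dots> \<le> (\<integral>y. k y * B \<partial>lborel)"
  proof (rule norm_integral_le_AE)
    have "norm (k y *\<^sub>R (h y - c)) \<le> k y * B" for y
      using k le[of y] by (cases "norm y \<le> \<epsilon>") (auto simp: mollifier_def mult_left_mono)
    then show "AE y in lborel. norm (k y *\<^sub>R (h y - c)) \<le> k y * B" by simp
  qed (use int in simp)
  also have "\<dots> = B" using int k by (simp add: mollifier_def)
  finally show ?thesis .
qed

lemma mollify_norm_le: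
  fixes f :: "'a::euclidean_space \<Rightarrow> 'b::euclidean_space"
  assumes "mollifier \<epsilon> k" "continuous_on UNIV f" "\<And>x. norm (f x) \<le> B"
  shows "norm (mollify k f x) \<le> B"
  using mollify_apply_le[OF assms(1) continuous_on_reflect[OF assms(2)], where c=0 and B=B and x1=x] assms(3)
  by (simp add: mollify_reflect)

lemma mollify_dist_le:
  fixes f :: "'a::euclidean_space \<Rightarrow> 'b::euclidean_space"
  assumes "mollifier \<epsilon> k" and L: "0 \<le> L" "\<And>x y. norm (f x - f y) \<le> L * norm (x - y)"
  shows "norm (mollify k f x - f x) \<le> L * \<epsilon>"
proof -
  have "continuous_on UNIV f"
    by (rule continuous_on_of_norm_lipschitz[OF L])
  moreover have "norm (f (x - y) - f x) \<le> L * \<epsilon>" if "norm y \<le> \<epsilon>" for y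
    using L(2)[of "x - y" x] that L(1) by (auto intro: order_trans mult_left_mono)
  ultimately show ?thesis
    using mollify_apply_le[OF assms(1) continuous_on_reflect[of f UNIV x], where c="f x" and B="L * \<epsilon>"]
    by (simp add: mollify_reflect)
qed

lemma mollify_diff:
  fixes f g :: "'a::euclidean_space \<Rightarrow> 'b::euclidean_space"
  assumes "mollifier \<epsilon> k" "continuous_on UNIV f"
  shows "mollify k f x - mollify k f y = (\<integral>z. k z *\<^sub>R (f (x - z) - f (y - z)) \<partial>lborel)"
proof -
  have "integrable lborel (\<lambda>z. k z *\<^sub>R f (x - z))" for x
    by (intro mollifier_integrable[OF assms(1)] continuous_on_compose2[OF assms(2)] continuous_intros) auto
  then show ?thesis by (simp add: mollify_reflect scaleR_diff_right)
qed

text \<open>\<open>K\<close> is fixed before \<open>f\<close>: the scheme needs one second-order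
  constant for the velocities frozen at all times. \<open>L\<close> is kept unchanged, since it
  governs the growth of Lip(psi) over many steps.\<close>

lemma mollify_C11:
  assumes m: "mollifier \<epsilon> k" and L: "0 \<le> L"
  obtains K where "\<And>f :: 'a::euclidean_space \<Rightarrow> 'b::euclidean_space.
    (\<And>x. norm (f x) \<le> B) \<Longrightarrow> (\<And>x y. norm (f x - f y) \<le> L * norm (x - y)) \<Longrightarrow> \<exists>g'. C11 L K (mollify k f) g'"
proof -
  have k: "\<And>n. Ck n k" and supp: "\<And>x. norm x > \<epsilon> \<Longrightarrow> k x = 0"
    using m by (auto simp: mollifier_def)
  obtain M where M: "M \<ge> 0" "\<And>x v. \<bar>frechet_derivative k (at x) v\<bar> \<le> M * norm v"
    using lipschitz_of_Ck_compact_support[of k \<epsilon>, OF k supp] by auto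
  \<comment> \<open>Bound of the kernel derivative, times the Lipschitz constant of
    \<open>f\<close>, times the volume of the ball carrying the kernel; it is not controlled as
    \<open>\<epsilon>\<close> decreases.\<close>
  define K where "K = M * L * measure lborel (cball (0::'a) \<epsilon>)"
  have K: "0 \<le> K" using M L by (simp add: K_def)
  have "\<exists>g'. C11 L K (mollify k f) g'"
    if B: "\<And>x. norm (f x) \<le> B" and Lf: "\<And>x y. norm (f x - f y) \<le> L * norm (x - y)"
    for f :: "'a \<Rightarrow> 'b"
  proof -
    have f: "continuous_on UNIV f"
      by (rule continuous_on_of_norm_lipschitz[OF L Lf])
    note D = mollify_has_derivative_kernel[of k \<epsilon>, OF k supp f B]
    define g' where "g' x = Blinfun (\<lambda>v. \<integral>y. frechet_derivative k (at (x - y)) v *\<^sub>R f y \<partial>lborel)" for x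
    have g': "blinfun_apply (g' x) = (\<lambda>v. \<integral>y. frechet_derivative k (at (x - y)) v *\<^sub>R f y \<partial>lborel)" for x
      unfolding g'_def by (intro bounded_linear_Blinfun_apply has_derivative_bounded_linear[OF D])
    have shift: "norm (f (x - z) - f (y - z)) \<le> L * norm (x - y)" for x y z
      using Lf[of "x - z" "y - z"] by simp
    have Lip: "norm (mollify k f x - mollify k f y) \<le> L * norm (x - y)" for x y
    proof -
      have "continuous_on UNIV (\<lambda>z. f (x - z) - f (y - z))"
        by (intro continuous_intros continuous_on_compose2[OF f]) auto
      from mollify_apply_le[OF m this, where c=0 and B="L * norm (x - y)"] show ?thesis
        using shift by (simp add: mollify_diff[OF m f])
    qed
    obtain Lk Kk where C: "C11 Lk Kk k (\<lambda>x. Blinfun (frechet_derivative k (at x)))"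
      using C11_of_Ck_compact_support[of k \<epsilon>, OF k supp] by blast
    have contD: "continuous_on S (\<lambda>x. frechet_derivative k (at x) v)" for S v
    proof -
      have "continuous_on S (\<lambda>x. blinfun_apply (Blinfun (frechet_derivative k (at x))) v)"
        by (intro continuous_intros C11_continuous_on_deriv[OF C])
      then show ?thesis by (simp add: blinfun_apply_Blinfun_frechet[OF k[of "Suc 0"]])
    qed
    have "norm (g' x - g' y) \<le> K * norm (x - y)" for x y
    proof (rule norm_blinfun_bound)
      fix v
      have int: "integrable lborel (\<lambda>z. frechet_derivative k (at z) v *\<^sub>R f (x - z))" for x
        using frechet_derivative_compact_support[of \<epsilon> k, OF supp]
        by (intro integrable_compact_support[where a=0 and R=\<epsilon>])
          (auto intro!: continuous_intros contD continuous_on_compose2[OF f])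
      \<comment> \<open>After reflection the dependence on \<open>x\<close> sits in \<open>f\<close>
        alone, whose Lipschitz bound then controls the variation of the derivative.\<close>
      have refl: "blinfun_apply (g' x) v = (\<integral>z. frechet_derivative k (at z) v *\<^sub>R f (x - z) \<partial>lborel)" for x
        unfolding g' using lborel_integral_reflect(1)[of "\<lambda>z. frechet_derivative k (at z) v *\<^sub>R f (x - z)" x] by simp
      have "blinfun_apply (g' x - g' y) v
        = (\<integral>z. frechet_derivative k (at z) v *\<^sub>R (f (x - z) - f (y - z)) \<partial>lborel)"
        using int[of x] int[of y] by (simp add: blinfun.diff_left refl scaleR_diff_right)
      also have "norm \<dots> \<le> (\<integral>z. indicator (cball (0::'a) \<epsilon>) z * (M * norm v * (L * norm (x - y))) \<partial>lborel)"
      proof (rule norm_integral_le_AE)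
        show "integrable lborel (\<lambda>z::'a. indicator (cball 0 \<epsilon>) z * (M * norm v * (L * norm (x - y))))"
          using borel_integrable_compact[of "cball (0::'a) \<epsilon>" "\<lambda>z. M * norm v * (L * norm (x - y))"] by simp
        have "norm (frechet_derivative k (at z) v *\<^sub>R (f (x - z) - f (y - z)))
            \<le> indicator (cball 0 \<epsilon>) z * (M * norm v * (L * norm (x - y)))" for z
        proof (cases "norm z \<le> \<epsilon>")
          case True
          have "\<bar>frechet_derivative k (at z) v\<bar> * norm (f (x - z) - f (y - z)) \<le> (M * norm v) * (L * norm (x - y))"
            using M shift by (intro mult_mono) auto
          then show ?thesis using True by simp
        next
          case False
          then show ?thesis using frechet_derivative_compact_support[of \<epsilon> k z, OF supp] by auto
        qed
        then show "AE z in lborel. norm (frechet_derivative k (at z) v *\<^sub>R (f (x - z) - f (y - z)))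
            \<le> indicator (cball 0 \<epsilon>) z * (M * norm v * (L * norm (x - y)))" by simp
      qed
      also have "\<dots> = K * norm (x - y) * norm v"
        by (simp add: K_def mult_ac)
      finally show "norm (blinfun_apply (g' x - g' y) v) \<le> K * norm (x - y) * norm v" .
    qed (use K in auto)
    moreover have "norm (g' x) \<le> L" for x
    proof (rule norm_blinfun_bound)
      show "norm (blinfun_apply (g' x) v) \<le> L * norm v" for v
        unfolding g' by (rule has_derivative_lipschitz_bound[OF D Lip])
    qed (rule L)
    ultimately have "C11 L K (mollify k f) g'"
      using mollify_norm_le[OF m f B] by (auto simp: C11_def g' D bounded_iff)
    then show ?thesis by blast
  qed
  then show ?thesis by (rule that)
qed

lemma C11_approx:
  assumes "\<epsilon> > 0" and L: "0 \<le> L"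
  obtains K where "\<And>f :: 'a::euclidean_space \<Rightarrow> 'b::euclidean_space.
    (\<And>x. norm (f x) \<le> B) \<Longrightarrow> (\<And>x y. norm (f x - f y) \<le> L * norm (x - y)) \<Longrightarrow>
    \<exists>g g'. C11 L K g g' \<and> (\<forall>x. norm (g x - f x) \<le> L * \<epsilon>) \<and> (\<forall>x. norm (g x) \<le> B)"
proof -
  obtain k :: "'a \<Rightarrow> real" where k: "mollifier \<epsilon> k"
    using mollifier_exists[OF assms(1)] by blast
  obtain K where K: "\<And>f :: 'a \<Rightarrow> 'b. (\<And>x. norm (f x) \<le> B) \<Longrightarrow>
      (\<And>x y. norm (f x - f y) \<le> L * norm (x - y)) \<Longrightarrow> \<exists>g'. C11 L K (mollify k f) g'"
    using mollify_C11[OF k L] by blast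
  show ?thesis
  proof (rule that)
    fix f :: "'a \<Rightarrow> 'b"
    assume B: "\<And>x. norm (f x) \<le> B" and Lf: "\<And>x y. norm (f x - f y) \<le> L * norm (x - y)"
    have f: "continuous_on UNIV f"
      by (rule continuous_on_of_norm_lipschitz[OF L Lf])
    show "\<exists>g g'. C11 L K g g' \<and> (\<forall>x. norm (g x - f x) \<le> L * \<epsilon>) \<and> (\<forall>x. norm (g x) \<le> B)"
      using K[OF B Lf] mollify_dist_le[OF k L Lf] mollify_norm_le[OF k f B] by blast
  qed
qed

text \<open>Here the derivative is placed on the function: derivatives of mollifications are means
  of \<open>f'\<close> and therefore converge to it.\<close>

lemma mollify_has_derivative_fun:
  fixes f :: "'a::euclidean_space \<Rightarrow> 'b::euclidean_space"
  assumes m: "mollifier \<epsilon> k" and f: "C11 L K f f'"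
  shows "(mollify k f has_derivative (\<lambda>v. \<integral>y. k y *\<^sub>R blinfun_apply (f' (x - y)) v \<partial>lborel)) (at x)"
  unfolding mollify_reflect[abs_def]
proof (rule has_derivative_integral_quadratic[where \<omega>="\<lambda>y. k y * K"])
  show "integrable lborel (\<lambda>y. k y *\<^sub>R f (x + v - y))" for v
    by (intro mollifier_integrable[OF m] continuous_on_compose2[OF C11_continuous_on[OF f, of UNIV]]
        continuous_intros) auto
  show "integrable lborel (\<lambda>y. k y *\<^sub>R blinfun_apply (f' (x - y)) v)" for v
    by (intro mollifier_integrable[OF m] continuous_intros
        continuous_on_compose2[OF C11_continuous_on_deriv[OF f, of UNIV]]) auto
  show "linear (\<lambda>v. k y *\<^sub>R blinfun_apply (f' (x - y)) v)" for y
    by (intro linearI) (simp_all add: blinfun.bilinear_simps algebra_simps)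
  show "integrable lborel (\<lambda>y. k y * K)"
    using mollifier_integrable[OF m, of "\<lambda>_. K"] by simp
  fix v y
  have "norm (k y *\<^sub>R f (x + v - y) - k y *\<^sub>R f (x - y) - k y *\<^sub>R blinfun_apply (f' (x - y)) v)
    = k y * norm (f (x - y + v) - f (x - y) - blinfun_apply (f' (x - y)) v)"
    using m by (simp add: scaleR_diff_right[symmetric] diff_add_eq mollifier_def)
  also have "\<dots> \<le> k y * (K * (norm v)\<^sup>2)"
    using m by (intro mult_left_mono C11_taylor[OF f]) (auto simp: mollifier_def)
  finally show "norm (k y *\<^sub>R f (x + v - y) - k y *\<^sub>R f (x - y) - k y *\<^sub>R blinfun_apply (f' (x - y)) v)
      \<le> k y * K * (norm v)\<^sup>2" by (simp add: mult_ac)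
qed

section \<open>Approximation of \<open>C11\<close> functions by test functions\<close>

lemma bump_has_derivative:
  "(bump r has_derivative (\<lambda>v. flat 2 (1 - (x \<bullet> x) / r\<^sup>2) * (- (2 * (x \<bullet> v) / r\<^sup>2)))) (at x)"
proof -
  have "((\<lambda>x. 1 - c * (x \<bullet> x)) has_derivative (\<lambda>v. - (c * (2 * (x \<bullet> v))))) (at x)" for c
    by (auto intro!: derivative_eq_intros simp: inner_commute)
  from this[of "inverse (r\<^sup>2)"]
  have "((\<lambda>x. 1 - (x \<bullet> x) / r\<^sup>2) has_derivative (\<lambda>v. - (2 * (x \<bullet> v) / r\<^sup>2))) (at x)"
    by (simp add: divide_inverse mult_ac)
  from has_derivative_compose[OF this flat_has_real_derivative[of 0, unfolded has_field_derivative_def]]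
  show ?thesis
    by (simp add: bump_def[abs_def] numeral_2_eq_2)
qed

text \<open>The derivative of exp(-1/u) is \<open>flat 2\<close>, and (1/u)^2 / 2 is a term of the
  exponential series of 1/u. The bound makes the gradient of a cutoff at radius r of order
  1/r.\<close>

lemma flat_2_le: "0 \<le> flat 2 u" "flat 2 u \<le> 2"
proof -
  show "0 \<le> flat 2 u" by (simp add: flat_def)
  show "flat 2 u \<le> 2"
  proof (cases "u > 0")
    case True
    then have "1 + 1/u + (1/u)\<^sup>2 / 2 \<le> exp (1/u)" by (intro exp_lower_Taylor_quadratic) simp
    then have "(1/u)\<^sup>2 \<le> 2 * exp (1/u)" using True
      by (smt (verit) divide_pos_pos field_sum_of_halves)
    then have "(1/u)\<^sup>2 * exp (- (1/u)) \<le> 2 * exp (1/u) * exp (- (1/u))"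
      by (intro mult_right_mono) auto
    then show ?thesis using True by (simp add: flat_def exp_minus_inverse mult.assoc)
  qed (simp add: flat_def)
qed

text \<open>Mollify at scale 1/(n+1), then cut off at radius n+1. The bounds are uniform in
  \<open>n\<close>, so that dominated convergence can transfer the weak equation to
  \<open>C11\<close> functions.\<close>

lemma test_function_approx:
  fixes \<psi> :: "'a::euclidean_space \<Rightarrow> real"
  assumes \<psi>: "C11 L K \<psi> \<psi>'"
  obtains \<phi> C where "\<And>n m. Ck m (\<phi> n)" "\<And>n. \<exists>R. \<forall>x. norm x > R \<longrightarrow> \<phi> n x = 0"
    "\<And>n x. \<bar>\<phi> n x\<bar> \<le> C" "\<And>n x v. \<bar>frechet_derivative (\<phi> n) (at x) v\<bar> \<le> C * norm v"
    "\<And>x. (\<lambda>n. \<phi> n x) \<longlonglongrightarrow> \<psi> x"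
    "\<And>x v. (\<lambda>n. frechet_derivative (\<phi> n) (at x) v) \<longlonglongrightarrow> blinfun_apply (\<psi>' x) v"
proof -
  have "\<exists>k :: 'a \<Rightarrow> real. mollifier (1 / real (Suc n)) k" for n by (rule mollifier_exists) simp
  then obtain k :: "nat \<Rightarrow> 'a \<Rightarrow> real" where k: "\<And>n. mollifier (1 / real (Suc n)) (k n)" by metis
  obtain B where B: "\<And>x. norm (\<psi> x) \<le> B" using C11_bounded[OF \<psi>] by blast
  have B0: "0 \<le> B" using B norm_ge_zero order_trans by blast
  have L: "0 \<le> L" "0 \<le> K" using C11_nonneg[OF \<psi>] by auto
  note c\<psi> = C11_continuous_on[OF \<psi>]
  define P where "P n = mollify (k n) \<psi>" for n
  define Q where "Q n x v = (\<integral>y. k n y *\<^sub>R blinfun_apply (\<psi>' (x - y)) v \<partial>lborel)" for n x v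
  \<comment> \<open>The factor \<open>exp 1\<close> cancels the maximum exp(-1) of
    \<open>bump\<close>, so that the cutoff tends to 1.\<close>
  define u :: "nat \<Rightarrow> 'a \<Rightarrow> real" where "u n x = exp 1 * bump (real (Suc n)) x" for n x
  define u' :: "nat \<Rightarrow> 'a \<Rightarrow> 'a \<Rightarrow> real" where
    "u' n x v = exp 1 * (flat 2 (1 - (x \<bullet> x) / (real (Suc n))\<^sup>2) * (- (2 * (x \<bullet> v) / (real (Suc n))\<^sup>2)))" for n x v
  have DP: "(P n has_derivative Q n x) (at x)" for n x
    unfolding P_def Q_def by (rule mollify_has_derivative_fun[OF k \<psi>])
  have Du: "(u n has_derivative u' n x) (at x)" for n x
    unfolding u_def[abs_def] u'_def
    by (rule has_derivative_mult_right[OF bump_has_derivative])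
  have P_le: "\<bar>P n x\<bar> \<le> B" for n x
    using mollify_norm_le[OF k c\<psi> B] by (simp add: P_def)
  have P_diff: "\<bar>P n x - \<psi> x\<bar> \<le> L * (1 / real (Suc n))" for n x
    using mollify_dist_le[OF k L(1) C11_lipschitz[OF \<psi>]] by (simp add: P_def)
  have cQ: "continuous_on UNIV (\<lambda>y. blinfun_apply (\<psi>' (x - y)) v)" for x v
    by (intro continuous_intros continuous_on_compose2[OF C11_continuous_on_deriv[OF \<psi>, of UNIV]]) auto
  have Q_le: "\<bar>Q n x v\<bar> \<le> L * norm v" for n x v
    using mollify_apply_le[OF k cQ, where c=0 and B="L * norm v"] C11_apply_le[OF \<psi>] by (simp add: Q_def)
  have Q_diff: "\<bar>Q n x v - blinfun_apply (\<psi>' x) v\<bar> \<le> K * (1 / real (Suc n)) * norm v" for n x v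
  proof -
    have "norm (blinfun_apply (\<psi>' (x - y)) v - blinfun_apply (\<psi>' x) v) \<le> K * (1 / real (Suc n)) * norm v"
      if "norm y \<le> 1 / real (Suc n)" for y
    proof -
      have "norm (blinfun_apply (\<psi>' (x - y) - \<psi>' x) v) \<le> norm (\<psi>' (x - y) - \<psi>' x) * norm v"
        by (rule norm_blinfun)
      also have "\<dots> \<le> K * (1 / real (Suc n)) * norm v"
        using C11_diff_le[OF \<psi>, of "x - y" x] mult_left_mono[OF that L(2)] by (intro mult_right_mono) auto
      finally show ?thesis by (simp add: blinfun.diff_left)
    qed
    from mollify_apply_le[OF k cQ this] show ?thesis by (simp add: Q_def)
  qed
  have u_le: "0 \<le> u n x" "u n x \<le> exp 1" for n x
    by (auto simp: u_def bump_nonneg bump_le_1)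
  have u'_le: "\<bar>u' n x v\<bar> \<le> 4 * exp 1 * norm v / real (Suc n)" for n x v
  proof (cases "norm x < real (Suc n)")
    case True
    define r where "r = real (Suc n)"
    have r: "r > 0" by (simp add: r_def)
    have "\<bar>x \<bullet> v\<bar> \<le> norm x * norm v" by (rule Cauchy_Schwarz_ineq2)
    also have "\<dots> \<le> r * norm v" using True by (intro mult_right_mono) (auto simp: r_def)
    finally have "\<bar>2 * (x \<bullet> v) / r\<^sup>2\<bar> \<le> 2 * norm v / r"
      using r by (simp add: abs_mult power2_eq_square field_simps)
    then have "\<bar>flat 2 (1 - (x \<bullet> x) / r\<^sup>2)\<bar> * \<bar>2 * (x \<bullet> v) / r\<^sup>2\<bar> \<le> 2 * (2 * norm v / r)"
      using flat_2_le[of "1 - (x \<bullet> x) / r\<^sup>2"] by (intro mult_mono) auto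
    then have "exp 1 * (\<bar>flat 2 (1 - (x \<bullet> x) / r\<^sup>2)\<bar> * \<bar>2 * (x \<bullet> v) / r\<^sup>2\<bar>) \<le> exp 1 * (2 * (2 * norm v / r))"
      by (intro mult_left_mono) auto
    then show ?thesis unfolding u'_def r_def[symmetric] by (simp add: abs_mult mult_ac)
  next
    case False
    then have "(real (Suc n))\<^sup>2 \<le> (norm x)\<^sup>2" by (intro power_mono) auto
    then have "1 - (x \<bullet> x) / (real (Suc n))\<^sup>2 \<le> 0"
      by (simp add: power2_norm_eq_inner field_simps del: of_nat_Suc)
    then have "u' n x v = 0" unfolding u'_def by (simp add: flat_def)
    then show ?thesis by simp
  qed
  have u_lim: "(\<lambda>n. u n x) \<longlonglongrightarrow> 1" for x
  proof -
    have "((\<lambda>n. (1 / real (Suc n)) * (1 / real (Suc n)) * (x \<bullet> x)) \<longlonglongrightarrow> 0 * 0 * (x \<bullet> x))"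
      by (intro tendsto_mult tendsto_const lim_1_over_n[THEN LIMSEQ_Suc])
    from tendsto_diff[OF tendsto_const[of 1] this]
    have lim: "((\<lambda>n. 1 - (x \<bullet> x) / (real (Suc n))\<^sup>2) \<longlonglongrightarrow> 1)"
      by (simp add: power2_eq_square del: of_nat_Suc)
    from tendsto_mult[OF tendsto_const isCont_tendsto_compose[OF DERIV_isCont[OF flat_has_real_derivative] this], of "exp 1" 0]
    have "(\<lambda>n. exp 1 * flat 0 (1 - (x \<bullet> x) / (real (Suc n))\<^sup>2)) \<longlonglongrightarrow> exp 1 * flat 0 1" .
    then show ?thesis by (simp add: u_def bump_def flat_def exp_minus_inverse)
  qed
  define \<phi> where "\<phi> n x = P n x * u n x" for n x
  have D\<phi>: "frechet_derivative (\<phi> n) (at x) = (\<lambda>v. P n x * u' n x v + Q n x v * u n x)" for n x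
    using frechet_derivative_at[OF has_derivative_mult[OF DP Du]] by (simp add: \<phi>_def[abs_def])
  have inv: "1 / real (Suc n) \<le> 1" for n by simp
  show ?thesis
  \<comment> \<open>One constant for both bounds: the summands account for the size of the product,
    the gradient of the cutoff and the gradient of the mollification.\<close>
  proof (rule that[of \<phi> "B * exp 1 + B * (4 * exp 1) + L * exp 1"])
    fix n m
    have "Ck m (P n)" unfolding P_def
      using k[of n] by (intro Ck_mollify[OF _ _ c\<psi> B]) (auto simp: mollifier_def)
    then show "Ck m (\<phi> n)"
      using Ck_bump[of m "real (Suc n)" 0] unfolding \<phi>_def[abs_def] u_def
      by (intro Ck_mult Ck_const) auto
  next
    fix n show "\<exists>R. \<forall>x. norm x > R \<longrightarrow> \<phi> n x = 0"
      by (intro exI[of _ "real (Suc n)"]) (simp add: \<phi>_def u_def bump_eq_0 del: of_nat_Suc)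
  next
    fix n x
    have "\<bar>\<phi> n x\<bar> \<le> B * exp 1"
      unfolding \<phi>_def abs_mult using P_le[of n x] u_le[of n x] B0 by (intro mult_mono) auto
    moreover have "0 \<le> B * (4 * exp 1)" "0 \<le> L * exp 1" using B0 L by auto
    ultimately show "\<bar>\<phi> n x\<bar> \<le> B * exp 1 + B * (4 * exp 1) + L * exp 1" by linarith
  next
    fix n x v
    have "\<bar>u' n x v\<bar> \<le> 4 * exp 1 * norm v"
      using u'_le[of n x v] mult_left_mono[OF inv[of n], of "4 * exp 1 * norm v"] by simp
    then have "\<bar>P n x * u' n x v\<bar> \<le> B * (4 * exp 1 * norm v)"
      unfolding abs_mult using P_le[of n x] B0 by (intro mult_mono) auto
    moreover have "\<bar>Q n x v * u n x\<bar> \<le> (L * norm v) * exp 1"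
      unfolding abs_mult using Q_le[of n x v] u_le[of n x] L by (intro mult_mono) auto
    moreover have "0 \<le> B * exp 1 * norm v" using B0 by simp
    ultimately have "\<bar>P n x * u' n x v + Q n x v * u n x\<bar> \<le> B * exp 1 * norm v + B * (4 * exp 1 * norm v) + (L * norm v) * exp 1"
      by linarith
    then show "\<bar>frechet_derivative (\<phi> n) (at x) v\<bar> \<le> (B * exp 1 + B * (4 * exp 1) + L * exp 1) * norm v"
      unfolding D\<phi> by (simp add: algebra_simps)
  next
    fix x
    have lim0: "(\<lambda>n. c * (1 / real (Suc n)) * d) \<longlonglongrightarrow> 0" for c d
      using tendsto_mult[OF tendsto_mult[OF tendsto_const lim_1_over_n[THEN LIMSEQ_Suc]] tendsto_const, of c d] by simp
    have P_lim: "(\<lambda>n. P n x) \<longlonglongrightarrow> \<psi> x"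
      by (rule LIM_zero_cancel, rule Lim_null_comparison[OF _ lim0[of L 1]]) (use P_diff in simp)
    then show "(\<lambda>n. \<phi> n x) \<longlonglongrightarrow> \<psi> x"
      unfolding \<phi>_def using tendsto_mult[OF P_lim u_lim] by simp
    fix v
    have "(\<lambda>n. Q n x v) \<longlonglongrightarrow> blinfun_apply (\<psi>' x) v"
      by (rule LIM_zero_cancel, rule Lim_null_comparison[OF _ lim0[of K "norm v"]]) (use Q_diff in simp)
    moreover have "(\<lambda>n. u' n x v) \<longlonglongrightarrow> 0"
      by (rule Lim_null_comparison[OF _ lim0[of "4 * exp 1 * norm v" 1]]) (use u'_le in simp)
    ultimately show "(\<lambda>n. frechet_derivative (\<phi> n) (at x) v) \<longlonglongrightarrow> blinfun_apply (\<psi>' x) v"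
      unfolding D\<phi> using P_lim u_lim by (auto intro!: tendsto_eq_intros)
  qed
qed

section \<open>Measurable families of measures\<close>

lemma Mplus_D:
  assumes "\<mu> \<in> Mplus"
  shows "finite_measure \<mu>" "sets \<mu> = sets borel" "space \<mu> = UNIV"
    "f \<in> borel_measurable borel \<Longrightarrow> (f :: _ \<Rightarrow> 'b::topological_space) \<in> borel_measurable \<mu>"
proof -
  show sets: "finite_measure \<mu>" "sets \<mu> = sets borel" using assms by (auto simp: Mplus_def)
  show "space \<mu> = UNIV" using sets_eq_imp_space_eq[OF sets(2)] by simp
  show "f \<in> borel_measurable borel \<Longrightarrow> f \<in> borel_measurable \<mu>"
    using measurable_cong_sets[OF sets(2) refl] by blast
qed

lemma Mplus_integrable:
  fixes f :: "'a::topological_space \<Rightarrow> 'b::{banach, second_countable_topology}"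
  assumes "\<mu> \<in> Mplus" "f \<in> borel_measurable borel" "\<And>x. norm (f x) \<le> B"
  shows "integrable \<mu> f"
  using assms Mplus_D[OF assms(1)] by (intro finite_measure.integrable_const_bound[of \<mu> f B]) auto

lemma Mplus_integral_le:
  fixes f :: "'a::topological_space \<Rightarrow> 'b::{banach, second_countable_topology}"
  assumes "\<mu> \<in> Mplus" "\<And>x. norm (f x) \<le> B" "0 \<le> B" "measure \<mu> UNIV \<le> m"
  shows "norm (\<integral>x. f x \<partial>\<mu>) \<le> B * m"
proof -
  interpret finite_measure \<mu> using Mplus_D[OF assms(1)] by simp
  have "norm (\<integral>x. f x \<partial>\<mu>) \<le> (\<integral>x. B \<partial>\<mu>)"
    using assms by (intro norm_integral_le_AE) auto
  also have "\<dots> \<le> B * m"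
    using assms Mplus_D[OF assms(1)] mult_left_mono by (simp add: mult.commute)
  finally show ?thesis .
qed

text \<open>Lipschitz functions increasing to the indicator of an open \<open>U\<close>. For
  \<open>U = UNIV\<close> the complement is empty, \<open>infdist\<close> to it is 0 by convention
  and the ramp vanishes; \<open>ramp_tendsto_indicator\<close> excludes that case.\<close>

definition ramp :: "'a::euclidean_space set \<Rightarrow> nat \<Rightarrow> 'a \<Rightarrow> real" where
  "ramp U n x = min 1 (real n * infdist x (- U))"

lemma continuous_on_ramp: "continuous_on S (ramp U n)"
  unfolding ramp_def[abs_def] by (intro continuous_intros)

lemma ramp_bounds: "0 \<le> ramp U n x" "ramp U n x \<le> 1"
  by (auto simp: ramp_def infdist_nonneg)

lemma abs_ramp_le: "\<bar>ramp U n x\<bar> \<le> 1"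
  using ramp_bounds[of U n x] by linarith

lemma ramp_lipschitz: "\<bar>ramp U n x - ramp U n y\<bar> \<le> real n * norm (x - y)"
proof -
  have "\<bar>infdist x (- U) - infdist y (- U)\<bar> \<le> dist x y"
    using infdist_triangle_abs by blast
  then have "\<bar>real n * infdist x (- U) - real n * infdist y (- U)\<bar> \<le> real n * norm (x - y)"
    by (simp add: right_diff_distrib[symmetric] abs_mult dist_norm mult_left_mono)
  then show ?thesis unfolding ramp_def by linarith
qed

lemma ramp_tendsto_indicator:
  assumes "open U" "U \<noteq> UNIV"
  shows "(\<lambda>n. ramp U n x) \<longlonglongrightarrow> indicator U x"
proof (cases "x \<in> U")
  case True
  then have d: "infdist x (- U) > 0"
    using assms by (intro infdist_pos_not_in_closed) auto
  then obtain N where N: "1 / infdist x (- U) < real N" using reals_Archimedean2 by blast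
  have "eventually (\<lambda>n. ramp U n x = 1) sequentially"
  proof (rule eventually_sequentiallyI)
    fix n assume "N \<le> n"
    then have "1 / infdist x (- U) \<le> real n" using N by linarith
    then have "1 \<le> real n * infdist x (- U)" using d by (simp add: divide_simps mult.commute)
    then show "ramp U n x = 1" by (simp add: ramp_def)
  qed
  then show ?thesis using True by (simp add: tendsto_eventually)
next
  case False
  then show ?thesis by (simp add: ramp_def)
qed

lemma Mplus_measure_tendsto:
  assumes "\<mu> \<in> Mplus" "\<And>n. (f n :: 'a::topological_space \<Rightarrow> real) \<in> borel_measurable borel" "\<And>n x. \<bar>f n x\<bar> \<le> B"
    "\<And>x. (\<lambda>n. f n x) \<longlonglongrightarrow> indicator U x" "U \<in> sets borel"
  shows "(\<lambda>n. \<integral>x. f n x \<partial>\<mu>) \<longlonglongrightarrow> measure \<mu> U"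
proof -
  interpret finite_measure \<mu> using Mplus_D[OF assms(1)] by simp
  have "(\<lambda>n. \<integral>x. f n x \<partial>\<mu>) \<longlonglongrightarrow> (\<integral>x. indicator U x \<partial>\<mu>)"
    by (rule integral_dominated_convergence[where w="\<lambda>_. B"])
      (use assms Mplus_D[OF assms(1)] in auto)
  then show ?thesis using assms(5) Mplus_D[OF assms(1)] by simp
qed

context
  fixes M :: "'t measure" and \<rho> :: "'t \<Rightarrow> 'a::euclidean_space measure"
  assumes \<rho>: "\<And>t. t \<in> space M \<Longrightarrow> \<rho> t \<in> Mplus"
    and meas: "\<And>f :: 'a \<Rightarrow> real. continuous_on UNIV f \<Longrightarrow> (f \<longlongrightarrow> 0) at_infinity \<Longrightarrow>
      (\<lambda>t. \<integral>x. f x \<partial>\<rho> t) \<in> borel_measurable M"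
begin

text \<open>Boundedness of \<open>U\<close> makes the ramps vanish at infinity, so that they belong
  to the predual against which measurability is assumed.\<close>

lemma measurable_measure_bounded_open:
  assumes "open U" "bounded U"
  shows "(\<lambda>t. measure (\<rho> t) U) \<in> borel_measurable M"
proof (rule borel_measurable_LIMSEQ_real)
  have ne: "U \<noteq> UNIV" using assms(2) not_bounded_UNIV by blast
  obtain R where R: "\<And>x. x \<in> U \<Longrightarrow> norm x \<le> R" using assms(2) by (auto simp: bounded_iff)
  show "(\<lambda>n. \<integral>x. ramp U n x \<partial>\<rho> t) \<longlonglongrightarrow> measure (\<rho> t) U" if "t \<in> space M" for t
    using assms abs_ramp_le ramp_tendsto_indicator[OF assms(1) ne] borel_measurable_continuous_onI[OF continuous_on_ramp]
    by (intro Mplus_measure_tendsto[where B=1] \<rho>[OF that]) auto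
  show "(\<lambda>t. \<integral>x. ramp U n x \<partial>\<rho> t) \<in> borel_measurable M" for n
  proof (rule meas[OF continuous_on_ramp])
    have "eventually (\<lambda>x. ramp U n x = 0) at_infinity"
      unfolding eventually_at_infinity
    proof (intro exI[of _ "R + 1"] allI impI)
      fix x :: 'a assume "R + 1 \<le> norm x"
      then have "x \<in> - U" using R[of x] by auto
      then show "ramp U n x = 0" by (simp add: ramp_def)
    qed
    then show "(ramp U n \<longlongrightarrow> 0) at_infinity" by (rule tendsto_eventually)
  qed
qed

text \<open>The constant 1 does not vanish at infinity, so the total mass is reached through an
  exhaustion by balls.\<close>

lemma measurable_measure_UNIV: "(\<lambda>t. measure (\<rho> t) UNIV) \<in> borel_measurable M"
proof (rule borel_measurable_LIMSEQ_real)
  show "(\<lambda>t. measure (\<rho> t) (ball 0 (real n))) \<in> borel_measurable M" for n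
    by (rule measurable_measure_bounded_open) auto
  show "(\<lambda>n. measure (\<rho> t) (ball 0 (real n))) \<longlonglongrightarrow> measure (\<rho> t) UNIV" if "t \<in> space M" for t
  proof -
    note P = Mplus_D[OF \<rho>[OF that]]
    have "(\<Union>n. ball 0 (real n)) = (UNIV :: 'a set)"
      using reals_Archimedean2 by (auto simp: )
    then show ?thesis
      using finite_measure.finite_Lim_measure_incseq[OF P(1), of "\<lambda>n. ball 0 (real n)"] P
      by (simp add: incseq_def subset_ball image_subset_iff)
  qed
qed

text \<open>Rescaling turns the family into a subprobability kernel, measurable because open boxes
  form an intersection-stable generator; integrals against such kernels are measurable in the
  parameter. The parameter space \<open>M\<close> is left general: it is time for averages, and the
  product of time and space for convolutions.\<close>

lemma measurable_integral_kernel: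
  fixes g :: "'t \<Rightarrow> 'a \<Rightarrow> real"
  assumes g: "(\<lambda>(t, x). g t x) \<in> borel_measurable (M \<Otimes>\<^sub>M borel)"
  shows "(\<lambda>t. \<integral>x. g t x \<partial>\<rho> t) \<in> borel_measurable M"
proof -
  note [measurable] = g measurable_measure_UNIV
  \<comment> \<open>The summand 1 keeps the divisor positive when the measure is zero.\<close>
  define c where "c t = 1 + measure (\<rho> t) UNIV" for t
  have c: "c t \<ge> 1" for t by (simp add: c_def)
  have [measurable]: "c \<in> borel_measurable M" by (simp add: c_def[abs_def])
  define \<kappa> where "\<kappa> t = density (\<rho> t) (\<lambda>_. ennreal (1 / c t))" for t
  have em: "emeasure (\<kappa> t) A = ennreal (measure (\<rho> t) A / c t)" if "t \<in> space M" "A \<in> sets borel" for t A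
  proof -
    interpret finite_measure "\<rho> t" using Mplus_D[OF \<rho>[OF that(1)]] by simp
    show ?thesis
      using that c[of t] Mplus_D[OF \<rho>[OF that(1)]] by (simp add: \<kappa>_def emeasure_density_const emeasure_eq_measure ennreal_mult'[symmetric])
  qed
  have \<kappa>[measurable]: "\<kappa> \<in> measurable M (subprob_algebra borel)"
  proof (rule measurable_subprob_algebra_generated[where \<Omega>=UNIV and G="range (\<lambda>(a, b). box a b)"])
    show "sets borel = sigma_sets UNIV (range (\<lambda>(a, b). box a b) :: 'a set set)"
      by (subst borel_eq_box) simp
    show "Int_stable (range (\<lambda>(a, b). box a b) :: 'a set set)"
      by (auto simp: Int_stable_def box_Int_box)
    show "subprob_space (\<kappa> t)" if "t \<in> space M" for t
    proof
      have sp: "space (\<kappa> t) = UNIV" using Mplus_D[OF \<rho>[OF that]] by (simp add: \<kappa>_def)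
      show "emeasure (\<kappa> t) (space (\<kappa> t)) \<le> 1"
      proof -
        have "measure (\<rho> t) UNIV \<le> c t" "0 < c t" using c[of t] by (simp add: c_def, linarith)
        then have "measure (\<rho> t) UNIV / c t \<le> 1" by simp
        then show ?thesis unfolding sp using em[OF that, of UNIV] by simp
      qed
      show "space (\<kappa> t) \<noteq> {}" using sp by simp
    qed
    show "sets (\<kappa> t) = sets borel" if "t \<in> space M" for t
      using Mplus_D[OF \<rho>[OF that]] by (simp add: \<kappa>_def)
    show "(\<lambda>t. emeasure (\<kappa> t) A) \<in> borel_measurable M" if "A \<in> range (\<lambda>(a, b). box a b)" for A
    proof -
      have "open A" "bounded A" using that by auto
      note [measurable] = measurable_measure_bounded_open[OF this]
      have "(\<lambda>t. ennreal (measure (\<rho> t) A / c t)) \<in> borel_measurable M" by measurable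
      then show ?thesis using \<open>open A\<close> by (subst measurable_cong[OF em]) auto
    qed
    have "(\<lambda>t. ennreal (measure (\<rho> t) UNIV / c t)) \<in> borel_measurable M" by measurable
    then show "(\<lambda>t. emeasure (\<kappa> t) UNIV) \<in> borel_measurable M" by (subst measurable_cong[OF em]) auto
  qed auto
  note integral_measurable_subprob_algebra[measurable] measurable_distr2[measurable]
  \<comment> \<open>The integrand depends on \<open>t\<close> as well; pushing forward under
    \<open>x \<mapsto> (t, x)\<close> moves this dependence into the measure.\<close>
  have "(\<lambda>t. integral\<^sup>L (distr (\<kappa> t) (M \<Otimes>\<^sub>M borel) (\<lambda>x. (t, x))) (\<lambda>(t, x). g t x)) \<in> borel_measurable M"
    by measurable
  then have "(\<lambda>t. c t * integral\<^sup>L (distr (\<kappa> t) (M \<Otimes>\<^sub>M borel) (\<lambda>x. (t, x))) (\<lambda>(t, x). g t x)) \<in> borel_measurable M"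
    by measurable
  then show ?thesis
  proof (rule measurable_cong[THEN iffD1, rotated])
    fix t assume t: "t \<in> space M"
    note P = Mplus_D[OF \<rho>[OF t]]
    have gt: "g t \<in> borel_measurable borel"
      using measurable_compose[OF measurable_Pair1'[OF t] g] by simp
    have "integral\<^sup>L (distr (\<kappa> t) (M \<Otimes>\<^sub>M borel) (\<lambda>x. (t, x))) (\<lambda>(t, x). g t x) = (\<integral>x. g t x \<partial>\<kappa> t)"
      using t P by (subst integral_distr[OF _ g]) (auto simp: \<kappa>_def)
    also have "\<dots> = (\<integral>x. g t x \<partial>\<rho> t) / c t"
      unfolding \<kappa>_def using c[of t] P(4)[OF gt] by (subst integral_density) auto
    finally show "c t * integral\<^sup>L (distr (\<kappa> t) (M \<Otimes>\<^sub>M borel) (\<lambda>x. (t, x))) (\<lambda>(t, x). g t x) = (\<integral>x. g t x \<partial>\<rho> t)"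
      using c[of t] by simp
  qed
qed

end

text \<open>For continuous \<open>f\<close> the set where an essential bound fails is open and null,
  hence empty; so the bound from \<open>Linfty\<close> holds everywhere.\<close>

lemma Linfty_Lip_bounds:
  fixes f :: "'a::euclidean_space \<Rightarrow> 'b::euclidean_space"
  assumes "f \<in> Linfty \<inter> Lip"
  obtains B L where "B \<ge> 0" "\<And>x. norm (f x) \<le> B" "L \<ge> 0" "\<And>x y. norm (f x - f y) \<le> L * norm (x - y)"
    "continuous_on UNIV f"
proof -
  obtain L where L: "L-lipschitz_on UNIV f" using assms by (auto simp: Lip_def)
  obtain C where C: "AE x in lebesgue. norm (f x) \<le> C" using assms by (auto simp: Linfty_def)
  have cont: "continuous_on UNIV f" using L by (rule lipschitz_on_continuous_on)
  have op: "open {x. C < norm (f x)}"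
    by (intro open_Collect_less continuous_intros cont)
  have "{x. C < norm (f x)} \<in> null_sets lebesgue"
    using C op by (subst AE_iff_null_sets) (auto simp: not_less intro!: sets_completionI_sets)
  then have "{x. C < norm (f x)} = {}"
    using op open_not_negligible negligible_iff_null_sets by blast
  then have le: "norm (f x) \<le> C" for x by (auto simp: not_less[symmetric])
  have "norm (f x) \<le> \<bar>C\<bar>" for x using le[of x] by linarith
  moreover have "norm (f x - f y) \<le> L * norm (x - y)" for x y
    using lipschitz_onD[OF L, of x y] by (simp add: dist_norm)
  ultimately show ?thesis
    using that[of "\<bar>C\<bar>" L] lipschitz_on_nonneg[OF L] cont by auto
qed

section \<open>Testing in time\<close>

text \<open>A Dynkin argument: vanishing integrals pass from open intervals to Borel sets, then to
  Lebesgue sets, which differ from Borel sets by null sets. Finally \<open>g\<close> and 0 are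
  compared as densities.\<close>

lemma AE_zero_of_interval_integrals:
  fixes g :: "real \<Rightarrow> real"
  assumes g: "integrable lebesgue g" and I: "\<And>p q. (\<integral>x. indicator {p<..<q} x * g x \<partial>lebesgue) = 0"
  shows "AE x in lebesgue. g x = 0"
proof -
  have int: "integrable lebesgue (\<lambda>x. indicator A x * g x)" if "A \<in> sets lebesgue" for A
    using integrable_mult_indicator[OF that g] by simp
  have borel_sigma: "sets borel = sigma_sets UNIV (range (\<lambda>(a, b). {a<..<b::real}))"
  proof -
    have eq: "(\<lambda>(a, b). box a b) = (\<lambda>(a, b). {a<..<b::real})" by (auto simp: fun_eq_iff)
    show ?thesis unfolding borel_eq_box eq by simp
  qed
  have borel: "(\<integral>x. indicator A x * g x \<partial>lebesgue) = 0" if "A \<in> sets borel" for A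
  proof -
    have sets: "B \<in> sets lebesgue" if "B \<in> sigma_sets UNIV (range (\<lambda>(a, b). {a<..<b::real}))" for B
      using that by (intro sets_completionI_sets) (simp add: borel_sigma)
    have A: "A \<in> sigma_sets UNIV (range (\<lambda>(a, b). {a<..<b::real}))"
      using that by (simp add: borel_sigma)
    have IS: "Int_stable (range (\<lambda>(a, b). {a<..<b::real}))" "range (\<lambda>(a, b). {a<..<b::real}) \<subseteq> Pow UNIV"
      by (auto simp: Int_stable_def)
    from IS A show ?thesis
    proof (induction rule: sigma_sets_induct_disjoint)
      case (basic A)
      then show ?case using I by auto
    next
      case empty
      show ?case by simp
    next
      case (compl A)
      \<comment> \<open>Complements require the integral over the whole line, which is the limit
        over the intervals from -n to n.\<close>
      have "(\<integral>x. g x \<partial>lebesgue) = 0"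
      proof -
        have "(\<lambda>n. \<integral>x. indicator {- real n<..<real n} x * g x \<partial>lebesgue) \<longlonglongrightarrow> (\<integral>x. g x \<partial>lebesgue)"
        proof (rule integral_dominated_convergence[where w="\<lambda>x. norm (g x)"])
          have "(\<lambda>n. indicator {- real n<..<real n} x * g x) \<longlonglongrightarrow> g x" for x
          proof -
            obtain N where N: "\<bar>x\<bar> < real N" using reals_Archimedean2 by blast
            have "eventually (\<lambda>n. indicator {- real n<..<real n} x * g x = g x) sequentially"
              by (rule eventually_sequentiallyI[of N]) (use N in \<open>auto simp: indicator_def\<close>)
            then show ?thesis by (rule tendsto_eventually)
          qed
          then show "AE x in lebesgue. (\<lambda>n. indicator {- real n<..<real n} x * g x) \<longlonglongrightarrow> g x" by simp
          show "(\<lambda>x. indicator {- real n<..<real n} x * g x) \<in> borel_measurable lebesgue" for n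
            using int[of "{- real n<..<real n}"] by auto
        qed (use g in \<open>auto simp: indicator_def\<close>)
        then show ?thesis by (simp add: I LIMSEQ_const_iff)
      qed
      moreover have "(\<integral>x. indicator (UNIV - A) x * g x \<partial>lebesgue) = (\<integral>x. g x - indicator A x * g x \<partial>lebesgue)"
        by (intro Bochner_Integration.integral_cong) (auto simp: indicator_def)
      ultimately show ?case
        using compl int[OF sets[OF compl(1)]] g by simp
    next
      case (union A)
      have A: "A i \<in> sets lebesgue" for i using union(2) by (intro sets) auto
      then have "set_integrable lebesgue (\<Union>i. A i) g"
        unfolding set_integrable_def using int[of "\<Union>i. A i"] by auto
      then have "(LINT x:(\<Union>i. A i)|lebesgue. g x) = (\<Sum>i. (LINT x:(A i)|lebesgue. g x))"
        using union(1) A by (intro lebesgue_integral_countable_add) (auto simp: disjoint_family_on_def)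
      then show ?case using union by (simp add: set_lebesgue_integral_def)
    qed
  qed
  have "(\<integral>x. indicator A x * g x \<partial>lebesgue) = 0" if A: "A \<in> sets lebesgue" for A
  proof -
    obtain S N N' where S: "A = S \<union> N" "N \<subseteq> N'" "N' \<in> null_sets lborel" "S \<in> sets lborel"
      using sets_completionE[OF A] by blast
    have "AE x in lebesgue. x \<notin> N'"
      using S(3) by (intro AE_completion AE_not_in)
    then have "AE x in lebesgue. indicator A x * g x = indicator S x * g x"
      by (rule eventually_mono) (use S in \<open>auto simp: indicator_def\<close>)
    moreover have "S \<in> sets lebesgue" using S by (intro sets_completionI_sets) simp
    ultimately have "(\<integral>x. indicator A x * g x \<partial>lebesgue) = (\<integral>x. indicator S x * g x \<partial>lebesgue)"
      using int[OF A] int[of S] by (intro integral_cong_AE) auto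
    then show ?thesis using borel S by simp
  qed
  then show ?thesis
    using density_unique_real[OF g integrable_zero] by (simp add: set_lebesgue_integral_def)
qed

lemma Ck_diff: "Ck n f \<Longrightarrow> Ck n g \<Longrightarrow> Ck n (\<lambda>x. f x - g x)"
  using Ck_add[of n f "\<lambda>x. (-1) * g x"] Ck_mult[OF Ck_const] by fastforce

lemma smooth_antiderivative:
  fixes u :: "real \<Rightarrow> real"
  assumes u: "\<And>n. Ck n u" and supp: "\<And>t. t \<le> a \<or> t \<ge> c \<Longrightarrow> u t = 0" and ac: "p < a" "a \<le> c"
  defines "A \<equiv> \<lambda>t. integral {p..t} u"
  shows "(A has_real_derivative u t) (at t)" "t \<le> a \<Longrightarrow> A t = 0" "t \<ge> c \<Longrightarrow> A t = A c"
proof -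
  have cont: "continuous_on S u" for S by (rule Ck_imp_continuous_on[OF u[of 0]])
  have zero: "A t = 0" if "t \<le> a" for t
    unfolding A_def using that supp by (intro integral_unique has_integral_is_0) auto
  show "t \<le> a \<Longrightarrow> A t = 0" by (rule zero)
  show "(A has_real_derivative u t) (at t)"
  proof (cases "t < a")
    \<comment> \<open>Left of the support \<open>A\<close> vanishes near \<open>t\<close>. This
      covers the base point \<open>p\<close> and the points before it, where the fundamental theorem
      gives no two-sided derivative.\<close>
    case True
    have "((\<lambda>_. 0) has_real_derivative u t) (at t)" using True supp[of t] by simp
    moreover have "\<forall>\<^sub>F s in nhds t. 0 = A s"
      by (rule eventually_mono[OF eventually_nhds_in_open[of "{..<a}" t]]) (use True zero in auto)
    ultimately show ?thesis by (rule iffD1[OF DERIV_cong_ev[OF refl _ refl], rotated])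
  next
    case False
    then have "(A has_real_derivative u t) (at t within {p..t+1})"
      unfolding A_def using ac by (intro integral_has_real_derivative cont) auto
    moreover have "at t within {p..t+1} = at t" using False ac by (intro at_within_Icc_at) auto
    ultimately show ?thesis by simp
  qed
  show "A t = A c" if "t \<ge> c"
  proof -
    have "integral {p..c} u + integral {c..t} u = integral {p..t} u"
      using that ac by (intro Henstock_Kurzweil_Integration.integral_combine integrable_continuous_real cont) auto
    moreover have "integral {c..t} u = 0"
      using supp by (intro integral_unique has_integral_is_0) auto
    ultimately show ?thesis by (simp add: A_def)
  qed
qed

text \<open>Compact support in the open half line below \<open>T\<close>, with any value at 0
  allowed: this is how the initial datum enters.\<close>

definition time_test :: "real \<Rightarrow> (real \<Rightarrow> real) \<Rightarrow> bool" where
  "time_test T \<theta> \<longleftrightarrow> (\<forall>n. Ck n \<theta>) \<and> (\<exists>R c. c < T \<and> (\<forall>t. t < R \<or> t > c \<longrightarrow> \<theta> t = 0))"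

lemma time_test_antiderivative:
  fixes u :: "real \<Rightarrow> real"
  assumes u: "\<And>n. Ck n u" and supp: "\<And>t. t \<le> a \<or> t \<ge> c \<Longrightarrow> u t = 0" and ac: "0 \<le> a" "a \<le> c" "c < T"
  obtains \<theta> where "time_test T \<theta>" "\<And>t. t \<in> {0..T} \<Longrightarrow> deriv \<theta> t = u t"
    "\<And>t. t \<in> {0..T} \<Longrightarrow> \<theta> t = - (\<integral>s. indicator {t..} s * u s \<partial>lebesgue_on {0..T})"
proof -
  define A where "A t = integral {-1..t} u" for t
  have "-1 < a" using ac by simp
  note A = smooth_antiderivative[where u=u and a=a and c=c and p="-1", OF u supp this ac(2), folded A_def]
  \<comment> \<open>\<open>A\<close> alone stays constant after \<open>c\<close>; subtracting its
    shift by \<open>T\<close> makes the difference vanish there and for very negative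
    \<open>t\<close>. On \<open>{0..T}\<close> the shifted term is the constant \<open>A c\<close>,
    so the derivative is still \<open>u\<close>.\<close>
  define \<theta> where "\<theta> t = A t - A (t + T)" for t
  have D: "(\<theta> has_real_derivative u t - u (t + T)) (at t)" for t
    unfolding \<theta>_def[abs_def] by (intro DERIV_diff A(1) iffD1[OF DERIV_shift A(1)])
  have cont: "continuous_on S u" for S by (rule Ck_imp_continuous_on[OF u[of 0]])
  have "Ck n \<theta>" for n
  proof (cases n)
    case 0
    then show ?thesis
      by (auto intro!: continuous_at_imp_continuous_on DERIV_isCont[OF D])
  next
    case (Suc m)
    have "Ck m (\<lambda>t. (u t - u (t + T)) * v)" for v
      by (intro Ck_mult Ck_diff Ck_const Ck_translate u)
    then show ?thesis
      unfolding Suc by (intro Ck_SucI[OF D[unfolded has_field_derivative_def]])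
  qed
  moreover have "\<exists>R c. c < T \<and> (\<forall>t. t < R \<or> t > c \<longrightarrow> \<theta> t = 0)"
  proof (rule exI[of _ "- T"], rule exI[of _ c], intro conjI allI impI)
    fix t assume "t < - T \<or> c < t"
    then show "\<theta> t = 0"
    proof
      assume "t < - T"
      then show ?thesis using ac by (simp add: \<theta>_def A(2))
    next
      assume "c < t"
      then show ?thesis using ac by (simp add: \<theta>_def A(3)[of t] A(3)[of "t + T"])
    qed
  qed (rule ac)
  ultimately have 1: "time_test T \<theta>" by (auto simp: time_test_def)
  have 2: "deriv \<theta> t = u t" if "t \<in> {0..T}" for t
    using DERIV_imp_deriv[OF D] that supp[of "t + T"] ac by simp
  have 3: "\<theta> t = - (\<integral>s. indicator {t..} s * u s \<partial>lebesgue_on {0..T})" if t: "t \<in> {0..T}" for t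
  proof -
    have "\<theta> t = A t - A T"
      using t ac by (simp add: \<theta>_def A(3)[of "t + T"] A(3)[of T])
    also have "\<dots> = - integral {t..T} u"
      using Henstock_Kurzweil_Integration.integral_combine[of "-1" t T u] t
      by (simp add: A_def integrable_continuous_real cont)
    also have "integral {t..T} u = integral\<^sup>L (lebesgue_on {t..T}) u"
      by (intro lebesgue_integral_eq_integral[symmetric] continuous_imp_integrable_real cont) auto
    also have "\<dots> = (\<integral>s. indicator {t..T} s * u s \<partial>lebesgue)"
      by (subst integral_restrict_space) auto
    also have "\<dots> = (\<integral>s. indicator {0..T} s * (indicator {t..} s * u s) \<partial>lebesgue)"
      using t by (intro Bochner_Integration.integral_cong) (auto simp: indicator_def)
    also have "\<dots> = (\<integral>s. indicator {t..} s * u s \<partial>lebesgue_on {0..T})"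
      by (subst integral_restrict_space) auto
    finally show ?thesis .
  qed
  show ?thesis using that 1 2 3 by blast
qed

text \<open>The approximants are smooth, take values in [0,1] and vanish outside the interval
  itself, so for an interval well inside ]0,T[ they remain admissible in time.\<close>

lemma bump_exp_tendsto_indicator:
  fixes z t :: real
  assumes "r > 0"
  shows "(\<lambda>n. 1 - exp (- real n * bump r (t - z))) \<longlonglongrightarrow> indicator {z - r<..<z + r} t"
proof (cases "\<bar>t - z\<bar> < r")
  case True
  then have "bump r (t - z) > 0" using assms by (simp add: bump_pos_iff)
  then have "filterlim (\<lambda>n. real n * bump r (t - z)) at_top sequentially"
    by (intro filterlim_at_top_mult_tendsto_pos[OF tendsto_const] filterlim_real_sequentially)
  then have "filterlim (\<lambda>n. - real n * bump r (t - z)) at_bot sequentially"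
    by (simp add: filterlim_uminus_at_top)
  then have "(\<lambda>n. exp (- real n * bump r (t - z))) \<longlonglongrightarrow> 0"
    by (rule filterlim_compose[OF exp_at_bot])
  then have "(\<lambda>n. 1 - exp (- real n * bump r (t - z))) \<longlonglongrightarrow> 1 - 0"
    by (intro tendsto_diff tendsto_const)
  moreover have "t \<in> {z - r<..<z + r}" using True by auto
  ultimately show ?thesis by simp
next
  case False
  then have "bump r (t - z) = 0" using assms by (simp add: bump_eq_0)
  moreover have "t \<notin> {z - r<..<z + r}" using False by auto
  ultimately show ?thesis by simp
qed

text \<open>The fundamental lemma with the initial value built in. For \<open>\<theta>\<close> the
  antiderivative of \<open>u\<close> that vanishes at \<open>T\<close>, Fubini turns the weak
  identity into the vanishing of the integral of \<open>u\<close> times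
  \<open>m t - m0 - W t\<close>, and the admissible \<open>u\<close> approximate indicators of
  intervals.\<close>

lemma du_Bois_Reymond:
  fixes m w :: "real \<Rightarrow> real"
  assumes \<mu>_def: "\<mu> = lebesgue_on {0..T}" and m: "integrable \<mu> m" and w: "integrable \<mu> w"
    and weak: "\<And>\<theta>. time_test T \<theta> \<Longrightarrow> (\<integral>t. deriv \<theta> t * m t + \<theta> t * w t \<partial>\<mu>) + \<theta> 0 * m0 = 0"
    and T: "T > 0"
  shows "AE t in \<mu>. m t = m0 + (\<integral>s. indicator {..t} s * w s \<partial>\<mu>)"
proof -
  interpret \<mu>: finite_measure \<mu>
    unfolding \<mu>_def by (rule finite_measure_lebesgue_on) simp
  interpret P: pair_sigma_finite \<mu> \<mu> ..
  have sp: "space \<mu> = {0..T}" by (simp add: \<mu>_def)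
  have idm: "(\<lambda>x. x) \<in> borel_measurable \<mu>"
    unfolding \<mu>_def by (intro continuous_imp_measurable_on_sets_lebesgue continuous_intros) auto
  note [measurable] = idm borel_measurable_integrable[OF m] borel_measurable_integrable[OF w]
  define W where "W t = (\<integral>s. indicator {..t} s * w s \<partial>\<mu>)" for t
  have le_meas: "{p \<in> space (\<mu> \<Otimes>\<^sub>M \<mu>). fst p \<le> snd p} \<in> sets (\<mu> \<Otimes>\<^sub>M \<mu>)"
  proof -
    have [measurable]: "(\<lambda>p. fst p) \<in> borel_measurable (\<mu> \<Otimes>\<^sub>M \<mu>)" "(\<lambda>p. snd p) \<in> borel_measurable (\<mu> \<Otimes>\<^sub>M \<mu>)"
      using measurable_compose[OF measurable_fst idm] measurable_compose[OF measurable_snd idm] by auto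
    show ?thesis by measurable
  qed
  \<comment> \<open>The order relation on the square as one measurable function. Integrated in its
    first variable it produces \<open>W\<close>, in its second it produces \<open>\<theta>\<close>,
    so Fubini can exchange the two.\<close>
  define J where "J = (indicator {p \<in> space (\<mu> \<Otimes>\<^sub>M \<mu>). fst p \<le> snd p} :: real \<times> real \<Rightarrow> real)"
  have J[measurable]: "J \<in> borel_measurable (\<mu> \<Otimes>\<^sub>M \<mu>)" unfolding J_def using le_meas by measurable
  have J_eq: "J (s, t) = indicator {..t} s" "J (s, t) = indicator {s..} t" if "s \<in> {0..T}" "t \<in> {0..T}" for s t
    using that by (auto simp: J_def space_pair_measure sp indicator_def)
  have J_le: "\<bar>J p\<bar> \<le> 1" for p by (simp add: J_def indicator_def)
  have W_eq: "W t = (\<integral>s. J (s, t) * w s \<partial>\<mu>)" if "t \<in> {0..T}" for t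
    unfolding W_def using that by (intro Bochner_Integration.integral_cong) (auto simp: sp J_eq)
  have W_meas: "W \<in> borel_measurable \<mu>"
  proof -
    have "(\<lambda>t. \<integral>s. J (s, t) * w s \<partial>\<mu>) \<in> borel_measurable \<mu>" by measurable
    then show ?thesis using W_eq by (subst measurable_cong[of \<mu> W]) (auto simp: sp)
  qed
  have W_le: "\<bar>W t\<bar> \<le> (\<integral>s. \<bar>w s\<bar> \<partial>\<mu>)" for t
    unfolding W_def real_norm_def[symmetric] using w
    by (intro norm_integral_le_AE) (auto simp: indicator_def)
  have W: "integrable \<mu> W"
    by (rule \<mu>.integrable_const_bound[where B="\<integral>s. \<bar>w s\<bar> \<partial>\<mu>"]) (use W_le W_meas in auto)
  define g where "g t = m t - m0 - W t" for t
  have g: "integrable \<mu> g" unfolding g_def using m W by simp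
  have smooth: "(\<integral>t. u t * g t \<partial>\<mu>) = 0"
    if u: "\<And>n. Ck n u" and supp: "\<And>t. t \<le> a \<or> t \<ge> c \<Longrightarrow> u t = 0" and ac: "0 \<le> a" "a \<le> c" "c < T"
      and bd: "\<And>t. \<bar>u t\<bar> \<le> 1" for u a c
  proof -
    obtain \<theta> where \<theta>: "time_test T \<theta>" "\<And>t. t \<in> {0..T} \<Longrightarrow> deriv \<theta> t = u t"
      "\<And>t. t \<in> {0..T} \<Longrightarrow> \<theta> t = - (\<integral>s. indicator {t..} s * u s \<partial>\<mu>)"
      using time_test_antiderivative[OF u supp ac] unfolding \<mu>_def by blast
    have um[measurable]: "u \<in> borel_measurable \<mu>"
      unfolding \<mu>_def by (intro continuous_imp_measurable_on_sets_lebesgue Ck_imp_continuous_on[OF u[of 0]]) auto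
    have ui: "integrable \<mu> u"
      by (rule \<mu>.integrable_const_bound[where B=1]) (use bd in auto)
    have uf: "integrable \<mu> (\<lambda>t. u t * f t)" if f: "integrable \<mu> f" for f
      by (rule Bochner_Integration.integrable_bound[OF f])
        (use f bd in \<open>auto simp: abs_mult mult_left_le_one_le\<close>)
    have "integrable (\<mu> \<Otimes>\<^sub>M \<mu>) (\<lambda>(t, s). w t * u s)"
    proof (rule P.Fubini_integrable)
      show "integrable \<mu> (\<lambda>t. \<integral>s. norm (case (t, s) of (t, s) \<Rightarrow> w t * u s) \<partial>\<mu>)"
        using w by (simp add: abs_mult)
      show "AE t in \<mu>. integrable \<mu> (\<lambda>s. case (t, s) of (t, s) \<Rightarrow> w t * u s)" using ui by simp
    qed measurable
    then have "integrable (\<mu> \<Otimes>\<^sub>M \<mu>) (\<lambda>p. J p * (case p of (t, s) \<Rightarrow> w t * u s))"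
      by (rule Bochner_Integration.integrable_bound)
        (auto simp: abs_mult J_le mult_left_le_one_le simp del: abs_mult_less intro!: mult_left_le_one_le)
    then have "integrable (\<mu> \<Otimes>\<^sub>M \<mu>) (\<lambda>(t, s). J (t, s) * (w t * u s))"
      by (simp add: case_prod_beta')
    from P.Fubini_integral[OF this]
    have F: "(\<integral>s. \<integral>t. J (t, s) * (w t * u s) \<partial>\<mu> \<partial>\<mu>) = (\<integral>t. \<integral>s. J (t, s) * (w t * u s) \<partial>\<mu> \<partial>\<mu>)" .
    have "(\<integral>t. \<theta> t * w t \<partial>\<mu>) = - (\<integral>t. \<integral>s. J (t, s) * (w t * u s) \<partial>\<mu> \<partial>\<mu>)"
    proof -
      have "\<theta> t * w t = - (\<integral>s. J (t, s) * (w t * u s) \<partial>\<mu>)" if t: "t \<in> {0..T}" for t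
      proof -
        have "(\<integral>s. J (t, s) * (w t * u s) \<partial>\<mu>) = (\<integral>s. w t * (indicator {t..} s * u s) \<partial>\<mu>)"
          using t by (intro Bochner_Integration.integral_cong) (auto simp: J_eq(2) sp)
        then show ?thesis using \<theta>(3)[OF t] by simp
      qed
      then show ?thesis
        by (subst Bochner_Integration.integral_minus[symmetric], intro Bochner_Integration.integral_cong) (auto simp: sp)
    qed
    also have "\<dots> = - (\<integral>s. u s * W s \<partial>\<mu>)"
    proof -
      have "(\<integral>t. J (t, s) * (w t * u s) \<partial>\<mu>) = u s * W s" if s: "s \<in> {0..T}" for s
        unfolding W_eq[OF s] by (subst integral_mult_right_zero[symmetric]) (auto simp: mult_ac)
      then show ?thesis unfolding F[symmetric]
        by (auto intro!: Bochner_Integration.integral_cong simp: sp)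
    qed
    finally have tw: "(\<integral>t. \<theta> t * w t \<partial>\<mu>) = - (\<integral>s. u s * W s \<partial>\<mu>)" .
    have \<theta>_le: "\<bar>\<theta> t\<bar> \<le> (\<integral>s. \<bar>u s\<bar> \<partial>\<mu>)" if "t \<in> {0..T}" for t
      using norm_integral_le_AE[of \<mu> "\<lambda>s. \<bar>u s\<bar>" "\<lambda>s. indicator {t..} s * u s"] ui \<theta>(3)[OF that]
      by (auto simp: indicator_def)
    have \<theta>m[measurable]: "\<theta> \<in> borel_measurable \<mu>"
      unfolding \<mu>_def using \<theta>(1)
      by (intro continuous_imp_measurable_on_sets_lebesgue Ck_imp_continuous_on[of 0]) (auto simp: time_test_def)
    have \<theta>w: "integrable \<mu> (\<lambda>t. \<theta> t * w t)"
    proof (rule Bochner_Integration.integrable_bound)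
      show "integrable \<mu> (\<lambda>t. (\<integral>s. \<bar>u s\<bar> \<partial>\<mu>) * w t)" using w by simp
      show "AE t in \<mu>. norm (\<theta> t * w t) \<le> norm ((\<integral>s. \<bar>u s\<bar> \<partial>\<mu>) * w t)"
        by (intro AE_I2) (simp add: abs_mult mult_right_mono \<theta>_le sp)
    qed simp
    have "(\<integral>t. deriv \<theta> t * m t + \<theta> t * w t \<partial>\<mu>) = (\<integral>t. u t * m t + \<theta> t * w t \<partial>\<mu>)"
      using \<theta>(2) by (intro Bochner_Integration.integral_cong) (auto simp: sp)
    also have "\<dots> = (\<integral>t. u t * m t \<partial>\<mu>) - (\<integral>s. u s * W s \<partial>\<mu>)"
      using uf[OF m] \<theta>w tw by simp
    finally have 1: "(\<integral>t. u t * m t \<partial>\<mu>) - (\<integral>s. u s * W s \<partial>\<mu>) + \<theta> 0 * m0 = 0"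
      using weak[OF \<theta>(1)] by simp
    have "(\<integral>s. indicator {0..} s * u s \<partial>\<mu>) = (\<integral>s. u s \<partial>\<mu>)"
      by (intro Bochner_Integration.integral_cong) (auto simp: sp)
    then have "\<theta> 0 = - (\<integral>s. u s \<partial>\<mu>)" using \<theta>(3)[of 0] T by simp
    with 1 show ?thesis
      unfolding g_def using uf[OF m] uf[OF W] ui by (simp add: right_diff_distrib)
  qed
  have inner: "(\<integral>t. indicator {p<..<q} t * g t \<partial>\<mu>) = 0" if pq: "0 < p" "p < q" "q < T" for p q
  proof -
    define z r where "z = (p + q) / 2" and "r = (q - p) / 2"
    have r: "r > 0" "z - r = p" "z + r = q" using pq by (auto simp: z_def r_def field_simps)
    define u where "u n t = 1 - exp (- real n * bump r (t - z))" for n t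
    have "(\<integral>t. u n t * g t \<partial>\<mu>) = 0" for n
    proof (rule smooth[where a=p and c=q])
      show "Ck k (u n)" for k unfolding u_def[abs_def]
        by (intro Ck_diff Ck_exp Ck_mult Ck_const Ck_bump)
      show "u n t = 0" if "t \<le> p \<or> q \<le> t" for t
        using that r pq by (auto simp: u_def bump_eq_0)
      show "\<bar>u n t\<bar> \<le> 1" for t by (simp add: u_def bump_nonneg)
    qed (use pq in auto)
    moreover have "(\<lambda>n. \<integral>t. u n t * g t \<partial>\<mu>) \<longlonglongrightarrow> (\<integral>t. indicator {p<..<q} t * g t \<partial>\<mu>)"
    proof (rule integral_dominated_convergence[where w="\<lambda>t. norm (g t)"])
      show "AE t in \<mu>. (\<lambda>n. u n t * g t) \<longlonglongrightarrow> indicator {p<..<q} t * g t"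
        using bump_exp_tendsto_indicator[OF r(1), of _ z] unfolding r u_def
        by (intro AE_I2 tendsto_mult tendsto_const)
      show "AE t in \<mu>. norm (u n t * g t) \<le> norm (g t)" for n
        by (auto simp: u_def abs_mult bump_nonneg intro!: mult_left_le_one_le)
      have "u n \<in> borel_measurable \<mu>" for n
        unfolding \<mu>_def u_def[abs_def]
        by (intro continuous_imp_measurable_on_sets_lebesgue continuous_intros Ck_imp_continuous_on[OF Ck_bump[of 0]]) auto
      then show "(\<lambda>t. u n t * g t) \<in> borel_measurable \<mu>" for n using g by auto
      show "(\<lambda>t. indicator {p<..<q} t * g t) \<in> borel_measurable \<mu>"
      proof -
        have "{p<..<q} \<in> sets \<mu>" unfolding \<mu>_def using pq by (subst sets_restrict_space_iff) auto
        then show ?thesis using g by (intro borel_measurable_times borel_measurable_indicator) auto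
      qed
    qed (use g in auto)
    ultimately show ?thesis by (simp add: LIMSEQ_const_iff)
  qed
  \<comment> \<open>Extended by zero to the whole line, where
    \<open>AE_zero_of_interval_integrals\<close> applies.\<close>
  define g0 where "g0 t = indicator {0..T} t * g t" for t
  have g0: "integrable lebesgue g0"
    using g unfolding \<mu>_def g0_def by (subst (asm) integrable_restrict_space) auto
  have "AE t in lebesgue. g0 t = 0"
  proof (rule AE_zero_of_interval_integrals[OF g0])
    fix p q :: real
    \<comment> \<open>An arbitrary interval is cut down to ]0,T[ and shrunk by 1/(n+1), so that
      \<open>inner\<close> applies; only the points 0 and \<open>T\<close> can be lost in the
      limit.\<close>
    define P Q where "P n = max p 0 + 1 / real (Suc n)" and "Q n = min q T - 1 / real (Suc n)" for n
    have "(\<integral>x. indicator {P n<..<Q n} x * g0 x \<partial>lebesgue) = 0" for n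
    proof (cases "P n < Q n")
      case True
      have "0 < 1 / real (Suc n)" by simp
      then have "0 < P n" "Q n < T" unfolding P_def Q_def by linarith+
      then have "(\<integral>t. indicator {P n<..<Q n} t * g t \<partial>\<mu>) = 0" using True inner by blast
      then show ?thesis unfolding \<mu>_def g0_def by (subst (asm) integral_restrict_space) (auto simp: mult_ac)
    qed simp
    moreover have "(\<lambda>n. \<integral>x. indicator {P n<..<Q n} x * g0 x \<partial>lebesgue) \<longlonglongrightarrow> (\<integral>x. indicator {p<..<q} x * g0 x \<partial>lebesgue)"
    proof (rule integral_dominated_convergence[where w="\<lambda>t. norm (g0 t)"])
      have int: "integrable lebesgue (\<lambda>x. indicator {a<..<b} x * g0 x)" for a b :: real
        using integrable_mult_indicator[OF _ g0, of "{a<..<b}"] by simp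
      show "(\<lambda>x. indicator {p<..<q} x * g0 x) \<in> borel_measurable lebesgue"
        "(\<lambda>x. indicator {P n<..<Q n} x * g0 x) \<in> borel_measurable lebesgue" for n
        using int by auto
      have "AE t in lebesgue. t \<noteq> 0 \<and> t \<noteq> T"
        by (intro AE_completion AE_conjI AE_lborel_singleton)
      then show "AE t in lebesgue. (\<lambda>n. indicator {P n<..<Q n} t * g0 t) \<longlonglongrightarrow> indicator {p<..<q} t * g0 t"
      proof (rule eventually_mono)
        fix t assume t: "t \<noteq> 0 \<and> t \<noteq> T"
        have P: "P \<longlonglongrightarrow> max p 0 + 0" and Q: "Q \<longlonglongrightarrow> min q T - 0"
          unfolding P_def[abs_def] Q_def[abs_def]
          by (intro tendsto_intros lim_1_over_n[THEN LIMSEQ_Suc])+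
        show "(\<lambda>n. indicator {P n<..<Q n} t * g0 t) \<longlonglongrightarrow> indicator {p<..<q} t * g0 t"
        proof (cases "max p 0 < t \<and> t < min q T")
          case True
          have "eventually (\<lambda>n. P n < t) sequentially" "eventually (\<lambda>n. t < Q n) sequentially"
            using order_tendstoD(2)[OF P, of t] order_tendstoD(1)[OF Q, of t] True by auto
          then have "eventually (\<lambda>n. indicator {P n<..<Q n} t * g0 t = indicator {p<..<q} t * g0 t) sequentially"
            by eventually_elim (use True in auto)
          then show ?thesis by (rule tendsto_eventually)
        next
          case False
          have "0 < 1 / real (Suc n)" for n by simp
          then have "max p 0 < P n" "Q n < min q T" for n
            unfolding P_def Q_def by (metis less_add_same_cancel1, metis diff_less_eq less_add_same_cancel1)
          then have "\<not> (P n < t \<and> t < Q n)" for n using False by (meson less_trans)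
          then have "indicator {P n<..<Q n} t * g0 t = 0" for n by auto
          moreover have "indicator {p<..<q} t * g0 t = 0" using False t by (auto simp: g0_def)
          ultimately show ?thesis by (simp only: tendsto_const)
        qed
      qed
    qed (use g0 in \<open>auto simp: indicator_def\<close>)
    ultimately show "(\<integral>x. indicator {p<..<q} x * g0 x \<partial>lebesgue) = 0" by (simp add: LIMSEQ_const_iff)
  qed
  then show ?thesis
    unfolding \<mu>_def W_def[symmetric, unfolded \<mu>_def]
    by (subst AE_restrict_space_iff) (auto simp: g0_def g_def)
qed

lemma Ck_has_real_derivative:
  fixes f :: "real \<Rightarrow> real"
  assumes "Ck (Suc n) f"
  shows "(f has_real_derivative frechet_derivative f (at t) 1) (at t)" "deriv f t = frechet_derivative f (at t) 1"
proof -
  have D: "(f has_derivative frechet_derivative f (at t)) (at t)" by (rule Ck_Suc_has_derivative[OF assms])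
  have "v * frechet_derivative f (at t) 1 = frechet_derivative f (at t) v" for v
    using linear_eq_sum_Basis[OF has_derivative_linear[OF D], of v] by simp
  then show 1: "(f has_real_derivative frechet_derivative f (at t) 1) (at t)"
    by (rule has_derivative_imp_has_field_derivative[OF D])
  show "deriv f t = frechet_derivative f (at t) 1" by (rule DERIV_imp_deriv[OF 1])
qed

section \<open>Evolution of averages along a weak solution\<close>

lemma product_test_function:
  fixes \<theta> :: "real \<Rightarrow> real" and \<phi> :: "'a::euclidean_space \<Rightarrow> real"
  assumes \<theta>: "time_test T \<theta>" and \<phi>: "\<And>m. Ck m \<phi>" "\<And>x. norm x > R \<Longrightarrow> \<phi> x = 0"
  shows "(\<lambda>p. \<theta> (fst p) * \<phi> (snd p)) \<in> test_functions ({..<T} \<times> UNIV)"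
proof -
  obtain a c where ac: "c < T" "\<And>t. t < a \<or> t > c \<Longrightarrow> \<theta> t = 0"
    using \<theta> by (auto simp: time_test_def)
  have sub: "{p. \<theta> (fst p) * \<phi> (snd p) \<noteq> 0} \<subseteq> {a..c} \<times> cball 0 R"
    using ac(2) \<phi>(2) by (force simp: not_less[symmetric])
  have comp: "compact ({a..c} \<times> cball (0::'a) R)" by (intro compact_Times) auto
  have cl: "closure {p. \<theta> (fst p) * \<phi> (snd p) \<noteq> 0} \<subseteq> {a..c} \<times> cball 0 R"
    by (rule closure_minimal[OF sub compact_imp_closed[OF comp]])
  have "compact (closure {p. \<theta> (fst p) * \<phi> (snd p) \<noteq> 0})"
    using compact_Int_closed[OF comp closed_closure, of "{p. \<theta> (fst p) * \<phi> (snd p) \<noteq> 0}"] cl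
    by (simp add: Int_absorb1)
  moreover have "Ck n (\<lambda>p. \<theta> (fst p) * \<phi> (snd p))" for n
    using \<theta> \<phi> by (intro Ck_mult Ck_fst Ck_snd) (auto simp: time_test_def)
  ultimately show ?thesis using cl ac(1) by (fastforce simp: test_functions_def)
qed

lemma dt_product:
  assumes "time_test T \<theta>"
  shows "dt (\<lambda>p. \<theta> (fst p) * \<phi> (snd p)) t x = deriv \<theta> t * \<phi> x"
proof -
  have "Ck (Suc 0) \<theta>" using assms by (simp add: time_test_def)
  from Ck_has_real_derivative(1)[OF this, of t]
  have "((\<lambda>s. \<theta> s * \<phi> x) has_real_derivative deriv \<theta> t * \<phi> x) (at t)"
    unfolding Ck_has_real_derivative(2)[OF \<open>Ck (Suc 0) \<theta>\<close>] by (intro DERIV_cmult_right)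
  then show ?thesis by (simp add: dt_def DERIV_imp_deriv)
qed

lemma inner_grad_product:
  fixes \<phi> :: "real^'n \<Rightarrow> real"
  assumes "Ck (Suc 0) \<phi>"
  shows "v \<bullet> grad (\<lambda>p. \<theta> (fst p) * \<phi> (snd p)) t x = \<theta> t * frechet_derivative \<phi> (at x) v"
proof -
  note D = Ck_Suc_has_derivative[OF assms, of x]
  have fd: "frechet_derivative (\<lambda>y. \<theta> t * \<phi> y) (at x) = (\<lambda>v. \<theta> t * frechet_derivative \<phi> (at x) v)"
    using frechet_derivative_at[OF has_derivative_mult_right[OF D, of "\<theta> t"]] by simp
  have "v \<bullet> grad (\<lambda>p. \<theta> (fst p) * \<phi> (snd p)) t x = (\<Sum>l\<in>UNIV. v $ l * (\<theta> t * frechet_derivative \<phi> (at x) (axis l 1)))"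
    by (simp add: grad_def inner_vec_def fd)
  also have "\<dots> = \<theta> t * frechet_derivative \<phi> (at x) (\<Sum>l\<in>UNIV. v $ l *\<^sub>R axis l 1)"
    using has_derivative_linear[OF D]
    by (simp add: linear_sum linear_cmul sum_distrib_left mult_ac)
  also have "(\<Sum>l\<in>UNIV. v $ l *\<^sub>R axis l 1) = v"
    using basis_expansion[of v] by (simp add: scalar_mult_eq_scaleR)
  finally show ?thesis .
qed

section \<open>Constants of the problem, and averages along one solution\<close>

locale transport_data =
  fixes V :: "(real^'n) \<times> (real^'k) \<Rightarrow> (real^'n)^'k" and \<eta> :: "real^'n \<Rightarrow> (real^'k)^'k"
    and T M BV LV B\<eta> L\<eta> :: real
  assumes T: "T > 0" and M: "M \<ge> 0" and BV: "BV \<ge> 0" and LV: "LV \<ge> 0" and B\<eta>: "B\<eta> \<ge> 0" and L\<eta>: "L\<eta> \<ge> 0"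
    and V_le: "\<And>p. norm (V p) \<le> BV" and V_lip: "\<And>p q. norm (V p - V q) \<le> LV * norm (p - q)"
    and \<eta>_le: "\<And>x. norm (\<eta> x) \<le> B\<eta>" and \<eta>_lip: "\<And>x y. norm (\<eta> x - \<eta> y) \<le> L\<eta> * norm (x - y)"
begin

abbreviation "\<tau> \<equiv> lebesgue_on {0..T}"

sublocale \<tau>: finite_measure \<tau> by (rule finite_measure_lebesgue_on) simp

lemma velocity_le: "norm (velocity V \<eta> \<mu> i x) \<le> BV"
  unfolding velocity_def by (rule order_trans[OF Finite_Cartesian_Product.norm_nth_le V_le])

lemma continuous_on_V: "continuous_on UNIV V"
  by (rule continuous_on_of_norm_lipschitz[OF LV V_lip])

lemma continuous_on_\<eta>: "continuous_on UNIV \<eta>"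
  by (rule continuous_on_of_norm_lipschitz[OF L\<eta> \<eta>_lip])

lemma \<eta>_component: "\<bar>\<eta> x $ i $ j\<bar> \<le> B\<eta>" "\<bar>\<eta> x $ i $ j - \<eta> y $ i $ j\<bar> \<le> L\<eta> * norm (x - y)"
proof -
  have "norm (z $ i $ j) \<le> norm z" for z :: "(real^'k)^'k"
    by (rule order_trans[OF Finite_Cartesian_Product.norm_nth_le Finite_Cartesian_Product.norm_nth_le])
  from this[of "\<eta> x"] this[of "\<eta> x - \<eta> y"]
  have "\<bar>\<eta> x $ i $ j\<bar> \<le> norm (\<eta> x)" "\<bar>\<eta> x $ i $ j - \<eta> y $ i $ j\<bar> \<le> norm (\<eta> x - \<eta> y)" by simp_all
  then show "\<bar>\<eta> x $ i $ j\<bar> \<le> B\<eta>" "\<bar>\<eta> x $ i $ j - \<eta> y $ i $ j\<bar> \<le> L\<eta> * norm (x - y)"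
    using \<eta>_le[of x] \<eta>_lip[of x y] by linarith+
qed

end

locale solution = transport_data V \<eta> T M BV LV B\<eta> L\<eta>
  for V :: "(real^'n) \<times> (real^'k) \<Rightarrow> (real^'n)^'k" and \<eta> :: "real^'n \<Rightarrow> (real^'k)^'k"
    and T M BV LV B\<eta> L\<eta> :: real +
  fixes \<rho>0 :: "'k \<Rightarrow> (real^'n) measure" and \<rho> :: "real \<Rightarrow> 'k \<Rightarrow> (real^'n) measure"
  assumes \<rho>0: "\<And>i. \<rho>0 i \<in> Mplus" and weak: "weak_measure_solution T V \<eta> \<rho>0 \<rho>"
    and mass: "AE t in lebesgue_on {0..T}. \<forall>i. measure (\<rho> t i) UNIV \<le> M"
begin

lemma \<rho>_Mplus: "t \<in> {0..T} \<Longrightarrow> \<rho> t i \<in> Mplus"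
  using weak by (simp add: weak_measure_solution_def Linfty_Mplus_def)

lemma measurable_C0:
  "continuous_on UNIV f \<Longrightarrow> (f \<longlongrightarrow> 0) at_infinity \<Longrightarrow> (\<lambda>t. \<integral>x. f x \<partial>\<rho> t i) \<in> borel_measurable \<tau>"
  for f :: "real^'n \<Rightarrow> real"
  using weak by (simp add: weak_measure_solution_def Linfty_Mplus_def)

lemma measurable_integral:
  "(\<lambda>(t, x). g t x) \<in> borel_measurable (\<tau> \<Otimes>\<^sub>M borel) \<Longrightarrow> (\<lambda>t. \<integral>x. g t x \<partial>\<rho> t i) \<in> borel_measurable \<tau>"
  for g :: "real \<Rightarrow> real^'n \<Rightarrow> real"
  by (rule measurable_integral_kernel[where \<rho>="\<lambda>t. \<rho> t i"]) (auto intro: \<rho>_Mplus measurable_C0)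

lemma measurable_conv:
  "(\<lambda>p. conv (\<rho> (fst p) j) (\<lambda>z. \<eta> z $ i $ j) (snd p)) \<in> borel_measurable (\<tau> \<Otimes>\<^sub>M borel)"
  unfolding conv_def
\<comment> \<open>The parameter is the pair of time and space point, although the measure depends on
  time only, because the integrand contains the space point.\<close>
proof (rule measurable_integral_kernel[where M="\<tau> \<Otimes>\<^sub>M borel" and \<rho>="\<lambda>p. \<rho> (fst p) j" and g="\<lambda>p y. \<eta> (snd p - y) $ i $ j"])
  show "\<rho> (fst p) j \<in> Mplus" if "p \<in> space (\<tau> \<Otimes>\<^sub>M borel)" for p
    using that by (intro \<rho>_Mplus) (auto simp: space_pair_measure)
  show "(\<lambda>p. \<integral>x. f x \<partial>\<rho> (fst p) j) \<in> borel_measurable (\<tau> \<Otimes>\<^sub>M borel)"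
    if "continuous_on UNIV f" "(f \<longlongrightarrow> 0) at_infinity" for f :: "real^'n \<Rightarrow> real"
    by (rule measurable_compose[OF measurable_fst measurable_C0[OF that]])
  have "(\<lambda>z. \<eta> z $ i $ j) \<in> borel_measurable borel"
    by (intro borel_measurable_continuous_onI continuous_intros continuous_on_\<eta>)
  then have "(\<lambda>q. \<eta> (snd (fst q) - snd q) $ i $ j) \<in> borel_measurable ((\<tau> \<Otimes>\<^sub>M borel) \<Otimes>\<^sub>M borel)"
    by (rule measurable_compose[rotated]) measurable
  then show "(\<lambda>(p, y). \<eta> (snd p - y) $ i $ j) \<in> borel_measurable ((\<tau> \<Otimes>\<^sub>M borel) \<Otimes>\<^sub>M borel)"
    by (simp add: case_prod_beta')
qed

lemma measurable_velocity:
  "(\<lambda>p. velocity V \<eta> (\<rho> (fst p)) i (snd p)) \<in> borel_measurable (\<tau> \<Otimes>\<^sub>M borel)"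
proof -
  have "(\<lambda>p. \<chi> j. conv (\<rho> (fst p) j) (\<lambda>z. \<eta> z $ i $ j) (snd p)) \<in> borel_measurable (\<tau> \<Otimes>\<^sub>M borel)"
  proof (rule borel_measurable_euclidean_space[THEN iffD2], rule ballI)
    fix b :: "real^'k" assume "b \<in> Basis"
    then obtain j where b: "b = axis j 1" by (auto simp: Basis_vec_def)
    show "(\<lambda>p. (\<chi> j. conv (\<rho> (fst p) j) (\<lambda>z. \<eta> z $ i $ j) (snd p)) \<bullet> b) \<in> borel_measurable (\<tau> \<Otimes>\<^sub>M borel)"
      using measurable_conv by (simp add: b inner_axis)
  qed
  then have "(\<lambda>p. (snd p, \<chi> j. conv (\<rho> (fst p) j) (\<lambda>z. \<eta> z $ i $ j) (snd p))) \<in> borel_measurable (\<tau> \<Otimes>\<^sub>M borel)"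
    by (intro borel_measurable_Pair) measurable
  moreover have "(\<lambda>q. V q $ i) \<in> borel_measurable borel"
    by (intro borel_measurable_continuous_onI continuous_intros continuous_on_V)
  ultimately show ?thesis unfolding velocity_def by (rule measurable_compose)
qed

abbreviation vel :: "real \<Rightarrow> 'k \<Rightarrow> real^'n \<Rightarrow> real^'n" where
  "vel t i x \<equiv> velocity V \<eta> (\<rho> t) i x"

text \<open>For \<open>D\<close> the derivative of a test function this is, formally, the time
  derivative of its average.\<close>

definition flux :: "'k \<Rightarrow> (real^'n \<Rightarrow> real^'n \<Rightarrow> real) \<Rightarrow> real \<Rightarrow> real" where
  "flux i D t = (\<integral>x. D x (vel t i x) \<partial>\<rho> t i)"

text \<open>Common ground for derivatives of smooth functions, given as
  \<open>frechet_derivative\<close>, and for the bounded linear maps of \<open>C11\<close>.\<close>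

definition covector :: "real \<Rightarrow> (real^'n \<Rightarrow> real^'n \<Rightarrow> real) \<Rightarrow> bool" where
  "covector C D \<longleftrightarrow> (\<forall>x. linear (D x)) \<and> (\<forall>b. continuous_on UNIV (\<lambda>x. D x b)) \<and> (\<forall>x v. \<bar>D x v\<bar> \<le> C * norm v)"

lemma measurable_flux_integrand:
  assumes "covector C D"
  shows "(\<lambda>p. D (snd p) (velocity V \<eta> (\<rho> (fst p)) i (snd p))) \<in> borel_measurable (\<tau> \<Otimes>\<^sub>M borel)"
proof -
  have "(\<lambda>p. D (snd p) b) \<in> borel_measurable (\<tau> \<Otimes>\<^sub>M borel)" for b
    using assms borel_measurable_continuous_onI
    by (intro measurable_compose[OF measurable_snd]) (auto simp: covector_def)
  note [measurable] = this measurable_velocity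
  have "(\<lambda>p. \<Sum>b\<in>Basis. (velocity V \<eta> (\<rho> (fst p)) i (snd p) \<bullet> b) * D (snd p) b) \<in> borel_measurable (\<tau> \<Otimes>\<^sub>M borel)"
    by measurable
  also have "(\<lambda>p. \<Sum>b\<in>Basis. (velocity V \<eta> (\<rho> (fst p)) i (snd p) \<bullet> b) * D (snd p) b)
      = (\<lambda>p. D (snd p) (velocity V \<eta> (\<rho> (fst p)) i (snd p)))"
    using assms by (intro ext linear_eq_sum_Basis[symmetric]) (auto simp: covector_def)
  finally show ?thesis .
qed

lemma measurable_flux: "covector C D \<Longrightarrow> flux i D \<in> borel_measurable \<tau>"
  unfolding flux_def[abs_def]
  using measurable_flux_integrand by (intro measurable_integral) (simp add: case_prod_beta')

lemma covector_velocity_le: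
  assumes "covector C D"
  shows "\<bar>D x (velocity V \<eta> \<mu> i y)\<bar> \<le> C * BV"
proof -
  have C: "0 \<le> C" if "v \<noteq> 0" for v :: "real^'n"
    using assms that abs_ge_zero[of "D x v"] order_trans zero_le_mult_iff[of C "norm v"] unfolding covector_def
    by (metis norm_eq_zero norm_ge_zero order_antisym)
  have "\<bar>D x (velocity V \<eta> \<mu> i y)\<bar> \<le> C * norm (velocity V \<eta> \<mu> i y)"
    using assms by (simp add: covector_def)
  also have "\<dots> \<le> C * BV"
    using C[of "axis undefined 1"] velocity_le by (intro mult_left_mono) (auto simp: axis_eq_0_iff)
  finally show ?thesis .
qed

lemma flux_integrand:
  assumes "covector C D" "t \<in> {0..T}"
  shows "(\<lambda>x. D x (vel t i x)) \<in> borel_measurable borel"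
    "integrable (\<rho> t i) (\<lambda>x. D x (vel t i x))"
proof -
  show 1: "(\<lambda>x. D x (vel t i x)) \<in> borel_measurable borel"
    using measurable_compose[OF measurable_Pair1'[of t \<tau> borel] measurable_flux_integrand[OF assms(1), of i]] assms(2) by simp
  show "integrable (\<rho> t i) (\<lambda>x. D x (vel t i x))"
    using covector_velocity_le[OF assms(1)] by (intro Mplus_integrable[OF \<rho>_Mplus 1] assms) auto
qed

lemma flux_le:
  assumes "covector C D" "t \<in> {0..T}" "measure (\<rho> t i) UNIV \<le> M"
  shows "\<bar>flux i D t\<bar> \<le> C * BV * M"
proof -
  have "0 \<le> C * BV" using covector_velocity_le[OF assms(1)] abs_ge_zero order_trans by blast
  then show ?thesis
    unfolding flux_def real_norm_def[symmetric]
    using covector_velocity_le[OF assms(1)] assms by (intro Mplus_integral_le \<rho>_Mplus) auto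
qed

lemma AE_\<tau>I: "AE t in \<tau>. P t" if "AE t in \<tau>. \<forall>i. measure (\<rho> t i) UNIV \<le> M"
  "\<And>t. t \<in> {0..T} \<Longrightarrow> \<forall>i. measure (\<rho> t i) UNIV \<le> M \<Longrightarrow> P t"
proof -
  have "AE t in \<tau>. t \<in> space \<tau>" by (rule AE_space)
  then show ?thesis using that(1) by eventually_elim (use that(2) in simp)
qed

lemma integrable_flux: "covector C D \<Longrightarrow> integrable \<tau> (flux i D)"
  by (rule \<tau>.integrable_const_bound[where B="C * BV * M"])
    (auto intro!: AE_\<tau>I[OF mass] measurable_flux simp: flux_le)

lemma covector_C11: "C11 L K \<psi> \<psi>' \<Longrightarrow> covector L (\<lambda>x. blinfun_apply (\<psi>' x))"
  using C11_apply_le[of L K \<psi> \<psi>'] unfolding covector_def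
  by (auto intro!: continuous_intros C11_continuous_on_deriv bounded_linear.linear[OF blinfun.bounded_linear_right])

lemma measurable_average: "continuous_on UNIV f \<Longrightarrow> (\<lambda>t. \<integral>x. f x \<partial>\<rho> t i) \<in> borel_measurable \<tau>"
  for f :: "real^'n \<Rightarrow> real"
  by (intro measurable_integral)
    (auto simp: case_prod_beta' intro!: measurable_compose[OF measurable_snd] borel_measurable_continuous_onI)

lemma average_le:
  "t \<in> {0..T} \<Longrightarrow> measure (\<rho> t i) UNIV \<le> M \<Longrightarrow> (\<And>x. \<bar>f x\<bar> \<le> C) \<Longrightarrow> \<bar>\<integral>x. f x \<partial>\<rho> t i\<bar> \<le> C * M"
  using Mplus_integral_le[OF \<rho>_Mplus, of t f C i M] abs_ge_zero order_trans
  by (metis real_norm_def)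

lemma integrable_average: "continuous_on UNIV f \<Longrightarrow> (\<And>x. \<bar>f x\<bar> \<le> C) \<Longrightarrow> integrable \<tau> (\<lambda>t. \<integral>x. f x \<partial>\<rho> t i)"
  for f :: "real^'n \<Rightarrow> real"
  by (rule \<tau>.integrable_const_bound[where B="C * M"])
    (auto intro!: AE_\<tau>I[OF mass] measurable_average simp: average_le)

lemma weak_product:
  assumes \<theta>: "time_test T \<theta>" and \<phi>: "\<And>m. Ck m \<phi>" "\<And>x. norm x > R \<Longrightarrow> \<phi> x = 0"
  shows "(\<integral>t. deriv \<theta> t * (\<integral>x. \<phi> x \<partial>\<rho> t i) + \<theta> t * flux i (\<lambda>x. frechet_derivative \<phi> (at x)) t \<partial>\<tau>)
    + \<theta> 0 * (\<integral>x. \<phi> x \<partial>\<rho>0 i) = 0"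
    and "\<exists>C. covector C (\<lambda>x. frechet_derivative \<phi> (at x))"
proof -
  let ?D = "\<lambda>x. frechet_derivative \<phi> (at x)"
  obtain L K where C: "C11 L K \<phi> (\<lambda>x. Blinfun (?D x))"
    using C11_of_Ck_compact_support[of \<phi> R, OF \<phi>] by blast
  have cov: "covector L ?D"
    using covector_C11[OF C] by (simp add: blinfun_apply_Blinfun_frechet[OF \<phi>(1)[of "Suc 0"]])
  then show "\<exists>C. covector C ?D" by blast
  obtain B where B: "\<And>x. \<bar>\<phi> x\<bar> \<le> B" using C11_bounded[OF C] by auto
  have "(\<integral>x. dt (\<lambda>p. \<theta> (fst p) * \<phi> (snd p)) t x + vel t i x \<bullet> grad (\<lambda>p. \<theta> (fst p) * \<phi> (snd p)) t x \<partial>\<rho> t i)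
    = deriv \<theta> t * (\<integral>x. \<phi> x \<partial>\<rho> t i) + \<theta> t * flux i ?D t" if t: "t \<in> {0..T}" for t
  proof -
    have "integrable (\<rho> t i) \<phi>"
      using B by (intro Mplus_integrable[OF \<rho>_Mplus[OF t], where B=B] borel_measurable_continuous_onI Ck_imp_continuous_on[OF \<phi>(1)[of 0]]) auto
    then show ?thesis
      using flux_integrand(2)[OF cov t, of i]
      by (simp add: dt_product[OF \<theta>] inner_grad_product[OF \<phi>(1)] flux_def)
  qed
  then have "(\<integral>t. (\<integral>x. dt (\<lambda>p. \<theta> (fst p) * \<phi> (snd p)) t x + vel t i x \<bullet> grad (\<lambda>p. \<theta> (fst p) * \<phi> (snd p)) t x \<partial>\<rho> t i) \<partial>\<tau>)
    = (\<integral>t. deriv \<theta> t * (\<integral>x. \<phi> x \<partial>\<rho> t i) + \<theta> t * flux i ?D t \<partial>\<tau>)"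
    by (intro Bochner_Integration.integral_cong) auto
  moreover have "(\<integral>t. (\<integral>x. dt (\<lambda>p. \<theta> (fst p) * \<phi> (snd p)) t x + vel t i x \<bullet> grad (\<lambda>p. \<theta> (fst p) * \<phi> (snd p)) t x \<partial>\<rho> t i) \<partial>\<tau>)
    + (\<integral>x. \<theta> (fst (0, x)) * \<phi> (snd (0, x)) \<partial>\<rho>0 i) = 0"
  proof -
    have mem: "(\<lambda>p. \<theta> (fst p) * \<phi> (snd p)) \<in> test_functions ({..<T} \<times> UNIV)"
      by (rule product_test_function[OF \<theta> \<phi>])
    have "\<forall>\<Phi>\<in>test_functions ({..<T} \<times> UNIV).
        (\<integral>t. (\<integral>x. dt \<Phi> t x + vel t i x \<bullet> grad \<Phi> t x \<partial>\<rho> t i) \<partial>\<tau>) + (\<integral>x. \<Phi> (0, x) \<partial>\<rho>0 i) = 0"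
      using weak by (simp add: weak_measure_solution_def)
    from bspec[OF this mem] show ?thesis by simp
  qed
  ultimately show "(\<integral>t. deriv \<theta> t * (\<integral>x. \<phi> x \<partial>\<rho> t i) + \<theta> t * flux i ?D t \<partial>\<tau>) + \<theta> 0 * (\<integral>x. \<phi> x \<partial>\<rho>0 i) = 0"
    by simp
qed

text \<open>Mollified kernels need not have compact support, so the equation is wanted for all of
  \<open>C11\<close>. Dominated convergence along \<open>test_function_approx\<close> works because
  velocity and mass are bounded.\<close>

lemma weak_C11:
  assumes \<theta>: "time_test T \<theta>" and \<psi>: "C11 L K \<psi> \<psi>'"
  shows "(\<integral>t. deriv \<theta> t * (\<integral>x. \<psi> x \<partial>\<rho> t i) + \<theta> t * flux i (\<lambda>x. blinfun_apply (\<psi>' x)) t \<partial>\<tau>)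
    + \<theta> 0 * (\<integral>x. \<psi> x \<partial>\<rho>0 i) = 0"
proof -
  obtain \<phi> C where \<phi>: "\<And>n m. Ck m (\<phi> n)" "\<And>n. \<exists>R. \<forall>x. norm x > R \<longrightarrow> \<phi> n x = 0"
    "\<And>n x. \<bar>\<phi> n x\<bar> \<le> C" "\<And>n x v. \<bar>frechet_derivative (\<phi> n) (at x) v\<bar> \<le> C * norm v"
    "\<And>x. (\<lambda>n. \<phi> n x) \<longlonglongrightarrow> \<psi> x"
    "\<And>x v. (\<lambda>n. frechet_derivative (\<phi> n) (at x) v) \<longlonglongrightarrow> blinfun_apply (\<psi>' x) v"
    by (rule test_function_approx[OF \<psi>]) blast
  have C: "0 \<le> C" using \<phi>(3) abs_ge_zero order_trans by blast
  let ?D = "\<lambda>n x. frechet_derivative (\<phi> n) (at x)"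
  define F where "F n t = deriv \<theta> t * (\<integral>x. \<phi> n x \<partial>\<rho> t i) + \<theta> t * flux i (?D n) t" for n t
  have eq: "(\<integral>t. F n t \<partial>\<tau>) + \<theta> 0 * (\<integral>x. \<phi> n x \<partial>\<rho>0 i) = 0" for n
    using \<phi>(2)[of n] weak_product(1)[OF \<theta> \<phi>(1)[of _ n]] unfolding F_def by blast
  \<comment> \<open>\<open>weak_product\<close> supplies linearity and continuity, with a constant
    depending on \<open>n\<close>; the uniform bound \<open>C\<close> replaces that
    constant.\<close>
  have cov: "covector C (?D n)" for n
  proof -
    have "\<exists>C. covector C (?D n)" using \<phi>(2)[of n] weak_product(2)[OF \<theta> \<phi>(1)[of _ n]] by blast
    then show ?thesis using \<phi>(4) by (auto simp: covector_def)
  qed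
  have m\<phi>: "\<phi> n \<in> borel_measurable borel" for n
    by (intro borel_measurable_continuous_onI Ck_imp_continuous_on[OF \<phi>(1)[of 0]])
  have m\<psi>: "\<psi> \<in> borel_measurable borel"
    by (intro borel_measurable_continuous_onI C11_continuous_on[OF \<psi>])
  have av: "(\<lambda>n. \<integral>x. \<phi> n x \<partial>\<mu>) \<longlonglongrightarrow> (\<integral>x. \<psi> x \<partial>\<mu>)" if \<mu>: "\<mu> \<in> Mplus" for \<mu>
  proof -
    interpret finite_measure \<mu> using Mplus_D[OF \<mu>] by simp
    show ?thesis
      by (rule integral_dominated_convergence[where w="\<lambda>_. C"])
        (use \<phi> Mplus_D(4)[OF \<mu> m\<phi>] Mplus_D(4)[OF \<mu> m\<psi>] in auto)
  qed
  have fl: "(\<lambda>n. flux i (?D n) t) \<longlonglongrightarrow> flux i (\<lambda>x. blinfun_apply (\<psi>' x)) t" if t: "t \<in> {0..T}" for t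
    unfolding flux_def
  proof -
    note \<mu> = \<rho>_Mplus[OF t, of i]
    interpret finite_measure "\<rho> t i" using Mplus_D[OF \<mu>] by simp
    show "(\<lambda>n. \<integral>x. ?D n x (vel t i x) \<partial>\<rho> t i)
        \<longlonglongrightarrow> (\<integral>x. blinfun_apply (\<psi>' x) (vel t i x) \<partial>\<rho> t i)"
    proof (rule integral_dominated_convergence[where w="\<lambda>_. C * BV"])
      show "AE x in \<rho> t i. norm (?D n x (vel t i x)) \<le> C * BV" for n
        using covector_velocity_le[OF cov] by simp
      show "AE x in \<rho> t i. (\<lambda>n. ?D n x (vel t i x)) \<longlonglongrightarrow> blinfun_apply (\<psi>' x) (vel t i x)"
        using \<phi>(6) by simp
    qed (use flux_integrand(2)[OF cov t] flux_integrand(2)[OF covector_C11[OF \<psi>] t] in auto)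
  qed
  have \<theta>C: "Ck n \<theta>" for n using \<theta> by (simp add: time_test_def)
  have \<theta>m: "\<theta> \<in> borel_measurable \<tau>" "deriv \<theta> \<in> borel_measurable \<tau>"
  proof -
    have "deriv \<theta> = (\<lambda>t. frechet_derivative \<theta> (at t) 1)"
      using Ck_has_real_derivative(2)[OF \<theta>C] by blast
    moreover have "Ck 0 (\<lambda>t. frechet_derivative \<theta> (at t) 1)"
      using \<theta>C[of "Suc 0"] by simp
    ultimately have "continuous_on S (deriv \<theta>)" for S using Ck_imp_continuous_on[of 0 "deriv \<theta>" S] by simp
    then show "\<theta> \<in> borel_measurable \<tau>" "deriv \<theta> \<in> borel_measurable \<tau>"
      using Ck_imp_continuous_on[OF \<theta>C[of 0]]
      by (auto intro!: continuous_imp_measurable_on_sets_lebesgue)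
  qed
  obtain B where B: "B \<ge> 0" "\<And>t. \<bar>\<theta> t\<bar> \<le> B" "\<And>t. \<bar>deriv \<theta> t\<bar> \<le> B"
  proof -
    obtain a c where ac: "\<And>t. t < a \<or> t > c \<Longrightarrow> \<theta> t = 0" using \<theta> by (auto simp: time_test_def)
    have supp: "\<theta> t = 0" if "norm t > max \<bar>a\<bar> \<bar>c\<bar>" for t using that by (intro ac) auto
    obtain B1 where B1: "B1 \<ge> 0" "\<And>t. \<bar>\<theta> t\<bar> \<le> B1"
      using bounded_of_compact_support[of \<theta> "max \<bar>a\<bar> \<bar>c\<bar>", OF Ck_imp_continuous_on[OF \<theta>C[of 0]] supp] by auto
    obtain B2 where B2: "B2 \<ge> 0" "\<And>t v. \<bar>frechet_derivative \<theta> (at t) v\<bar> \<le> B2 * norm v"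
      using lipschitz_of_Ck_compact_support[of \<theta> "max \<bar>a\<bar> \<bar>c\<bar>", OF \<theta>C supp] by auto
    have "\<bar>deriv \<theta> t\<bar> \<le> B2" for t
      using B2(2)[of t 1] Ck_has_real_derivative(2)[OF \<theta>C] by simp
    then show ?thesis using B1 B2(1) that[of "B1 + B2"] by (meson add_increasing add_increasing2 add_nonneg_nonneg)
  qed
  have "(\<lambda>n. \<integral>t. F n t \<partial>\<tau>) \<longlonglongrightarrow> (\<integral>t. deriv \<theta> t * (\<integral>x. \<psi> x \<partial>\<rho> t i) + \<theta> t * flux i (\<lambda>x. blinfun_apply (\<psi>' x)) t \<partial>\<tau>)"
  proof (rule integral_dominated_convergence[where w="\<lambda>_. B * (C * M) + B * (C * BV * M)"])
    show "(\<lambda>t. deriv \<theta> t * (\<integral>x. \<psi> x \<partial>\<rho> t i) + \<theta> t * flux i (\<lambda>x. blinfun_apply (\<psi>' x)) t) \<in> borel_measurable \<tau>"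
      by (intro borel_measurable_add borel_measurable_times \<theta>m measurable_average C11_continuous_on[OF \<psi>]
          measurable_flux[OF covector_C11[OF \<psi>]])
    show "F n \<in> borel_measurable \<tau>" for n
      unfolding F_def[abs_def]
      by (intro borel_measurable_add borel_measurable_times \<theta>m measurable_average Ck_imp_continuous_on[OF \<phi>(1)[of 0]]
          measurable_flux[OF cov])
    show "AE t in \<tau>. norm (F n t) \<le> B * (C * M) + B * (C * BV * M)" for n
    proof (rule AE_\<tau>I[OF mass])
      fix t assume t: "t \<in> {0..T}" and m: "\<forall>i. measure (\<rho> t i) UNIV \<le> M"
      have "\<bar>deriv \<theta> t * (\<integral>x. \<phi> n x \<partial>\<rho> t i)\<bar> \<le> B * (C * M)"
        unfolding abs_mult using B C M m t \<phi>(3) by (intro mult_mono average_le) auto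
      moreover have "\<bar>\<theta> t * flux i (?D n) t\<bar> \<le> B * (C * BV * M)"
        unfolding abs_mult using B C M m t by (intro mult_mono flux_le[OF cov]) auto
      ultimately show "norm (F n t) \<le> B * (C * M) + B * (C * BV * M)"
        unfolding F_def by simp
    qed
    show "AE t in \<tau>. (\<lambda>n. F n t) \<longlonglongrightarrow> deriv \<theta> t * (\<integral>x. \<psi> x \<partial>\<rho> t i) + \<theta> t * flux i (\<lambda>x. blinfun_apply (\<psi>' x)) t"
      unfolding F_def using av[OF \<rho>_Mplus] fl by (intro AE_I2 tendsto_intros) auto
  qed simp
  from tendsto_add[OF this tendsto_mult[OF tendsto_const av[OF \<rho>0]], of "\<theta> 0" i] show ?thesis
    unfolding eq by (simp add: LIMSEQ_const_iff)
qed

text \<open>The Lipschitz representative of \<open>t \<mapsto> \<integral>\<psi> d\<rho>\<^sub>t\<close>. It is defined at every time, so that no common null set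
  for all test functions has to be chosen.\<close>

definition evol :: "'k \<Rightarrow> (real^'n \<Rightarrow> real) \<Rightarrow> (real^'n \<Rightarrow> (real^'n) \<Rightarrow>\<^sub>L real) \<Rightarrow> real \<Rightarrow> real" where
  "evol i \<psi> \<psi>' t = (\<integral>x. \<psi> x \<partial>\<rho>0 i) + (\<integral>s. indicator {..t} s * flux i (\<lambda>x. blinfun_apply (\<psi>' x)) s \<partial>\<tau>)"

text \<open>The averages play the role of \<open>m\<close> and the fluxes that of \<open>w\<close>
  in \<open>du_Bois_Reymond\<close>. The exceptional null set depends on \<open>\<psi>\<close>, so
  averages are later compared for countably many functions at a time only.\<close>

lemma AE_average_eq_evol:
  assumes "C11 L K \<psi> \<psi>'"
  shows "AE t in \<tau>. (\<integral>x. \<psi> x \<partial>\<rho> t i) = evol i \<psi> \<psi>' t"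
  unfolding evol_def
proof (rule du_Bois_Reymond[OF refl _ _ _ T])
  obtain B where "\<And>x. \<bar>\<psi> x\<bar> \<le> B" using C11_bounded[OF assms] by auto
  then show "integrable \<tau> (\<lambda>t. \<integral>x. \<psi> x \<partial>\<rho> t i)"
    by (intro integrable_average C11_continuous_on[OF assms])
  show "integrable \<tau> (flux i (\<lambda>x. blinfun_apply (\<psi>' x)))"
    by (rule integrable_flux[OF covector_C11[OF assms]])
qed (rule weak_C11[OF _ assms])

lemma evol_0: "evol i \<psi> \<psi>' 0 = (\<integral>x. \<psi> x \<partial>\<rho>0 i)"
proof -
  have "AE s in lebesgue. s \<noteq> (0::real)" by (intro AE_completion AE_lborel_singleton)
  then have "AE s in \<tau>. s \<noteq> 0" by (subst AE_restrict_space_iff) auto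
  moreover have "AE s in \<tau>. s \<in> space \<tau>" by (rule AE_space)
  ultimately have "AE s in \<tau>. indicator {..0} s * flux i (\<lambda>x. blinfun_apply (\<psi>' x)) s = 0"
    by eventually_elim auto
  then have "(\<integral>s. indicator {..0} s * flux i (\<lambda>x. blinfun_apply (\<psi>' x)) s \<partial>\<tau>) = 0"
    by (rule integral_eq_zero_AE)
  then show ?thesis by (simp add: evol_def)
qed

lemma integrable_flux_upto:
  assumes "covector C D"
  shows "integrable \<tau> (\<lambda>s. indicator {..t} s * flux i D s)"
proof (rule Bochner_Integration.integrable_bound[OF integrable_flux[OF assms, of i]])
  have "indicator {..t} \<in> borel_measurable \<tau>"
    by (intro measurable_restrict_space1 measurable_completion) auto
  then show "(\<lambda>s. indicator {..t} s * flux i D s) \<in> borel_measurable \<tau>"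
    using measurable_flux[OF assms, of i] by (intro borel_measurable_times)
qed (auto simp: indicator_def)

lemma evol_diff:
  assumes "C11 L K \<psi> \<psi>'" "a \<le> b"
  shows "evol i \<psi> \<psi>' b - evol i \<psi> \<psi>' a = (\<integral>s. indicator {a<..b} s * flux i (\<lambda>x. blinfun_apply (\<psi>' x)) s \<partial>\<tau>)"
proof -
  have "evol i \<psi> \<psi>' b - evol i \<psi> \<psi>' a
    = (\<integral>s. indicator {..b} s * flux i (\<lambda>x. blinfun_apply (\<psi>' x)) s - indicator {..a} s * flux i (\<lambda>x. blinfun_apply (\<psi>' x)) s \<partial>\<tau>)"
    using integrable_flux_upto[OF covector_C11[OF assms(1)]] by (simp add: evol_def)
  also have "\<dots> = (\<integral>s. indicator {a<..b} s * flux i (\<lambda>x. blinfun_apply (\<psi>' x)) s \<partial>\<tau>)"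
    using assms(2) by (intro Bochner_Integration.integral_cong) (auto simp: indicator_def)
  finally show ?thesis .
qed

end

section \<open>Euler steps\<close>

text \<open>\<open>L\<close> is a separate hypothesis because the difference between a pulled-back
  function and the function itself has a derivative of order h, far below the sum of the two
  constants.\<close>

lemma C11_diff:
  assumes f: "C11 L1 K1 f f'" and g: "C11 L2 K2 g g'" and L: "\<And>x. norm (f' x - g' x) \<le> L"
  shows "C11 L (K1 + K2) (\<lambda>x. f x - g x) (\<lambda>x. f' x - g' x)"
  unfolding C11_def
proof (intro conjI allI)
  obtain B1 B2 where B: "\<And>x. norm (f x) \<le> B1" "\<And>x. norm (g x) \<le> B2"
    using C11_bounded[OF f] C11_bounded[OF g] by blast
  have "norm (f x - g x) \<le> B1 + B2" for x
    using B[of x] norm_triangle_ineq4[of "f x" "g x"] by linarith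
  then show "bounded (range (\<lambda>x. f x - g x))" by (auto simp: bounded_iff)
  have "blinfun_apply (f' x - g' x) = (\<lambda>v. blinfun_apply (f' x) v - blinfun_apply (g' x) v)" for x
    by (simp add: fun_eq_iff blinfun.diff_left)
  then show "((\<lambda>x. f x - g x) has_derivative blinfun_apply (f' x - g' x)) (at x)" for x
    using has_derivative_diff[OF C11_has_derivative[OF f, of x UNIV] C11_has_derivative[OF g, of x UNIV]] by simp
  show "norm (f' x - g' x - (f' y - g' y)) \<le> (K1 + K2) * norm (x - y)" for x y
  proof -
    have "f' x - g' x - (f' y - g' y) = (f' x - f' y) - (g' x - g' y)" by simp
    then have "norm (f' x - g' x - (f' y - g' y)) \<le> norm (f' x - f' y) + norm (g' x - g' y)"
      using norm_triangle_ineq4 by metis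
    then show ?thesis
      using C11_diff_le[OF f, of x y] C11_diff_le[OF g, of x y] by (simp add: distrib_right)
  qed
qed (rule L)

text \<open>A convolution with \<open>g\<close> at \<open>x\<close> is the average of this reflected
  function, so it evolves like any other average.\<close>

lemma C11_reflect:
  assumes "C11 L K g g'"
  shows "C11 L K (\<lambda>y. g (x - y)) (\<lambda>y. - g' (x - y))"
  unfolding C11_def
proof (intro conjI allI)
  show "bounded (range (\<lambda>y. g (x - y)))"
    using C11_bounded[OF assms] by (auto simp: bounded_iff)
  show "((\<lambda>y. g (x - y)) has_derivative blinfun_apply (- g' (x - y))) (at y)" for y
  proof -
    have "((\<lambda>y. x - y) has_derivative (\<lambda>v. - v)) (at y)" by (auto intro!: derivative_eq_intros)
    from has_derivative_compose[OF this C11_has_derivative[OF assms, of _ UNIV]]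
    moreover have "blinfun_apply (- g' (x - y)) = (\<lambda>v. blinfun_apply (g' (x - y)) (- v))"
      by (simp add: fun_eq_iff blinfun.minus_left blinfun.minus_right)
    ultimately show ?thesis by simp
  qed
  show "norm (- g' (x - y)) \<le> L" for y using C11_norm_le[OF assms] by simp
  show "norm (- g' (x - y) - - g' (x - z)) \<le> K * norm (y - z)" for y z
    using C11_diff_le[OF assms, of "x - z" "x - y"] by (simp add: norm_minus_commute)
qed

text \<open>One explicit Euler step \<open>x \<mapsto> x + h g(x)\<close>, pulled back to test functions.\<close>

definition pull' :: "real \<Rightarrow> ('a::euclidean_space \<Rightarrow> 'a) \<Rightarrow> ('a \<Rightarrow> 'a \<Rightarrow>\<^sub>L 'a) \<Rightarrow> ('a \<Rightarrow> 'a \<Rightarrow>\<^sub>L real) \<Rightarrow> 'a \<Rightarrow> 'a \<Rightarrow>\<^sub>L real" where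
  "pull' h g g' \<phi>' x = \<phi>' (x + h *\<^sub>R g x) o\<^sub>L (id_blinfun + h *\<^sub>R g' x)"

text \<open>Chain rule, with \<open>1 + h * Lg\<close> bounding the derivative of the step. Only the
  term \<open>h * L * Kg\<close> involves the second-order constant of the field.\<close>

lemma C11_pull:
  fixes \<phi> :: "'a::euclidean_space \<Rightarrow> real"
  assumes \<phi>: "C11 L K \<phi> \<phi>'" and g: "C11 Lg Kg g g'" and h: "0 \<le> h"
  shows "C11 (L * (1 + h * Lg)) (K * (1 + h * Lg)\<^sup>2 + h * L * Kg) (\<lambda>x. \<phi> (x + h *\<^sub>R g x)) (pull' h g g' \<phi>')"
  unfolding C11_def
proof (intro conjI allI)
  note nn = C11_nonneg[OF \<phi>] C11_nonneg[OF g] h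
  define A where "A x = id_blinfun + h *\<^sub>R g' x" for x
  have A_le: "norm (A x) \<le> 1 + h * Lg" for x
  proof -
    have "norm (A x) \<le> norm (id_blinfun :: 'a \<Rightarrow>\<^sub>L 'a) + norm (h *\<^sub>R g' x)"
      unfolding A_def by (rule norm_triangle_ineq)
    also have "\<dots> \<le> 1 + h * Lg"
      using C11_norm_le[OF g, of x] h norm_blinfun_id_le by (intro add_mono) (auto intro: mult_left_mono)
    finally show ?thesis .
  qed
  show "bounded (range (\<lambda>x. \<phi> (x + h *\<^sub>R g x)))"
    using C11_bounded[OF \<phi>] by (auto simp: bounded_iff)
  show "((\<lambda>x. \<phi> (x + h *\<^sub>R g x)) has_derivative blinfun_apply (pull' h g g' \<phi>' x)) (at x)" for x
  proof -
    have "((\<lambda>x. x + h *\<^sub>R g x) has_derivative (\<lambda>v. v + h *\<^sub>R blinfun_apply (g' x) v)) (at x)"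
      by (auto intro!: derivative_eq_intros C11_has_derivative[OF g])
    from has_derivative_compose[OF this C11_has_derivative[OF \<phi>, of _ UNIV]]
    moreover have "blinfun_apply (pull' h g g' \<phi>' x) = (\<lambda>v. blinfun_apply (\<phi>' (x + h *\<^sub>R g x)) (v + h *\<^sub>R blinfun_apply (g' x) v))"
      by (simp add: fun_eq_iff pull'_def blinfun.add_left blinfun.scaleR_left)
    ultimately show ?thesis by simp
  qed
  show "norm (pull' h g g' \<phi>' x) \<le> L * (1 + h * Lg)" for x
    unfolding pull'_def A_def[symmetric]
    by (rule order_trans[OF norm_blinfun_compose])
      (use C11_norm_le[OF \<phi>] A_le nn in \<open>auto intro!: mult_mono\<close>)
  show "norm (pull' h g g' \<phi>' x - pull' h g g' \<phi>' y) \<le> (K * (1 + h * Lg)\<^sup>2 + h * L * Kg) * norm (x - y)" for x y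
  proof -
    define X Y where "X = x + h *\<^sub>R g x" and "Y = y + h *\<^sub>R g y"
    have XY: "norm (X - Y) \<le> (1 + h * Lg) * norm (x - y)"
    proof -
      have "X - Y = (x - y) + h *\<^sub>R (g x - g y)" by (simp add: X_def Y_def algebra_simps)
      then have "norm (X - Y) \<le> norm (x - y) + h * norm (g x - g y)"
        using norm_triangle_ineq[of "x - y" "h *\<^sub>R (g x - g y)"] h by simp
      also have "\<dots> \<le> norm (x - y) + h * (Lg * norm (x - y))"
        using C11_lipschitz[OF g, of x y] h by (intro add_mono mult_left_mono) auto
      finally show ?thesis by (simp add: algebra_simps)
    qed
    have "pull' h g g' \<phi>' x - pull' h g g' \<phi>' y
        = ((\<phi>' X - \<phi>' Y) o\<^sub>L A x) + (\<phi>' Y o\<^sub>L (h *\<^sub>R (g' x - g' y)))"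
      unfolding pull'_def X_def[symmetric] Y_def[symmetric] A_def
      by (rule blinfun_eqI) (simp add: blinfun.bilinear_simps algebra_simps)
    also have "norm \<dots> \<le> norm (\<phi>' X - \<phi>' Y) * norm (A x) + norm (\<phi>' Y) * norm (h *\<^sub>R (g' x - g' y))"
      by (intro order_trans[OF norm_triangle_ineq] add_mono norm_blinfun_compose)
    also have "\<dots> \<le> (K * ((1 + h * Lg) * norm (x - y))) * (1 + h * Lg) + L * (h * (Kg * norm (x - y)))"
    proof (intro add_mono mult_mono)
      show "norm (\<phi>' X - \<phi>' Y) \<le> K * ((1 + h * Lg) * norm (x - y))"
        using C11_diff_le[OF \<phi>, of X Y] mult_left_mono[OF XY nn(2)] by linarith
      show "norm (h *\<^sub>R (g' x - g' y)) \<le> h * (Kg * norm (x - y))"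
        using C11_diff_le[OF g, of x y] h by (auto intro: mult_left_mono)
    qed (use nn A_le C11_norm_le[OF \<phi>] in auto)
    finally show ?thesis by (simp add: power2_eq_square algebra_simps)
  qed
qed

text \<open>The step moves a point by at most \<open>h * B\<close>, and its derivative differs from
  the identity by at most \<open>h * Lg\<close>.\<close>

lemma pull'_diff_le:
  fixes \<phi> :: "'a::euclidean_space \<Rightarrow> real"
  assumes \<phi>: "C11 L K \<phi> \<phi>'" and g: "C11 Lg Kg g g'" and h: "0 \<le> h" and B: "\<And>x. norm (g x) \<le> B"
  shows "norm (pull' h g g' \<phi>' x - \<phi>' x) \<le> h * (K * B + L * Lg)"
proof -
  note nn = C11_nonneg[OF \<phi>] C11_nonneg[OF g] h
  define X where "X = x + h *\<^sub>R g x"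
  have "pull' h g g' \<phi>' x - \<phi>' x = (\<phi>' X - \<phi>' x) + (\<phi>' X o\<^sub>L (h *\<^sub>R g' x))"
    unfolding pull'_def X_def[symmetric]
    by (rule blinfun_eqI) (simp add: blinfun.bilinear_simps algebra_simps)
  also have "norm \<dots> \<le> norm (\<phi>' X - \<phi>' x) + norm (\<phi>' X) * norm (h *\<^sub>R g' x)"
    by (intro order_trans[OF norm_triangle_ineq] add_mono norm_blinfun_compose order_refl)
  also have "\<dots> \<le> K * (h * B) + L * (h * Lg)"
  proof (intro add_mono mult_mono)
    have "norm (X - x) \<le> h * B" using B[of x] h by (simp add: X_def mult_left_mono)
    then show "norm (\<phi>' X - \<phi>' x) \<le> K * (h * B)"
      using C11_diff_le[OF \<phi>, of X x] mult_left_mono[of "norm (X - x)" "h * B" K] nn by linarith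
    show "norm (h *\<^sub>R g' x) \<le> h * Lg" using C11_norm_le[OF g, of x] h by (auto intro: mult_left_mono)
  qed (use nn C11_norm_le[OF \<phi>] in auto)
  finally show ?thesis by (simp add: algebra_simps)
qed

text \<open>Turns estimates that hold, outside one null set of times, at countably many points into
  estimates at all points.\<close>

lemma le_on_dense:
  fixes h :: "'a::topological_space \<Rightarrow> real"
  assumes "continuous_on UNIV h" and D: "\<And>X. open X \<Longrightarrow> X \<noteq> {} \<Longrightarrow> \<exists>d\<in>D. d \<in> X" and "\<And>d. d \<in> D \<Longrightarrow> h d \<le> c"
  shows "h x \<le> c"
proof (rule ccontr)
  assume "\<not> h x \<le> c"
  then have "{x. c < h x} \<noteq> {}" by (auto simp: not_le)
  moreover have "open {x. c < h x}" by (intro open_Collect_less continuous_intros assms)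
  ultimately obtain d where "d \<in> D" "d \<in> {x. c < h x}" using D by meson
  then show False using assms(3)[of d] by simp
qed

section \<open>Lipschitz and stability bounds for the velocity\<close>

context transport_data
begin

lemma interval_integral_le:
  assumes "AE s in \<tau>. s \<in> {a<..b} \<longrightarrow> \<bar>f s\<bar> \<le> B" "0 \<le> a" "a \<le> b" "b \<le> T" "0 \<le> B"
  shows "\<bar>\<integral>s. indicator {a<..b} s * f s \<partial>\<tau>\<bar> \<le> (b - a) * B"
proof -
  have sets: "{a<..b} \<in> sets \<tau>" using assms by (subst sets_restrict_space_iff) auto
  have "norm (\<integral>s. indicator {a<..b} s * f s \<partial>\<tau>) \<le> (\<integral>s. indicator {a<..b} s * B \<partial>\<tau>)"
  proof (rule norm_integral_le_AE)
    show "integrable \<tau> (\<lambda>s. indicator {a<..b} s * B)"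
      by (intro integrable_mult_left integrable_real_indicator sets) (simp add: less_top[symmetric])
    show "AE s in \<tau>. norm (indicator {a<..b} s * f s) \<le> indicator {a<..b} s * B"
      using assms(1) by eventually_elim (auto simp: indicator_def)
  qed
  also have "\<dots> = measure \<tau> {a<..b} * B"
  proof -
    have "{a<..b} \<inter> {0..T} = {a<..b}" using assms by auto
    then show ?thesis using sets by simp
  qed
  also have "measure \<tau> {a<..b} = b - a"
    using assms by (subst measure_restrict_space) auto
  finally show ?thesis by simp
qed

lemma conv_lipschitz:
  assumes \<mu>: "\<mu> \<in> Mplus" "measure \<mu> UNIV \<le> M" and g: "\<And>x y. \<bar>g x - g y\<bar> \<le> L * norm (x - y)" "\<And>x. \<bar>g x\<bar> \<le> B" and L: "0 \<le> L"
  shows "\<bar>conv \<mu> g x - conv \<mu> g y\<bar> \<le> L * M * norm (x - y)"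
proof -
  have cont: "continuous_on UNIV g"
    using g L by (intro continuous_on_of_norm_lipschitz[of L]) auto
  have int: "integrable \<mu> (\<lambda>z. g (x - z))" for x
    using g by (intro Mplus_integrable[OF \<mu>(1), where B=B] borel_measurable_continuous_onI continuous_on_reflect cont) auto
  have "conv \<mu> g x - conv \<mu> g y = (\<integral>z. g (x - z) - g (y - z) \<partial>\<mu>)"
    unfolding conv_def using int by simp
  also have "\<bar>\<dots>\<bar> \<le> (L * norm (x - y)) * M"
    unfolding real_norm_def[symmetric]
  proof (intro Mplus_integral_le \<mu>)
    show "norm (g (x - z) - g (y - z)) \<le> L * norm (x - y)" for z
      using g(1)[of "x - z" "y - z"] by simp
  qed (use L in auto)
  finally show ?thesis by (simp add: mult_ac)
qed

text \<open>The known bound concerns a \<open>C11\<close> kernel \<open>g\<close> on a dense set.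
  Continuity extends it to all points, and replacing \<open>g\<close> by \<open>f\<close> costs
  \<open>\<delta> * M\<close> for each of the two measures.\<close>

lemma conv_close:
  assumes \<mu>: "\<mu> \<in> Mplus" "measure \<mu> UNIV \<le> M" and \<nu>: "\<nu> \<in> Mplus" "measure \<nu> UNIV \<le> M"
    and g: "\<And>x y. \<bar>g x - g y\<bar> \<le> L * norm (x - y)" "\<And>x. \<bar>g x\<bar> \<le> B" and L: "0 \<le> L"
    and f: "continuous_on UNIV f" "\<And>x. \<bar>f x\<bar> \<le> B" and fg: "\<And>x. \<bar>g x - f x\<bar> \<le> \<delta>"
    and D: "\<And>X. open X \<Longrightarrow> X \<noteq> {} \<Longrightarrow> \<exists>d\<in>D. d \<in> X"
    and c: "\<And>x. x \<in> D \<Longrightarrow> \<bar>conv \<mu> g x - conv \<nu> g x\<bar> \<le> c"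
  shows "\<bar>conv \<mu> f x - conv \<nu> f x\<bar> \<le> c + 2 * M * \<delta>"
proof -
  have \<delta>: "0 \<le> \<delta>" using fg abs_ge_zero order_trans by blast
  have lip: "continuous_on UNIV (conv \<mu> g)" if "\<mu> \<in> Mplus" "measure \<mu> UNIV \<le> M" for \<mu>
    using conv_lipschitz[OF that g L] L M
    by (intro continuous_on_of_norm_lipschitz[of "L * M"]) auto
  have "\<bar>conv \<mu> g x - conv \<nu> g x\<bar> \<le> c"
    by (rule le_on_dense[OF _ D c]) (auto intro!: continuous_intros lip \<mu> \<nu>)
  moreover have "\<bar>conv \<mu> f x - conv \<mu> g x\<bar> \<le> \<delta> * M" if \<mu>: "\<mu> \<in> Mplus" "measure \<mu> UNIV \<le> M" for \<mu>
  proof -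
    have cont: "continuous_on UNIV g"
      using g L by (intro continuous_on_of_norm_lipschitz[of L]) auto
    have int: "integrable \<mu> (\<lambda>z. g (x - z))" "integrable \<mu> (\<lambda>z. f (x - z))"
      using g f by (auto intro!: Mplus_integrable[OF \<mu>(1), where B=B] borel_measurable_continuous_onI continuous_on_reflect cont)
    have "conv \<mu> f x - conv \<mu> g x = (\<integral>z. f (x - z) - g (x - z) \<partial>\<mu>)"
      unfolding conv_def using int by simp
    also have "\<bar>\<dots>\<bar> \<le> \<delta> * M"
      unfolding real_norm_def[symmetric]
      using fg \<delta> by (intro Mplus_integral_le \<mu>) (auto simp: abs_minus_commute)
    finally show ?thesis .
  qed
  from this[OF \<mu>] this[OF \<nu>] show ?thesis
    using calculation by (simp add: algebra_simps)
qed

lemma norm_Pair_vec_le: "norm ((x :: real^'n), (z :: real^'k)) \<le> norm x + (\<Sum>j\<in>UNIV. \<bar>z $ j\<bar>)"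
  using norm_Pair_le[of x z] norm_le_l1_cart[of z] by linarith

lemma velocity_close:
  assumes "\<And>j. \<bar>conv (\<mu> j) (\<lambda>z. \<eta> z $ i $ j) x - conv (\<nu> j) (\<lambda>z. \<eta> z $ i $ j) x\<bar> \<le> c"
  shows "norm (velocity V \<eta> \<mu> i x - velocity V \<eta> \<nu> i x) \<le> LV * (real CARD('k) * c)"
proof -
  define a b where "a = (\<chi> j. conv (\<mu> j) (\<lambda>z. \<eta> z $ i $ j) x)" and "b = (\<chi> j. conv (\<nu> j) (\<lambda>z. \<eta> z $ i $ j) x)"
  have "norm (velocity V \<eta> \<mu> i x - velocity V \<eta> \<nu> i x) = norm ((V (x, a) - V (x, b)) $ i)"
    by (simp add: velocity_def a_def b_def)
  also have "\<dots> \<le> norm (V (x, a) - V (x, b))" by (rule Finite_Cartesian_Product.norm_nth_le)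
  also have "\<dots> \<le> LV * norm ((0 :: real^'n), a - b)" using V_lip[of "(x, a)" "(x, b)"] by simp
  also have "\<dots> \<le> LV * (real CARD('k) * c)"
  proof (rule mult_left_mono[OF _ LV])
    have "norm ((0 :: real^'n), a - b) \<le> (\<Sum>j\<in>UNIV. \<bar>(a - b) $ j\<bar>)"
      using norm_Pair_vec_le[of 0 "a - b"] by simp
    also have "\<dots> \<le> (\<Sum>j\<in>(UNIV :: 'k set). c)" using assms by (intro sum_mono) (simp add: a_def b_def)
    finally show "norm ((0 :: real^'n), a - b) \<le> real CARD('k) * c" by simp
  qed
  finally show ?thesis .
qed

text \<open>Lipschitz constant of the velocity in \<open>x\<close>: the explicit dependence plus one
  contribution \<open>L\<eta> * M\<close> per convolution. The measures enter only through their
  mass, so the constant is uniform in time.\<close>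

definition "Lb = LV * (1 + real CARD('k) * (L\<eta> * M))"

lemma Lb_nonneg: "0 \<le> Lb" using LV L\<eta> M by (simp add: Lb_def)

lemma velocity_lipschitz:
  assumes "\<And>j. \<mu> j \<in> Mplus" "\<And>j. measure (\<mu> j) UNIV \<le> M"
  shows "norm (velocity V \<eta> \<mu> i x - velocity V \<eta> \<mu> i y) \<le> Lb * norm (x - y)"
proof -
  define a where "a x = (\<chi> j. conv (\<mu> j) (\<lambda>z. \<eta> z $ i $ j) x)" for x
  have "norm (velocity V \<eta> \<mu> i x - velocity V \<eta> \<mu> i y) = norm ((V (x, a x) - V (y, a y)) $ i)"
    by (simp add: velocity_def a_def)
  also have "\<dots> \<le> norm (V (x, a x) - V (y, a y))" by (rule Finite_Cartesian_Product.norm_nth_le)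
  also have "\<dots> \<le> LV * norm (x - y, a x - a y)" using V_lip[of "(x, a x)" "(y, a y)"] by simp
  also have "\<dots> \<le> LV * (norm (x - y) + real CARD('k) * (L\<eta> * M * norm (x - y)))"
  proof (rule mult_left_mono[OF _ LV])
    have "norm (x - y, a x - a y) \<le> norm (x - y) + (\<Sum>j\<in>UNIV. \<bar>(a x - a y) $ j\<bar>)"
      by (rule norm_Pair_vec_le)
    also have "\<dots> \<le> norm (x - y) + (\<Sum>j\<in>(UNIV :: 'k set). L\<eta> * M * norm (x - y))"
      using conv_lipschitz[OF assms \<eta>_component(2) \<eta>_component(1) L\<eta>]
      by (intro add_left_mono sum_mono) (simp add: a_def)
    finally show "norm (x - y, a x - a y) \<le> norm (x - y) + real CARD('k) * (L\<eta> * M * norm (x - y))" by simp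
  qed
  finally show ?thesis by (simp add: Lb_def algebra_simps)
qed

end

context solution
begin

lemma evol_lipschitz:
  assumes "C11 L K \<psi> \<psi>'" "0 \<le> a" "a \<le> b" "b \<le> T"
  shows "\<bar>evol i \<psi> \<psi>' b - evol i \<psi> \<psi>' a\<bar> \<le> (b - a) * (L * BV * M)"
  unfolding evol_diff[OF assms(1,3)]
proof (rule interval_integral_le)
  show "AE s in \<tau>. s \<in> {a<..b} \<longrightarrow> \<bar>flux i (\<lambda>x. blinfun_apply (\<psi>' x)) s\<bar> \<le> L * BV * M"
    by (rule AE_\<tau>I[OF mass]) (use flux_le[OF covector_C11[OF assms(1)]] in blast)
qed (use assms C11_nonneg[OF assms(1)] BV M in auto)

lemma evol_minus:
  assumes f: "C11 L1 K1 f f'" and g: "C11 L2 K2 g g'"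
  shows "evol i (\<lambda>x. f x - g x) (\<lambda>x. f' x - g' x) t = evol i f f' t - evol i g g' t"
proof -
  have "(\<integral>x. f x - g x \<partial>\<rho>0 i) = (\<integral>x. f x \<partial>\<rho>0 i) - (\<integral>x. g x \<partial>\<rho>0 i)"
  proof -
    obtain B1 B2 where B: "\<And>x. norm (f x) \<le> B1" "\<And>x. norm (g x) \<le> B2"
      using C11_bounded[OF f] C11_bounded[OF g] by blast
    have "integrable (\<rho>0 i) f" "integrable (\<rho>0 i) g"
      using B by (auto intro!: Mplus_integrable[OF \<rho>0] borel_measurable_continuous_onI C11_continuous_on[OF f] C11_continuous_on[OF g])
    then show ?thesis by simp
  qed
  moreover have "flux i (\<lambda>x. blinfun_apply (f' x - g' x)) s = flux i (\<lambda>x. blinfun_apply (f' x)) s - flux i (\<lambda>x. blinfun_apply (g' x)) s"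
    if "s \<in> {0..T}" for s
    using flux_integrand(2)[OF covector_C11[OF f] that] flux_integrand(2)[OF covector_C11[OF g] that]
    by (simp add: flux_def blinfun.diff_left)
  then have "(\<integral>s. indicator {..t} s * flux i (\<lambda>x. blinfun_apply (f' x - g' x)) s \<partial>\<tau>)
    = (\<integral>s. indicator {..t} s * flux i (\<lambda>x. blinfun_apply (f' x)) s - indicator {..t} s * flux i (\<lambda>x. blinfun_apply (g' x)) s \<partial>\<tau>)"
    by (intro Bochner_Integration.integral_cong) (simp_all add: right_diff_distrib)
  ultimately show ?thesis
    using integrable_flux_upto[OF covector_C11[OF f]] integrable_flux_upto[OF covector_C11[OF g]] by (simp add: evol_def)
qed

text \<open>Countability of \<open>Q\<close> and finiteness of the index type leave a single null
  set for all these identities.\<close>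

lemma AE_conv_eq_evol:
  fixes g :: "'k \<Rightarrow> 'k \<Rightarrow> real^'n \<Rightarrow> real"
  assumes g: "\<And>i j. C11 L K (g i j) (g' i j)" and Q: "countable Q"
  shows "AE s in \<tau>. s \<in> {0..T} \<and> (\<forall>i. measure (\<rho> s i) UNIV \<le> M) \<and>
    (\<forall>i j. \<forall>x\<in>Q. conv (\<rho> s j) (g i j) x = evol j (\<lambda>y. g i j (x - y)) (\<lambda>y. - g' i j (x - y)) s)"
proof (intro AE_conjI)
  show "AE s in \<tau>. s \<in> {0..T}" using AE_space[of \<tau>] by simp
  show "AE s in \<tau>. \<forall>i j. \<forall>x\<in>Q. conv (\<rho> s j) (g i j) x = evol j (\<lambda>y. g i j (x - y)) (\<lambda>y. - g' i j (x - y)) s"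
  proof -
    have "AE s in \<tau>. \<forall>i\<in>UNIV. \<forall>j\<in>UNIV. \<forall>x\<in>Q. (\<integral>y. g i j (x - y) \<partial>\<rho> s j) = evol j (\<lambda>y. g i j (x - y)) (\<lambda>y. - g' i j (x - y)) s"
      by (intro AE_ball_countable' Q AE_average_eq_evol[OF C11_reflect[OF g]] countable_finite finite)
    then show ?thesis by (simp add: conv_def)
  qed
qed (rule mass)

text \<open>The flux integrates the derivative of \<open>\<phi>\<close> along the velocity.
  Replacing the velocity by \<open>g\<close> costs \<open>L * \<delta>\<close>; replacing the
  derivative by a difference quotient costs the Taylor remainder
  \<open>h * K * BV\<^sup>2\<close>.\<close>

lemma flux_euler_close:
  assumes \<phi>: "C11 L K \<phi> \<phi>'" and g: "continuous_on UNIV g" "\<And>x. norm (g x) \<le> BV"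
    and h: "0 < h" and s: "s \<in> {0..T}" "measure (\<rho> s i) UNIV \<le> M"
    and close: "\<And>x. norm (vel s i x - g x) \<le> \<delta>"
  shows "\<bar>flux i (\<lambda>x. blinfun_apply (\<phi>' x)) s - (\<integral>x. \<phi> (x + h *\<^sub>R g x) - \<phi> x \<partial>\<rho> s i) / h\<bar> \<le> (L * \<delta> + h * K * BV\<^sup>2) * M"
proof -
  note nn = C11_nonneg[OF \<phi>]
  have \<delta>: "0 \<le> \<delta>" using close norm_ge_zero order_trans by blast
  obtain B where B: "\<And>x. norm (\<phi> x) \<le> B" using C11_bounded[OF \<phi>] by blast
  have "norm (\<phi> (x + h *\<^sub>R g x) - \<phi> x) \<le> B + B" for x
    using B[of "x + h *\<^sub>R g x"] B[of x] norm_triangle_ineq4[of "\<phi> (x + h *\<^sub>R g x)" "\<phi> x"] by linarith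
  then have int: "integrable (\<rho> s i) (\<lambda>x. \<phi> (x + h *\<^sub>R g x) - \<phi> x)"
    by (intro Mplus_integrable[OF \<rho>_Mplus[OF s(1)], where B="B + B"] borel_measurable_continuous_onI continuous_intros
        continuous_on_compose2[OF C11_continuous_on[OF \<phi>, of UNIV]] g C11_continuous_on[OF \<phi>]) auto
  have "flux i (\<lambda>x. blinfun_apply (\<phi>' x)) s - (\<integral>x. \<phi> (x + h *\<^sub>R g x) - \<phi> x \<partial>\<rho> s i) / h
     = (\<integral>x. blinfun_apply (\<phi>' x) (vel s i x) - (\<phi> (x + h *\<^sub>R g x) - \<phi> x) / h \<partial>\<rho> s i)"
    unfolding flux_def
    using Bochner_Integration.integral_diff[OF flux_integrand(2)[OF covector_C11[OF \<phi>] s(1)] integrable_divide[OF int, of h]]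
    by simp
  also have "\<bar>\<dots>\<bar> \<le> (L * \<delta> + h * K * BV\<^sup>2) * M"
    unfolding real_norm_def[symmetric]
  proof (intro Mplus_integral_le \<rho>_Mplus s)
    fix x
    define a where "a = blinfun_apply (\<phi>' x) (vel s i x - g x)"
    define b where "b = \<phi> (x + h *\<^sub>R g x) - \<phi> x - blinfun_apply (\<phi>' x) (h *\<^sub>R g x)"
    have "\<bar>a\<bar> \<le> L * norm (vel s i x - g x)"
      using C11_apply_le[OF \<phi>] unfolding a_def real_norm_def by blast
    also have "\<dots> \<le> L * \<delta>" using close nn by (intro mult_left_mono)
    finally have a: "\<bar>a\<bar> \<le> L * \<delta>" .
    have "\<bar>b\<bar> \<le> K * (norm (h *\<^sub>R g x))\<^sup>2"
      using C11_taylor[OF \<phi>] unfolding b_def real_norm_def by blast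
    also have "\<dots> \<le> K * (h * BV)\<^sup>2"
      using g(2)[of x] h nn by (intro mult_left_mono power_mono) auto
    finally have "\<bar>b\<bar> / h \<le> h * K * BV\<^sup>2"
      using h by (simp add: power2_eq_square field_simps)
    moreover have "blinfun_apply (\<phi>' x) (vel s i x) - (\<phi> (x + h *\<^sub>R g x) - \<phi> x) / h = a - b / h"
      using h by (simp add: a_def b_def blinfun.diff_right blinfun.scaleR_right field_simps)
    ultimately show "norm (blinfun_apply (\<phi>' x) (vel s i x) - (\<phi> (x + h *\<^sub>R g x) - \<phi> x) / h) \<le> L * \<delta> + h * K * BV\<^sup>2"
      using a h abs_triangle_ineq4[of a "b / h"] by (simp add: abs_divide)
  qed (use nn h \<delta> in auto)
  finally show ?thesis .
qed

end

section \<open>Difference of two solutions over one Euler step\<close>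

locale two_solutions = transport_data V \<eta> T M BV LV B\<eta> L\<eta>
  + l: solution V \<eta> T M BV LV B\<eta> L\<eta> \<rho>0 \<rho> + r: solution V \<eta> T M BV LV B\<eta> L\<eta> \<rho>0 \<rho>'
  for V :: "(real^'n) \<times> (real^'k) \<Rightarrow> (real^'n)^'k" and \<eta> :: "real^'n \<Rightarrow> (real^'k)^'k"
    and T M BV LV B\<eta> L\<eta> :: real and \<rho>0 and \<rho> \<rho>' :: "real \<Rightarrow> 'k \<Rightarrow> (real^'n) measure"
begin

definition gap :: "'k \<Rightarrow> (real^'n \<Rightarrow> real) \<Rightarrow> (real^'n \<Rightarrow> (real^'n) \<Rightarrow>\<^sub>L real) \<Rightarrow> real \<Rightarrow> real" where
  "gap i \<psi> \<psi>' t = l.evol i \<psi> \<psi>' t - r.evol i \<psi> \<psi>' t"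

lemma gap_0: "gap i \<psi> \<psi>' 0 = 0"
  by (simp add: gap_def l.evol_0 r.evol_0)

lemma gap_lipschitz:
  assumes "C11 L K \<psi> \<psi>'" "0 \<le> a" "a \<le> b" "b \<le> T"
  shows "\<bar>gap i \<psi> \<psi>' b - gap i \<psi> \<psi>' a\<bar> \<le> 2 * ((b - a) * (L * BV * M))"
  using l.evol_lipschitz[OF assms, of i] r.evol_lipschitz[OF assms, of i] by (simp add: gap_def)

text \<open>Up to \<open>O(h\<^sup>2)\<close>, an Euler step transports both solutions by the same frozen field \<open>g\<close>; only the
  difference of the two velocities is seen at first order.\<close>

lemma gap_euler_step:
  assumes \<phi>: "C11 L K \<phi> \<phi>'" and g: "C11 Lb Kg g g'" "\<And>x. norm (g x) \<le> BV"
    and h: "0 < h" and t: "0 \<le> t" "t + h \<le> T" and E: "0 \<le> E" and \<delta>: "0 \<le> \<delta>"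
    and close: "AE s in \<tau>. s \<in> {t<..t + h} \<longrightarrow> (\<forall>x. norm (l.vel s i x - g x) \<le> \<delta> \<and>
      norm (l.vel s i x - r.vel s i x) \<le> E)"
  shows "\<bar>gap i \<phi> \<phi>' (t + h) - gap i (\<lambda>x. \<phi> (x + h *\<^sub>R g x)) (pull' h g g' \<phi>') t\<bar>
    \<le> h * (2 * M * L * \<delta> + M * L * E + h * (2 * M * K * BV\<^sup>2 + 2 * M * BV * (K * BV + L * Lb)))" (is "_ \<le> h * ?R")
proof -
  note nn = C11_nonneg[OF \<phi>] C11_nonneg[OF g(1)] M BV E \<delta>
  \<comment> \<open>The increment of \<open>\<phi>\<close> under the step. Its average divided by
    \<open>h\<close> approximates the flux, for both solutions with the same
    \<open>g\<close>.\<close>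
  define \<psi> where "\<psi> x = \<phi> (x + h *\<^sub>R g x) - \<phi> x" for x
  define \<psi>' where "\<psi>' x = pull' h g g' \<phi>' x - \<phi>' x" for x
  \<comment> \<open>The increment has a derivative of order h, so its gap changes by O(h^2) during
    the step and may be frozen at the initial time \<open>t\<close>.\<close>
  define L\<psi> where "L\<psi> = h * (K * BV + L * Lb)"
  have h0: "0 \<le> h" using h by simp
  note pull = C11_pull[OF \<phi> g(1) h0]
  obtain K\<psi> where \<psi>: "C11 L\<psi> K\<psi> \<psi> \<psi>'"
    using C11_diff[OF pull \<phi> pull'_diff_le[OF \<phi> g(1) h0 g(2)]] unfolding \<psi>_def[abs_def] \<psi>'_def[abs_def] L\<psi>_def by blast
  have gap_\<psi>: "gap i \<psi> \<psi>' s = gap i (\<lambda>x. \<phi> (x + h *\<^sub>R g x)) (pull' h g g' \<phi>') s - gap i \<phi> \<phi>' s" for s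
    unfolding gap_def \<psi>_def[abs_def] \<psi>'_def[abs_def] l.evol_minus[OF pull \<phi>] r.evol_minus[OF pull \<phi>] by simp
  let ?l = "l.flux i (\<lambda>x. blinfun_apply (\<phi>' x))" and ?r = "r.flux i (\<lambda>x. blinfun_apply (\<phi>' x))"
  \<comment> \<open>The constant integrates over the step to exactly
    \<open>gap i \<psi> \<psi>' t\<close>, so the integral of \<open>f\<close> is the quantity to be
    estimated.\<close>
  define f where "f s = ?l s - ?r s - gap i \<psi> \<psi>' t / h" for s
  have sets: "{t<..t + h} \<in> sets \<tau>" using t h by (subst sets_restrict_space_iff) auto
  have meas: "measure \<tau> {t<..t + h} = h"
    using t h by (subst measure_restrict_space) auto
  have int: "integrable \<tau> (\<lambda>s. indicator {t<..t + h} s * ?l s)" "integrable \<tau> (\<lambda>s. indicator {t<..t + h} s * ?r s)"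
    using integrable_mult_indicator[OF sets l.integrable_flux[OF l.covector_C11[OF \<phi>], of i]]
      integrable_mult_indicator[OF sets r.integrable_flux[OF r.covector_C11[OF \<phi>], of i]] by auto
  have intc: "integrable \<tau> (\<lambda>s. indicator {t<..t + h} s * c)" for c :: real
    by (intro integrable_mult_left integrable_real_indicator sets) (simp add: less_top[symmetric])
  have c: "(\<integral>s. indicator {t<..t + h} s * c \<partial>\<tau>) = h * c" for c :: real
  proof -
    have "{t<..t + h} \<inter> {0..T} = {t<..t + h}" using t h by auto
    then show ?thesis using sets meas by simp
  qed
  have "gap i \<phi> \<phi>' (t + h) - gap i \<phi> \<phi>' t
     = (\<integral>s. indicator {t<..t + h} s * ?l s \<partial>\<tau>) - (\<integral>s. indicator {t<..t + h} s * ?r s \<partial>\<tau>)"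
    using l.evol_diff[OF \<phi>, of t "t + h" i] r.evol_diff[OF \<phi>, of t "t + h" i] h by (simp add: gap_def)
  moreover have "(\<integral>s. indicator {t<..t + h} s * f s \<partial>\<tau>)
     = (\<integral>s. indicator {t<..t + h} s * ?l s \<partial>\<tau>) - (\<integral>s. indicator {t<..t + h} s * ?r s \<partial>\<tau>) - gap i \<psi> \<psi>' t"
    using int intc c[of "gap i \<psi> \<psi>' t / h"] h unfolding f_def by (simp add: right_diff_distrib)
  ultimately have eq: "gap i \<phi> \<phi>' (t + h) - gap i (\<lambda>x. \<phi> (x + h *\<^sub>R g x)) (pull' h g g' \<phi>') t
     = (\<integral>s. indicator {t<..t + h} s * f s \<partial>\<tau>)"
    using gap_\<psi>[of t] by simp
  have "\<bar>\<integral>s. indicator {t<..t + h} s * f s \<partial>\<tau>\<bar> \<le> (t + h - t) * ?R"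
  proof (rule interval_integral_le)
    have AE: "AE s in \<tau>. s \<in> {0..T}" using AE_space[of \<tau>] by simp
    show "AE s in \<tau>. s \<in> {t<..t + h} \<longrightarrow> \<bar>f s\<bar> \<le> ?R"
      using close AE l.mass r.mass l.AE_average_eq_evol[OF \<psi>, of i] r.AE_average_eq_evol[OF \<psi>, of i]
    proof eventually_elim
      case (elim s)
      show ?case
      proof
        assume s: "s \<in> {t<..t + h}"
        note elim = elim[unfolded \<psi>_def[abs_def]]
        have cl: "norm (l.vel s i x - g x) \<le> \<delta>" "norm (r.vel s i x - g x) \<le> \<delta> + E" for x
        proof -
          have 1: "norm (l.vel s i x - g x) \<le> \<delta>"
            "norm (l.vel s i x - r.vel s i x) \<le> E"
            using elim(1) s by auto
          then show "norm (l.vel s i x - g x) \<le> \<delta>" by simp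
          have "r.vel s i x - g x = (l.vel s i x - g x) - (l.vel s i x - r.vel s i x)"
            by simp
          then show "norm (r.vel s i x - g x) \<le> \<delta> + E"
            using 1 norm_triangle_ineq4[of "l.vel s i x - g x" "l.vel s i x - r.vel s i x"]
            by simp
        qed
        have a: "\<bar>?l s - l.evol i \<psi> \<psi>' s / h\<bar> \<le> (L * \<delta> + h * K * BV\<^sup>2) * M"
          using l.flux_euler_close[OF \<phi> C11_continuous_on[OF g(1)] g(2) h elim(2) _ cl(1)] elim(3)
          unfolding elim(5) \<psi>_def[abs_def] by blast
        have b: "\<bar>?r s - r.evol i \<psi> \<psi>' s / h\<bar> \<le> (L * (\<delta> + E) + h * K * BV\<^sup>2) * M"
          using r.flux_euler_close[OF \<phi> C11_continuous_on[OF g(1)] g(2) h elim(2) _ cl(2)] elim(4)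
          unfolding elim(6) \<psi>_def[abs_def] by blast
        have "\<bar>gap i \<psi> \<psi>' s - gap i \<psi> \<psi>' t\<bar> \<le> 2 * ((s - t) * (L\<psi> * BV * M))"
          using s t by (intro gap_lipschitz[OF \<psi>]) auto
        also have "\<dots> \<le> 2 * (h * (L\<psi> * BV * M))"
          using s nn h by (intro mult_left_mono mult_right_mono) (auto simp: L\<psi>_def)
        finally have "\<bar>gap i \<psi> \<psi>' s - gap i \<psi> \<psi>' t\<bar> / h \<le> 2 * (L\<psi> * BV * M)"
          using h by (simp add: field_simps)
        then have c: "\<bar>gap i \<psi> \<psi>' s / h - gap i \<psi> \<psi>' t / h\<bar> \<le> 2 * (L\<psi> * BV * M)"
          using h by (simp add: diff_divide_distrib[symmetric] abs_divide)
        have "f s = (?l s - l.evol i \<psi> \<psi>' s / h) - (?r s - r.evol i \<psi> \<psi>' s / h) + (gap i \<psi> \<psi>' s / h - gap i \<psi> \<psi>' t / h)"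
          unfolding f_def gap_def by (simp add: diff_divide_distrib)
        then have "\<bar>f s\<bar> \<le> (L * \<delta> + h * K * BV\<^sup>2) * M + (L * (\<delta> + E) + h * K * BV\<^sup>2) * M + 2 * (L\<psi> * BV * M)"
          using a b c by linarith
        also have "\<dots> = ?R" by (simp add: L\<psi>_def algebra_simps)
        finally show "\<bar>f s\<bar> \<le> ?R" .
      qed
    qed
  qed (use t h nn in auto)
  then show ?thesis unfolding eq by simp
qed

end

section \<open>Iteration of the Euler step\<close>

lemma one_plus_power_le_exp:
  fixes c h :: real
  assumes "0 \<le> c" "0 \<le> h" "real n * h \<le> T"
  shows "(1 + h * c) ^ n \<le> exp (c * T)"
proof -
  have "(1 + h * c) ^ n \<le> exp (h * c) ^ n"
    using assms exp_ge_add_one_self[of "h * c"] by (intro power_mono) auto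
  also have "\<dots> = exp (real n * h * c)" by (simp add: exp_of_nat_mult[symmetric] mult.assoc)
  also have "\<dots> \<le> exp (c * T)" using mult_left_mono[OF assms(3,1)] by (simp add: mult_ac)
  finally show ?thesis .
qed

text \<open>The source of the gain 1/\<gamma>. Since \<open>h * \<gamma> \<le> 1\<close>,
  \<open>exp (h * \<gamma>)\<close> is at most 3, which makes each term at most 3/\<gamma> times an
  increment of the exponential; the increments telescope.\<close>

lemma exp_riemann_sum_le:
  fixes h \<gamma> :: real
  assumes "0 < \<gamma>" "0 \<le> h" "h * \<gamma> \<le> 1"
  shows "(\<Sum>j<m. h * exp (\<gamma> * (real (Suc j) * h))) \<le> 3 / \<gamma> * exp (\<gamma> * (real m * h))"
proof -
  have step: "h * exp (\<gamma> * (real (Suc j) * h)) \<le> 3 / \<gamma> * exp (\<gamma> * (real (Suc j) * h)) - 3 / \<gamma> * exp (\<gamma> * (real j * h))" for j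
  proof -
    define e where "e = exp (\<gamma> * (real j * h))"
    define q where "q = exp (h * \<gamma>)"
    have e: "exp (\<gamma> * (real (Suc j) * h)) = e * q"
      by (simp add: e_def q_def exp_add[symmetric] algebra_simps)
    have "q \<le> exp 1" using assms by (simp add: q_def)
    then have q3: "q \<le> 3" using exp_le by linarith
    have q1: "1 + h * \<gamma> \<le> q" unfolding q_def by (rule exp_ge_add_one_self)
    have "h * \<gamma> * q \<le> h * \<gamma> * 3" using q3 assms by (intro mult_left_mono) auto
    moreover have "h * \<gamma> * 3 \<le> 3 * (q - 1)" using q1 by simp
    ultimately have "h * \<gamma> * q \<le> 3 * (q - 1)" by (rule order_trans)
    then have "h * q \<le> 3 / \<gamma> * (q - 1)" using assms by (simp add: field_simps)
    moreover define a where "a = 3 / \<gamma>"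
    ultimately have "e * (h * q) \<le> e * (a * (q - 1))" by (intro mult_left_mono) (auto simp: e_def)
    then show ?thesis unfolding e e_def[symmetric] a_def[symmetric] by (simp add: algebra_simps)
  qed
  have "(\<Sum>j<m. h * exp (\<gamma> * (real (Suc j) * h)))
      \<le> (\<Sum>j<m. 3 / \<gamma> * exp (\<gamma> * (real (Suc j) * h)) - 3 / \<gamma> * exp (\<gamma> * (real j * h)))"
    by (intro sum_mono step)
  also have "\<dots> = 3 / \<gamma> * exp (\<gamma> * (real m * h)) - 3 / \<gamma> * exp (\<gamma> * (real 0 * h))"
    by (rule sum_lessThan_telescope)
  also have "\<dots> \<le> 3 / \<gamma> * exp (\<gamma> * (real m * h))" using assms by simp
  finally show ?thesis .
qed

context two_solutions
begin

text \<open>\<open>Kg\<close> and \<open>\<delta>\<close> are arguments because they have to be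
  common to all steps, while the field itself changes from step to step.\<close>

definition euler_field :: "'k \<Rightarrow> real \<Rightarrow> real \<Rightarrow> real \<Rightarrow> real \<Rightarrow> real \<Rightarrow> bool" where
  "euler_field i Kg \<delta> E t h \<longleftrightarrow> (\<exists>g g'. C11 Lb Kg g g' \<and> (\<forall>x. norm (g x) \<le> BV) \<and>
     (AE s in \<tau>. s \<in> {t<..t + h} \<longrightarrow> (\<forall>x. norm (l.vel s i x - g x) \<le> \<delta> \<and>
      norm (l.vel s i x - r.vel s i x) \<le> E)))"

definition step_error :: "real \<Rightarrow> real \<Rightarrow> real \<Rightarrow> real \<Rightarrow> real \<Rightarrow> real" where
  "step_error L K \<delta> E h = h * (2 * M * L * \<delta> + M * L * E + h * (2 * M * K * BV\<^sup>2 + 2 * M * BV * (K * BV + L * Lb)))"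

lemma step_error_mono:
  assumes "L \<le> L'" "K \<le> K'" "0 \<le> h" "0 \<le> \<delta>" "0 \<le> E"
  shows "step_error L K \<delta> E h \<le> step_error L' K' \<delta> E h"
  unfolding step_error_def using assms M BV Lb_nonneg
  by (intro mult_left_mono add_mono mult_right_mono) auto

text \<open>The pullback runs backwards in time: at time \<open>real j * h\<close> the test function
  has passed through the remaining \<open>m - j\<close> steps, and at time 0 the gap vanishes, so
  only the step errors are left. They are evaluated at the largest constants \<open>Lm\<close> and
  \<open>Km\<close>.\<close>

lemma gap_euler_iterate:
  fixes E :: "nat \<Rightarrow> real" and m :: nat
  assumes h: "0 < h" "h \<le> 1" "real m * h \<le> T" and \<delta>: "0 \<le> \<delta>" and E: "\<And>j. 0 \<le> E j" and Kg: "0 \<le> Kg"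
    and field: "\<And>j. j < m \<Longrightarrow> euler_field i Kg \<delta> (E j) (real j * h) h"
    and \<psi>: "C11 L0 K0 \<psi> \<psi>'"
  defines "Lm \<equiv> L0 * exp (Lb * T)" and "Km \<equiv> (K0 + 1) * exp ((2 * Lb + Lb\<^sup>2 + L0 * exp (Lb * T) * Kg) * T)"
  shows "\<bar>gap i \<psi> \<psi>' (real m * h)\<bar> \<le> (\<Sum>j<m. step_error Lm Km \<delta> (E j) h)"
proof -
  note nn = C11_nonneg[OF \<psi>] Lb_nonneg Kg
  have Lm: "0 \<le> Lm" using nn by (simp add: Lm_def)
  \<comment> \<open>Chosen so that \<open>K + 1\<close> grows by at most the factor
    \<open>1 + h * c\<close> per step: the summand 1 makes the source term \<open>h * L * Kg\<close>
    multiplicative, and \<open>h \<le> 1\<close> absorbs the quadratic term in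
    \<open>h * Lb\<close>.\<close>
  define c where "c = 2 * Lb + Lb\<^sup>2 + Lm * Kg"
  have c: "0 \<le> c" using nn Lm by (simp add: c_def)
  have Km: "Km = (K0 + 1) * exp (c * T)" by (simp add: Km_def c_def Lm_def)
  have le_T: "real n * h \<le> T" if "n \<le> m" for n
  proof -
    have "real n * h \<le> real m * h" using that h by (intro mult_right_mono) auto
    then show ?thesis using h(3) by simp
  qed
  \<comment> \<open>Generalized to every function whose constants do not exceed those reachable
    after \<open>m - j\<close> pullbacks, since the induction changes the function.\<close>
  have "\<bar>gap i \<phi> \<phi>' (real j * h)\<bar> \<le> (\<Sum>l<j. step_error Lm Km \<delta> (E l) h)"
    if "j \<le> m" "C11 L K \<phi> \<phi>'" "L \<le> L0 * (1 + h * Lb) ^ (m - j)" "K + 1 \<le> (K0 + 1) * (1 + h * c) ^ (m - j)" for j L K \<phi> \<phi>'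
    using that
  proof (induction j arbitrary: L K \<phi> \<phi>')
    case 0
    show ?case by (simp add: gap_0)
  next
    case (Suc j)
    note \<phi> = \<open>C11 L K \<phi> \<phi>'\<close>
    note nn' = C11_nonneg[OF \<phi>]
    have j: "j < m" "m - j = Suc (m - Suc j)" using Suc.prems(1) by auto
    have L: "L \<le> Lm"
    proof -
      have "(1 + h * Lb) ^ (m - Suc j) \<le> exp (Lb * T)"
        using h nn le_T[of "m - Suc j"] by (intro one_plus_power_le_exp) auto
      then have "L0 * (1 + h * Lb) ^ (m - Suc j) \<le> Lm" unfolding Lm_def using nn by (intro mult_left_mono)
      then show ?thesis using Suc.prems(3) by simp
    qed
    have K: "K \<le> Km"
    proof -
      have "(1 + h * c) ^ (m - Suc j) \<le> exp (c * T)"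
        using h c le_T[of "m - Suc j"] by (intro one_plus_power_le_exp) auto
      then have "(K0 + 1) * (1 + h * c) ^ (m - Suc j) \<le> Km" unfolding Km using nn by (intro mult_left_mono) auto
      then show ?thesis using Suc.prems(4) by simp
    qed
    obtain g g' where g: "C11 Lb Kg g g'" "\<And>x. norm (g x) \<le> BV"
      "AE s in \<tau>. s \<in> {real j * h<..real j * h + h} \<longrightarrow> (\<forall>x. norm (l.vel s i x - g x) \<le> \<delta> \<and>
      norm (l.vel s i x - r.vel s i x) \<le> E j)"
      using field[OF j(1)] unfolding euler_field_def by blast
    have h0: "0 \<le> h" using h by simp
    note pull = C11_pull[OF \<phi> g(1) h0]
    have t: "real (Suc j) * h = real j * h + h" by (simp add: algebra_simps)
    have "\<bar>gap i \<phi> \<phi>' (real j * h + h) - gap i (\<lambda>x. \<phi> (x + h *\<^sub>R g x)) (pull' h g g' \<phi>') (real j * h)\<bar>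
      \<le> step_error L K \<delta> (E j) h"
      unfolding step_error_def using h le_T[of "Suc j"] Suc.prems(1) t
      by (intro gap_euler_step[OF \<phi> g(1,2) h(1) _ _ E \<delta> g(3)]) auto
    also have "\<dots> \<le> step_error Lm Km \<delta> (E j) h"
      using L K h \<delta> E by (intro step_error_mono) auto
    finally have 1: "\<bar>gap i \<phi> \<phi>' (real j * h + h) - gap i (\<lambda>x. \<phi> (x + h *\<^sub>R g x)) (pull' h g g' \<phi>') (real j * h)\<bar>
      \<le> step_error Lm Km \<delta> (E j) h" .
    have 2: "\<bar>gap i (\<lambda>x. \<phi> (x + h *\<^sub>R g x)) (pull' h g g' \<phi>') (real j * h)\<bar> \<le> (\<Sum>l<j. step_error Lm Km \<delta> (E l) h)"
    proof (rule Suc.IH[OF _ pull])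
      show "j \<le> m" using j by simp
      show "L * (1 + h * Lb) \<le> L0 * (1 + h * Lb) ^ (m - j)"
        using mult_right_mono[OF Suc.prems(3), of "1 + h * Lb"] h nn unfolding j(2) by (simp add: mult_ac)
      have "h * h * Lb\<^sup>2 * K \<le> h * Lb\<^sup>2 * K"
        using h nn nn' by (intro mult_right_mono) auto
      moreover have "h * (L * Kg) \<le> h * (Lm * Kg)"
        using L h nn by (intro mult_left_mono mult_right_mono) auto
      moreover have "0 \<le> h * (2 * Lb + Lb\<^sup>2)" "0 \<le> h * (K * (Lm * Kg))" using h nn nn' Lm by auto
      ultimately have "K * (1 + h * Lb)\<^sup>2 + h * L * Kg + 1 \<le> (K + 1) * (1 + h * c)"
        unfolding c_def by (simp add: power2_eq_square algebra_simps)
      also have "\<dots> \<le> (K0 + 1) * (1 + h * c) ^ (m - Suc j) * (1 + h * c)"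
        using Suc.prems(4) h c by (intro mult_right_mono) auto
      finally show "K * (1 + h * Lb)\<^sup>2 + h * L * Kg + 1 \<le> (K0 + 1) * (1 + h * c) ^ (m - j)"
        unfolding j(2) by (simp add: mult_ac)
    qed
    show ?case using 1 2 unfolding t by simp
  qed
  from this[of m L0 K0 \<psi> \<psi>'] \<psi> show ?thesis by simp
qed

text \<open>A bound by \<open>A\<close> in the dual Lipschitz norm weighted with exp(-\<gamma> t).
  It is uniform in \<open>K\<close>, the constant that deteriorates under mollification.\<close>

definition gap_bound :: "real \<Rightarrow> real \<Rightarrow> bool" where
  "gap_bound \<gamma> A \<longleftrightarrow> (\<forall>i L K \<psi> \<psi>'. \<forall>t\<in>{0..T}. C11 L K \<psi> \<psi>' \<longrightarrow> \<bar>gap i \<psi> \<psi>' t\<bar> \<le> L * (A * exp (\<gamma> * t)))"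

text \<open>The velocities see the measures only through convolutions with Lipschitz kernels. For
  \<open>C11\<close> kernels at distance \<open>L\<eta> * \<epsilon>\<close> these convolutions are
  values of \<open>evol\<close> outside a null set, where time regularity and the assumed gap bound
  are available; the term \<open>2 * M * (L\<eta> * \<epsilon>)\<close> pays for the
  replacement.\<close>

lemma velocity_regularity:
  assumes bound: "gap_bound \<gamma> A" and \<epsilon>: "0 < \<epsilon>"
  obtains S where "AE s in \<tau>. s \<in> S" "S \<subseteq> {0..T}" "\<And>s i. s \<in> S \<Longrightarrow> measure (\<rho> s i) UNIV \<le> M"
    "\<And>s r i x. s \<in> S \<Longrightarrow> r \<in> S \<Longrightarrow> norm (l.vel s i x - l.vel r i x)
      \<le> LV * (real CARD('k) * (\<bar>s - r\<bar> * (L\<eta> * BV * M) + 2 * M * (L\<eta> * \<epsilon>)))"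
    "\<And>s i x. s \<in> S \<Longrightarrow> norm (l.vel s i x - r.vel s i x)
      \<le> LV * (real CARD('k) * (L\<eta> * (A * exp (\<gamma> * s)) + 2 * M * (L\<eta> * \<epsilon>)))"
proof -
  obtain Q :: "(real^'n) set" where Q: "countable Q" "\<And>X. open X \<Longrightarrow> X \<noteq> {} \<Longrightarrow> \<exists>d\<in>Q. d \<in> X"
    using countable_dense_setE by blast
  obtain K where K: "\<And>f :: real^'n \<Rightarrow> real. (\<And>x. norm (f x) \<le> B\<eta>) \<Longrightarrow> (\<And>x y. norm (f x - f y) \<le> L\<eta> * norm (x - y)) \<Longrightarrow>
    \<exists>g g'. C11 L\<eta> K g g' \<and> (\<forall>x. norm (g x - f x) \<le> L\<eta> * \<epsilon>) \<and> (\<forall>x. norm (g x) \<le> B\<eta>)"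
    using C11_approx[OF \<epsilon> L\<eta>, of B\<eta>] by blast
  have "\<exists>g g'. C11 L\<eta> K g g' \<and> (\<forall>x. norm (g x - \<eta> x $ i $ j) \<le> L\<eta> * \<epsilon>) \<and> (\<forall>x. norm (g x) \<le> B\<eta>)" for i j
    by (rule K) (simp_all add: \<eta>_component)
  then obtain g g' where g: "\<And>i j. C11 L\<eta> K (g i j) (g' i j)" "\<And>i j x. \<bar>g i j x - \<eta> x $ i $ j\<bar> \<le> L\<eta> * \<epsilon>"
    "\<And>i j x. \<bar>g i j x\<bar> \<le> B\<eta>" unfolding real_norm_def by metis
  have glip: "\<bar>g i j x - g i j y\<bar> \<le> L\<eta> * norm (x - y)" for i j x y
    using C11_lipschitz[OF g(1)] by simp
  have cont: "continuous_on UNIV (\<lambda>z. \<eta> z $ i $ j)" for i j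
    by (intro continuous_intros continuous_on_\<eta>)
  define S where "S = {s. (s \<in> {0..T} \<and> (\<forall>i. measure (\<rho> s i) UNIV \<le> M) \<and>
      (\<forall>i j. \<forall>x\<in>Q. conv (\<rho> s j) (g i j) x = l.evol j (\<lambda>y. g i j (x - y)) (\<lambda>y. - g' i j (x - y)) s)) \<and>
      (s \<in> {0..T} \<and> (\<forall>i. measure (\<rho>' s i) UNIV \<le> M) \<and>
      (\<forall>i j. \<forall>x\<in>Q. conv (\<rho>' s j) (g i j) x = r.evol j (\<lambda>y. g i j (x - y)) (\<lambda>y. - g' i j (x - y)) s))}"
  show ?thesis
  proof (rule that)
    show "AE s in \<tau>. s \<in> S"
      using l.AE_conv_eq_evol[OF g(1) Q(1)] r.AE_conv_eq_evol[OF g(1) Q(1)] unfolding S_def mem_Collect_eq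
      by (rule AE_conjI)
    show "S \<subseteq> {0..T}" by (auto simp: S_def)
    show "measure (\<rho> s i) UNIV \<le> M" if "s \<in> S" for s i using that by (auto simp: S_def)
    fix s i x assume s: "s \<in> S"
    show "norm (l.vel s i x - r.vel s i x)
      \<le> LV * (real CARD('k) * (L\<eta> * (A * exp (\<gamma> * s)) + 2 * M * (L\<eta> * \<epsilon>)))"
    proof (rule velocity_close)
      fix j
      have "\<bar>conv (\<rho> s j) (g i j) y - conv (\<rho>' s j) (g i j) y\<bar> \<le> L\<eta> * (A * exp (\<gamma> * s))" if "y \<in> Q" for y
      proof -
        have "conv (\<rho> s j) (g i j) y - conv (\<rho>' s j) (g i j) y = gap j (\<lambda>z. g i j (y - z)) (\<lambda>z. - g' i j (y - z)) s"
          using s that by (auto simp: S_def gap_def)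
        then show ?thesis
          using bound C11_reflect[OF g(1)[of i j], of y] s unfolding gap_bound_def by (auto simp: S_def)
      qed
      then show "\<bar>conv (\<rho> s j) (\<lambda>z. \<eta> z $ i $ j) x - conv (\<rho>' s j) (\<lambda>z. \<eta> z $ i $ j) x\<bar>
          \<le> L\<eta> * (A * exp (\<gamma> * s)) + 2 * M * (L\<eta> * \<epsilon>)"
        using s by (intro conv_close[OF l.\<rho>_Mplus _ r.\<rho>_Mplus _ glip g(3) L\<eta> cont \<eta>_component(1) g(2) Q(2)]) (auto simp: S_def)
    qed
  next
    fix s r i x assume s: "s \<in> S" and r: "r \<in> S"
    show "norm (l.vel s i x - l.vel r i x)
      \<le> LV * (real CARD('k) * (\<bar>s - r\<bar> * (L\<eta> * BV * M) + 2 * M * (L\<eta> * \<epsilon>)))"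
    proof (rule velocity_close)
      fix j
      have "\<bar>conv (\<rho> s j) (g i j) y - conv (\<rho> r j) (g i j) y\<bar> \<le> \<bar>s - r\<bar> * (L\<eta> * BV * M)" if "y \<in> Q" for y
      proof -
        have "conv (\<rho> s j) (g i j) y - conv (\<rho> r j) (g i j) y
          = l.evol j (\<lambda>z. g i j (y - z)) (\<lambda>z. - g' i j (y - z)) s - l.evol j (\<lambda>z. g i j (y - z)) (\<lambda>z. - g' i j (y - z)) r"
          using s r that by (auto simp: S_def)
        then show ?thesis
          using l.evol_lipschitz[OF C11_reflect[OF g(1)[of i j], of y], of s r j]
            l.evol_lipschitz[OF C11_reflect[OF g(1)[of i j], of y], of r s j] s r
          by (cases "s \<le> r") (auto simp: S_def abs_minus_commute)
      qed
      then show "\<bar>conv (\<rho> s j) (\<lambda>z. \<eta> z $ i $ j) x - conv (\<rho> r j) (\<lambda>z. \<eta> z $ i $ j) x\<bar>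
          \<le> \<bar>s - r\<bar> * (L\<eta> * BV * M) + 2 * M * (L\<eta> * \<epsilon>)"
        using s r by (intro conv_close[OF l.\<rho>_Mplus _ l.\<rho>_Mplus _ glip g(3) L\<eta> cont \<eta>_component(1) g(2) Q(2)]) (auto simp: S_def)
    qed
  qed
qed

text \<open>Cost of freezing the velocity for a time \<open>h\<close>, plus the cost
  \<open>Lb * \<epsilon>\<close> of mollifying it.\<close>

definition "field_error \<epsilon> h = LV * (real CARD('k) * (h * (L\<eta> * BV * M) + 2 * M * (L\<eta> * \<epsilon>))) + Lb * \<epsilon>"
definition "velocity_gap \<epsilon> D = LV * (real CARD('k) * (L\<eta> * D + 2 * M * (L\<eta> * \<epsilon>)))"

lemma euler_field_exists:
  assumes bound: "gap_bound \<gamma> A" and \<epsilon>: "0 < \<epsilon>" and A: "0 \<le> A" and \<gamma>: "0 \<le> \<gamma>"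
  obtains Kg where "0 \<le> Kg" "\<And>i t h. 0 < h \<Longrightarrow> 0 \<le> t \<Longrightarrow> t + h \<le> T \<Longrightarrow>
    euler_field i Kg (field_error \<epsilon> h) (velocity_gap \<epsilon> (A * exp (\<gamma> * (t + h)))) t h"
proof -
  obtain S where S: "AE s in \<tau>. s \<in> S" "S \<subseteq> {0..T}" "\<And>s i. s \<in> S \<Longrightarrow> measure (\<rho> s i) UNIV \<le> M"
    "\<And>s r i x. s \<in> S \<Longrightarrow> r \<in> S \<Longrightarrow> norm (l.vel s i x - l.vel r i x)
      \<le> LV * (real CARD('k) * (\<bar>s - r\<bar> * (L\<eta> * BV * M) + 2 * M * (L\<eta> * \<epsilon>)))"
    "\<And>s i x. s \<in> S \<Longrightarrow> norm (l.vel s i x - r.vel s i x)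
      \<le> LV * (real CARD('k) * (L\<eta> * (A * exp (\<gamma> * s)) + 2 * M * (L\<eta> * \<epsilon>)))"
    using velocity_regularity[OF bound \<epsilon>] by blast
  obtain Kg where Kg: "\<And>f :: real^'n \<Rightarrow> real^'n. (\<And>x. norm (f x) \<le> BV) \<Longrightarrow> (\<And>x y. norm (f x - f y) \<le> Lb * norm (x - y)) \<Longrightarrow>
    \<exists>g g'. C11 Lb Kg g g' \<and> (\<forall>x. norm (g x - f x) \<le> Lb * \<epsilon>) \<and> (\<forall>x. norm (g x) \<le> BV)"
    using C11_approx[OF \<epsilon> Lb_nonneg, of BV] by blast
  \<comment> \<open>Approximating the zero field shows that \<open>Kg\<close> is
    nonnegative.\<close>
  have "\<exists>g g'. C11 Lb Kg g g' \<and> (\<forall>x. norm (g x - (0 :: real^'n)) \<le> Lb * \<epsilon>) \<and> (\<forall>x :: real^'n. norm (g x) \<le> BV)"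
    by (rule Kg) (use BV Lb_nonneg in auto)
  then have Kg0: "0 \<le> Kg" using C11_nonneg(2) by blast
  show ?thesis
  proof (rule that[OF Kg0])
    fix i t h assume h: "(0::real) < h" "0 \<le> t" "t + h \<le> T"
    \<comment> \<open>The velocity is frozen at some time of the step at which the estimates hold;
      the left endpoint may lie in the null set.\<close>
    obtain s0 where s0: "s0 \<in> S" "s0 \<in> {t<..t + h}"
    proof -
      have "\<exists>s0. s0 \<in> S \<and> s0 \<in> {t<..t + h}"
      proof (rule ccontr)
        assume none: "\<not> ?thesis"
        have "AE s in \<tau>. s \<notin> {t<..t + h}" using S(1) by eventually_elim (use none in auto)
        moreover have sets: "{t<..t + h} \<in> sets \<tau>" using h by (subst sets_restrict_space_iff) auto
        ultimately have "emeasure \<tau> {t<..t + h} = 0"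
          using AE_iff_null_sets[OF sets] by auto
        then have "measure \<tau> {t<..t + h} = 0" by (simp add: measure_def)
        moreover have "measure \<tau> {t<..t + h} = h"
          using h by (subst measure_restrict_space) auto
        ultimately show False using h by simp
      qed
      then show ?thesis using that by blast
    qed
    have "\<exists>g g'. C11 Lb Kg g g' \<and> (\<forall>x. norm (g x - l.vel s0 i x) \<le> Lb * \<epsilon>) \<and> (\<forall>x. norm (g x) \<le> BV)"
      using s0 S(2,3) by (intro Kg velocity_le velocity_lipschitz l.\<rho>_Mplus) auto
    then obtain g g' where g: "C11 Lb Kg g g'" "\<And>x. norm (g x - l.vel s0 i x) \<le> Lb * \<epsilon>" "\<And>x. norm (g x) \<le> BV"
      by blast
    have "AE s in \<tau>. s \<in> {t<..t + h} \<longrightarrow> (\<forall>x. norm (l.vel s i x - g x) \<le> field_error \<epsilon> h \<and>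
      norm (l.vel s i x - r.vel s i x) \<le> velocity_gap \<epsilon> (A * exp (\<gamma> * (t + h))))"
      using S(1)
    proof eventually_elim
      case (elim s)
      show ?case
      proof (intro impI allI conjI)
        fix x assume s: "s \<in> {t<..t + h}"
        have "norm (l.vel s i x - l.vel s0 i x)
          \<le> LV * (real CARD('k) * (\<bar>s - s0\<bar> * (L\<eta> * BV * M) + 2 * M * (L\<eta> * \<epsilon>)))"
          by (rule S(4)[OF elim s0(1)])
        also have "\<dots> \<le> LV * (real CARD('k) * (h * (L\<eta> * BV * M) + 2 * M * (L\<eta> * \<epsilon>)))"
          using s s0 LV L\<eta> BV M by (intro mult_left_mono add_right_mono mult_right_mono) auto
        finally have 1: "norm (l.vel s i x - l.vel s0 i x)
          \<le> LV * (real CARD('k) * (h * (L\<eta> * BV * M) + 2 * M * (L\<eta> * \<epsilon>)))" .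
        have "l.vel s i x - g x = (l.vel s i x - l.vel s0 i x) - (g x - l.vel s0 i x)"
          by simp
        then have "norm (l.vel s i x - g x)
          \<le> norm (l.vel s i x - l.vel s0 i x) + norm (g x - l.vel s0 i x)"
          using norm_triangle_ineq4 by metis
        then show "norm (l.vel s i x - g x) \<le> field_error \<epsilon> h"
          using 1 g(2)[of x] by (simp add: field_error_def)
        have "exp (\<gamma> * s) \<le> exp (\<gamma> * (t + h))" using s \<gamma> by (simp add: mult_left_mono)
        then have "LV * (real CARD('k) * (L\<eta> * (A * exp (\<gamma> * s)) + 2 * M * (L\<eta> * \<epsilon>))) \<le> velocity_gap \<epsilon> (A * exp (\<gamma> * (t + h)))"
          unfolding velocity_gap_def using LV L\<eta> A by (intro mult_left_mono add_right_mono) auto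
        then show "norm (l.vel s i x - r.vel s i x) \<le> velocity_gap \<epsilon> (A * exp (\<gamma> * (t + h)))"
          using S(5)[OF elim] order_trans by blast
      qed
    qed
    then show "euler_field i Kg (field_error \<epsilon> h) (velocity_gap \<epsilon> (A * exp (\<gamma> * (t + h)))) t h"
      unfolding euler_field_def using g by blast
  qed
qed

section \<open>Uniqueness\<close>

text \<open>The rate that makes the Euler estimate a contraction by \<open>1/2\<close> in the weighted norm.\<close>

definition "\<gamma> = 6 * (M * exp (Lb * T) * LV * real CARD('k) * L\<eta>) + 1"

lemma \<gamma>_pos: "0 < \<gamma>"
  using M LV L\<eta> by (simp add: \<gamma>_def add_nonneg_pos)

text \<open>Once the velocity gap is bounded through \<open>A\<close>, the summed step errors split
  into \<open>X\<close>, a multiple of \<open>\<epsilon>\<close> and a multiple of h. The last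
  factor depends on \<open>\<epsilon>\<close> through \<open>Kg\<close>, so h tends to 0
  first.\<close>

lemma gap_bound_halve:
  assumes bound: "gap_bound \<gamma> A" and A: "0 \<le> A"
  shows "gap_bound \<gamma> (A / 2)"
  unfolding gap_bound_def
proof (intro allI ballI impI)
  fix i L K t and \<psi> :: "real^'n \<Rightarrow> real" and \<psi>'
  assume t: "t \<in> {0..T}" and \<psi>: "C11 L K \<psi> \<psi>'"
  note nn = C11_nonneg[OF \<psi>]
  define \<kappa> where "\<kappa> = real CARD('k)"
  define Lm where "Lm = L * exp (Lb * T)"
  \<comment> \<open>The part that survives both limits: the first-order effect of the velocity gap,
    summed by \<open>exp_riemann_sum_le\<close>.\<close>
  define X where "X = M * Lm * LV * \<kappa> * L\<eta> * A * (3 / \<gamma> * exp (\<gamma> * t))"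
  \<comment> \<open>Independent of \<open>\<epsilon>\<close> and of \<open>Kg\<close>, as the second
    limit requires.\<close>
  define c1 where "c1 = 2 * M * Lm * (LV * \<kappa> * 2 * M * L\<eta> + Lb) + M * Lm * LV * \<kappa> * 2 * M * L\<eta>"
  have Lm: "0 \<le> Lm" using nn by (simp add: Lm_def)
  have approx: "\<bar>gap i \<psi> \<psi>' t\<bar> \<le> X + t * (\<epsilon> * c1)" if \<epsilon>: "0 < \<epsilon>" and t0: "0 < t" for \<epsilon>
  proof -
    obtain Kg where Kg: "0 \<le> Kg" "\<And>i s h. 0 < h \<Longrightarrow> 0 \<le> s \<Longrightarrow> s + h \<le> T \<Longrightarrow>
        euler_field i Kg (field_error \<epsilon> h) (velocity_gap \<epsilon> (A * exp (\<gamma> * (s + h)))) s h"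
      using euler_field_exists[OF bound \<epsilon> A less_imp_le[OF \<gamma>_pos]] by blast
    define Km where "Km = (K + 1) * exp ((2 * Lb + Lb\<^sup>2 + L * exp (Lb * T) * Kg) * T)"
    define c2 where "c2 = 2 * M * Lm * LV * \<kappa> * L\<eta> * BV * M + (2 * M * Km * BV\<^sup>2 + 2 * M * BV * (Km * BV + Lm * Lb))"
    have main: "\<bar>gap i \<psi> \<psi>' t\<bar> \<le> X + t * (\<epsilon> * c1 + t * (1 / real m) * c2)" if m: "1 \<le> m" "t \<le> real m" "t * \<gamma> \<le> real m" for m
    proof -
      define h where "h = t / real m"
      have h: "0 < h" "h \<le> 1" "h * \<gamma> \<le> 1" "real m * h = t"
        using m t0 by (auto simp: h_def)
      define E where "E j = velocity_gap \<epsilon> (A * exp (\<gamma> * (real j * h + h)))" for j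
      have E: "0 \<le> E j" for j
        unfolding E_def velocity_gap_def using LV L\<eta> M A \<epsilon> by simp
      have \<delta>: "0 \<le> field_error \<epsilon> h"
        unfolding field_error_def using LV L\<eta> BV M \<epsilon> h Lb_nonneg by simp
      have "euler_field i Kg (field_error \<epsilon> h) (E j) (real j * h) h" if "j < m" for j
        unfolding E_def
      proof (rule Kg(2))
        have "real (Suc j) * h \<le> real m * h" using that h by (intro mult_right_mono) auto
        then show "real j * h + h \<le> T" using h t by (simp add: algebra_simps)
      qed (use h in auto)
      then have "\<bar>gap i \<psi> \<psi>' (real m * h)\<bar> \<le> (\<Sum>j<m. step_error Lm Km (field_error \<epsilon> h) (E j) h)"
        unfolding Lm_def Km_def using h t
        by (intro gap_euler_iterate[OF _ _ _ \<delta> E Kg(1) _ \<psi>]) auto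
      also have "\<dots> = (\<Sum>j<m. h * (\<epsilon> * c1 + h * c2) + M * Lm * LV * \<kappa> * L\<eta> * A * (h * exp (\<gamma> * (real (Suc j) * h))))"
      proof (rule sum.cong[OF refl])
        fix j
        have j: "real j * h + h = real (Suc j) * h" by (simp add: algebra_simps)
        show "step_error Lm Km (field_error \<epsilon> h) (E j) h
          = h * (\<epsilon> * c1 + h * c2) + M * Lm * LV * \<kappa> * L\<eta> * A * (h * exp (\<gamma> * (real (Suc j) * h)))"
          unfolding step_error_def field_error_def E_def velocity_gap_def c1_def c2_def \<kappa>_def[symmetric] j
          by (simp add: algebra_simps)
      qed
      also have "\<dots> = real m * h * (\<epsilon> * c1 + h * c2)
          + M * Lm * LV * \<kappa> * L\<eta> * A * (\<Sum>j<m. h * exp (\<gamma> * (real (Suc j) * h)))"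
        by (simp add: sum.distrib sum_distrib_left)
      also have "\<dots> \<le> real m * h * (\<epsilon> * c1 + h * c2) + M * Lm * LV * \<kappa> * L\<eta> * A * (3 / \<gamma> * exp (\<gamma> * (real m * h)))"
        using M Lm LV L\<eta> A h by (intro add_left_mono mult_left_mono exp_riemann_sum_le \<gamma>_pos) (auto simp: \<kappa>_def)
      finally show ?thesis unfolding h(4) X_def by (simp add: h_def)
    qed
    have "(\<lambda>m. X + t * (\<epsilon> * c1 + t * (1 / real m) * c2)) \<longlonglongrightarrow> X + t * (\<epsilon> * c1 + t * 0 * c2)"
      by (intro tendsto_intros lim_1_over_n)
    then have "\<bar>gap i \<psi> \<psi>' t\<bar> \<le> X + t * (\<epsilon> * c1 + t * 0 * c2)"
    proof (rule LIMSEQ_le_const)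
      \<comment> \<open>From here on the step \<open>t / m\<close> is at most 1 and its product with
        \<open>\<gamma>\<close> is at most 1.\<close>
      obtain N where N: "max 1 (max t (t * \<gamma>)) \<le> real N" using real_arch_simple by blast
      show "\<exists>N. \<forall>m\<ge>N. \<bar>gap i \<psi> \<psi>' t\<bar> \<le> X + t * (\<epsilon> * c1 + t * (1 / real m) * c2)"
      proof (intro exI allI impI)
        fix m assume "N \<le> m"
        then have "real N \<le> real m" by simp
        then show "\<bar>gap i \<psi> \<psi>' t\<bar> \<le> X + t * (\<epsilon> * c1 + t * (1 / real m) * c2)"
          using N by (intro main) auto
      qed
    qed
    then show ?thesis by simp
  qed
  have "\<bar>gap i \<psi> \<psi>' t\<bar> \<le> X"
  proof (cases "t = 0")
    case True
    then show ?thesis using M Lm LV L\<eta> A \<gamma>_pos by (simp add: gap_0 X_def \<kappa>_def)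
  next
    case False
    then have t0: "0 < t" using t by simp
    have "(\<lambda>n. X + t * (1 / real (Suc n) * c1)) \<longlonglongrightarrow> X + t * (0 * c1)"
      by (intro tendsto_intros lim_1_over_n[THEN LIMSEQ_Suc])
    then have "\<bar>gap i \<psi> \<psi>' t\<bar> \<le> X + t * (0 * c1)"
    proof (rule LIMSEQ_le_const)
      have "\<bar>gap i \<psi> \<psi>' t\<bar> \<le> X + t * (1 / real (Suc n) * c1)" for n
        by (rule approx[OF _ t0]) simp
      then show "\<exists>N. \<forall>n\<ge>N. \<bar>gap i \<psi> \<psi>' t\<bar> \<le> X + t * (1 / real (Suc n) * c1)" by blast
    qed
    then show ?thesis by simp
  qed
  also have "X \<le> L * (A / 2 * exp (\<gamma> * t))"
  proof -
    define P where "P = M * exp (Lb * T) * LV * \<kappa> * L\<eta>"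
    \<comment> \<open>By the choice of \<open>\<gamma>\<close>, which equals
      \<open>6 * P + 1\<close>.\<close>
    have "3 * P / \<gamma> \<le> 1 / 2" using \<gamma>_pos by (simp add: divide_le_eq \<gamma>_def P_def \<kappa>_def)
    then have "(3 * P / \<gamma>) * (L * A * exp (\<gamma> * t)) \<le> (1 / 2) * (L * A * exp (\<gamma> * t))"
      using nn A by (intro mult_right_mono) auto
    moreover have "X = (3 * P / \<gamma>) * (L * A * exp (\<gamma> * t))"
      by (simp add: X_def P_def Lm_def)
    ultimately show ?thesis by simp
  qed
  finally show "\<bar>gap i \<psi> \<psi>' t\<bar> \<le> L * (A / 2 * exp (\<gamma> * t))" .
qed

text \<open>Halving a finite bound indefinitely leaves only 0. The first bound is crude: the gap
  vanishes at time 0 and is Lipschitz in time.\<close>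

lemma gap_eq_0:
  assumes "C11 L K \<psi> \<psi>'" "t \<in> {0..T}"
  shows "gap i \<psi> \<psi>' t = 0"
proof -
  define A where "A = 2 * (T * (BV * M))"
  have A: "0 \<le> A" using T BV M by (simp add: A_def)
  have "gap_bound \<gamma> A"
    unfolding gap_bound_def
  proof (intro allI ballI impI)
    fix i L K t and \<psi> :: "real^'n \<Rightarrow> real" and \<psi>'
  assume t: "t \<in> {0..T}" and \<psi>: "C11 L K \<psi> \<psi>'"
    note nn = C11_nonneg[OF \<psi>]
    have "\<bar>gap i \<psi> \<psi>' t\<bar> \<le> 2 * (t * (L * BV * M))"
      using gap_lipschitz[OF \<psi>, of 0 t i] t by (simp add: gap_0)
    also have "\<dots> \<le> 2 * (T * (L * BV * M))"
      using t nn BV M by (intro mult_left_mono mult_right_mono) auto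
    also have "\<dots> = L * (A * 1)" by (simp add: A_def)
    also have "\<dots> \<le> L * (A * exp (\<gamma> * t))"
      using t nn A \<gamma>_pos by (intro mult_left_mono) auto
    finally show "\<bar>gap i \<psi> \<psi>' t\<bar> \<le> L * (A * exp (\<gamma> * t))" .
  qed
  then have "gap_bound \<gamma> (A * (1 / 2) ^ n)" for n
  proof (induction n)
    case (Suc n)
    from gap_bound_halve[OF Suc.IH[OF Suc.prems]] A show ?case by simp
  qed simp
  then have le: "\<bar>gap i \<psi> \<psi>' t\<bar> \<le> L * (A * (1 / 2) ^ n * exp (\<gamma> * t))" for n
    using assms unfolding gap_bound_def by blast
  have "(\<lambda>n. L * (A * (1 / 2) ^ n * exp (\<gamma> * t))) \<longlonglongrightarrow> L * (A * 0 * exp (\<gamma> * t))"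
    by (intro tendsto_intros LIMSEQ_realpow_zero) auto
  then have "\<bar>gap i \<psi> \<psi>' t\<bar> \<le> L * (A * 0 * exp (\<gamma> * t))"
    by (rule LIMSEQ_le_const) (use le in blast)
  then show ?thesis by simp
qed

section \<open>From equal averages to equal measures\<close>

lemma AE_average_eq:
  fixes \<psi> :: "real^'n \<Rightarrow> real"
  assumes "C11 L K \<psi> \<psi>'"
  shows "AE t in \<tau>. (\<integral>x. \<psi> x \<partial>\<rho> t i) = (\<integral>x. \<psi> x \<partial>\<rho>' t i)"
proof -
  have "AE t in \<tau>. t \<in> {0..T}" using AE_space[of \<tau>] by simp
  with l.AE_average_eq_evol[OF assms, of i] r.AE_average_eq_evol[OF assms, of i] show ?thesis
    by eventually_elim (use gap_eq_0[OF assms] in \<open>simp add: gap_def\<close>)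
qed

lemma AE_measure_eq:
  assumes "open U"
  shows "AE t in \<tau>. measure (\<rho> t i) U = measure (\<rho>' t i) U"
proof -
  have space: "AE t in \<tau>. t \<in> {0..T}" using AE_space[of \<tau>] by simp
  show ?thesis
  proof (cases "U = UNIV")
    case True
    \<comment> \<open>The whole space is handled with the constant function 1, since its ramps
      vanish identically.\<close>
    have "blinfun_apply 0 = (\<lambda>v :: real^'n. 0 :: real)" by (simp add: fun_eq_iff)
    then have "C11 0 0 (\<lambda>x. 1 :: real) (\<lambda>x :: real^'n. 0)"
      by (auto simp: C11_def bounded_iff)
    from AE_average_eq[OF this, of i] space show ?thesis
    proof eventually_elim
      case (elim t)
      then show ?case
        using Mplus_D(3)[OF l.\<rho>_Mplus[of t i]] Mplus_D(3)[OF r.\<rho>_Mplus[of t i]] True by simp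
    qed
  next
    case False
    \<comment> \<open>The ramp has Lipschitz constant \<open>n\<close>, so mollifying at scale
      1/(n+1)^2 leaves an error below 1/(n+1).\<close>
    have "\<exists>g g' K. C11 (real n) K g g' \<and> (\<forall>x. norm (g x - ramp U n x) \<le> real n * (1 / (real (Suc n))\<^sup>2)) \<and> (\<forall>x. norm (g x) \<le> 1)" for n
    proof -
      have pos: "0 < 1 / (real (Suc n))\<^sup>2" by simp
      obtain K where "\<And>f :: real^'n \<Rightarrow> real. (\<And>x. norm (f x) \<le> 1) \<Longrightarrow> (\<And>x y. norm (f x - f y) \<le> real n * norm (x - y)) \<Longrightarrow>
        \<exists>g g'. C11 (real n) K g g' \<and> (\<forall>x. norm (g x - f x) \<le> real n * (1 / (real (Suc n))\<^sup>2)) \<and> (\<forall>x. norm (g x) \<le> 1)"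
        using C11_approx[OF pos of_nat_0_le_iff, of 1] by blast
      from this[of "ramp U n"] show ?thesis using abs_ramp_le ramp_lipschitz by (metis real_norm_def)
    qed
    then obtain g g' K where g: "\<And>n. C11 (real n) (K n) (g n) (g' n)"
      "\<And>n x. \<bar>g n x - ramp U n x\<bar> \<le> real n * (1 / (real (Suc n))\<^sup>2)" "\<And>n x. \<bar>g n x\<bar> \<le> 1"
      unfolding real_norm_def by metis
    have lim: "(\<lambda>n. g n x) \<longlonglongrightarrow> indicator U x" for x
    proof -
      have "(\<lambda>n. g n x - ramp U n x) \<longlonglongrightarrow> 0"
      proof (rule Lim_null_comparison[OF _ lim_1_over_n[THEN LIMSEQ_Suc]])
        have "real n * (1 / (real (Suc n))\<^sup>2) \<le> real (Suc n) * (1 / (real (Suc n))\<^sup>2)" for n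
          by (intro mult_right_mono) auto
        then have "real n * (1 / (real (Suc n))\<^sup>2) \<le> 1 / real (Suc n)" for n
          by (simp add: power2_eq_square del: of_nat_Suc)
        then show "\<forall>\<^sub>F n in sequentially. norm (g n x - ramp U n x) \<le> 1 / real (Suc n)"
          using g(2)[of _ x] by (auto intro!: always_eventually order_trans[OF g(2)])
      qed
      from tendsto_add[OF this ramp_tendsto_indicator[OF assms False, of x]] show ?thesis by simp
    qed
    have "AE t in \<tau>. \<forall>n. (\<integral>x. g n x \<partial>\<rho> t i) = (\<integral>x. g n x \<partial>\<rho>' t i)"
      unfolding AE_all_countable using AE_average_eq[OF g(1)] by blast
    with space show ?thesis
    proof eventually_elim
      case (elim t)
      have gm: "g n \<in> borel_measurable borel" for n
        by (intro borel_measurable_continuous_onI C11_continuous_on[OF g(1)])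
      have "(\<lambda>n. \<integral>x. g n x \<partial>\<mu>) \<longlonglongrightarrow> measure \<mu> U" if "\<mu> \<in> Mplus" for \<mu>
        by (rule Mplus_measure_tendsto[OF that gm g(3) lim]) (use assms in simp)
      from this[OF l.\<rho>_Mplus[OF elim(1), of i]] this[OF r.\<rho>_Mplus[OF elim(1), of i]] show ?case
        using LIMSEQ_unique elim(2) by simp
    qed
  qed
qed

text \<open>On a countable intersection-stable generator of the Borel sets only countably many null
  sets are discarded, and finite measures that agree on it, including on the whole space,
  coincide.\<close>

lemma AE_solutions_eq: "AE t in \<tau>. \<rho> t = \<rho>' t"
proof -
  obtain B :: "(real^'n) set set" where B: "countable B" "topological_basis B"
    using ex_countable_basis by blast
  \<comment> \<open>Finite intersections of basis sets; the empty intersection contributes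
    \<open>UNIV\<close>.\<close>
  define P where "P = Inter ` {F. F \<subseteq> B \<and> finite F}"
  have P_open: "open U" if "U \<in> P" for U
    using that topological_basis_open[OF B(2)] by (auto simp: P_def intro!: open_Inter)
  have P_sets: "sigma_sets UNIV P = sets borel"
  proof
    show "sigma_sets UNIV P \<subseteq> sets borel"
      using P_open by (intro sets.sigma_sets_subset[of P borel, simplified]) auto
    have "B \<subseteq> P"
    proof
      fix b assume "b \<in> B"
      then have "{b} \<in> {F. F \<subseteq> B \<and> finite F}" by simp
      then have "\<Inter>{b} \<in> P" unfolding P_def by (rule imageI)
      then show "b \<in> P" by simp
    qed
    then have "sigma_sets UNIV B \<subseteq> sigma_sets UNIV P" by (rule sigma_sets_mono')
    then show "sets borel \<subseteq> sigma_sets UNIV P"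
      by (simp add: borel_eq_countable_basis[OF B])
  qed
  have P_Int: "Int_stable P"
  proof (rule Int_stableI)
    fix a b assume "a \<in> P" "b \<in> P"
    then obtain F G where "F \<subseteq> B" "finite F" "a = \<Inter>F" "G \<subseteq> B" "finite G" "b = \<Inter>G"
      by (auto simp: P_def)
    then have "a \<inter> b = \<Inter>(F \<union> G)" "F \<union> G \<in> {F. F \<subseteq> B \<and> finite F}" by auto
    then show "a \<inter> b \<in> P" unfolding P_def by blast
  qed
  have P_UNIV: "UNIV \<in> P" unfolding P_def by (rule image_eqI[where x="{}"]) auto
  have "countable {F. F \<subseteq> B \<and> finite F}"
    using countable_Collect_finite_subset[OF B(1)] by (simp add: conj_commute)
  then have "countable P" unfolding P_def by (rule countable_image)
  then have "AE t in \<tau>. \<forall>i\<in>UNIV. \<forall>U\<in>P. measure (\<rho> t i) U = measure (\<rho>' t i) U"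
    using P_open by (intro AE_ball_countable' AE_measure_eq) (auto intro: countable_finite)
  moreover have "AE t in \<tau>. t \<in> {0..T}" using AE_space[of \<tau>] by simp
  ultimately show ?thesis
  proof eventually_elim
    case (elim t)
    show ?case
    proof
      fix i
      note l = Mplus_D[OF l.\<rho>_Mplus[OF elim(2), of i]] and r = Mplus_D[OF r.\<rho>_Mplus[OF elim(2), of i]]
      show "\<rho> t i = \<rho>' t i"
      proof (rule measure_eqI_generator_eq[OF P_Int, where \<Omega>=UNIV and A="\<lambda>_. UNIV"])
        show "emeasure (\<rho> t i) U = emeasure (\<rho>' t i) U" if "U \<in> P" for U
          using elim(1) that finite_measure.emeasure_eq_measure[OF l(1)] finite_measure.emeasure_eq_measure[OF r(1)] by simp
        show "emeasure (\<rho> t i) UNIV \<noteq> \<infinity>" for n :: nat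
          using finite_measure.emeasure_finite[OF l(1)] by simp
      qed (use l r P_sets P_UNIV in auto)
    qed
  qed
qed

end

theorem proposition4p6:
  fixes V :: "(real^'n) \<times> (real^'k) \<Rightarrow> (real^'n)^'k"
    and \<eta> :: "real^'n \<Rightarrow> (real^'k)^'k"
    and \<rho>0 :: "'k \<Rightarrow> (real^'n) measure"
    and \<rho> \<rho>' :: "real \<Rightarrow> 'k \<Rightarrow> (real^'n) measure"
    and T :: real
  assumes "\<And>i. \<rho>0 i \<in> Mplus"
    and "V \<in> Linfty \<inter> Lip"
    and "\<eta> \<in> Linfty \<inter> Lip"
    and "T > 0"
    and "weak_measure_solution T V \<eta> \<rho>0 \<rho>"
    and "weak_measure_solution T V \<eta> \<rho>0 \<rho>'"
  shows "AE t in lebesgue_on {0..T}. \<rho> t = \<rho>' t"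
proof -
  obtain BV LV where V: "BV \<ge> 0" "\<And>p. norm (V p) \<le> BV" "LV \<ge> 0" "\<And>p q. norm (V p - V q) \<le> LV * norm (p - q)"
    using Linfty_Lip_bounds[OF assms(2)] by metis
  obtain B\<eta> L\<eta> where \<eta>: "B\<eta> \<ge> 0" "\<And>x. norm (\<eta> x) \<le> B\<eta>" "L\<eta> \<ge> 0" "\<And>x y. norm (\<eta> x - \<eta> y) \<le> L\<eta> * norm (x - y)"
    using Linfty_Lip_bounds[OF assms(3)] by metis
  obtain M1 M2 where M: "AE t in lebesgue_on {0..T}. \<forall>i. measure (\<rho> t i) UNIV \<le> M1"
    "AE t in lebesgue_on {0..T}. \<forall>i. measure (\<rho>' t i) UNIV \<le> M2"
    using assms(5,6) by (auto simp: weak_measure_solution_def Linfty_Mplus_def)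
  \<comment> \<open>One nonnegative mass bound for both solutions, as the shared locale
    demands.\<close>
  define M where "M = max 0 (max M1 M2)"
  have "AE t in lebesgue_on {0..T}. \<forall>i. measure (\<rho> t i) UNIV \<le> M"
    "AE t in lebesgue_on {0..T}. \<forall>i. measure (\<rho>' t i) UNIV \<le> M"
    using M(1) by (rule eventually_mono, simp add: M_def le_max_iff_disj)
      (use M(2) in \<open>rule eventually_mono, simp add: M_def le_max_iff_disj\<close>)
  then interpret two_solutions V \<eta> T M BV LV B\<eta> L\<eta> \<rho>0 \<rho> \<rho>'
    using V \<eta> assms by unfold_locales (auto simp: M_def)
  show ?thesis by (rule AE_solutions_eq)
qed
end
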